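(* Let $E\to M$ and $F\to M$ be smooth vector bundles over the same manifold $M$, and let $D_E\colon\Gamma(E)\to\Gamma(E)$ and $D_F\colon\Gamma(F)\to\Gamma(F)$ be linear derivations with the same symbol $X\in\mathfrak{X}(M)$. Let $D$ be the linear derivation of $E\otimes F$ with symbol $X$ defined by \[ D(e\otimes f)=(D_Ee)\otimes f+e\otimes(D_Ff)\qquad\text{for all }e\in\Gamma(E),\ f\in\Gamma(F). \] Let $\phi\colon\Omega\to M$ be the flow of $X$, and let $\Phi^E$ and $\Phi^F$ be the flows of the linear vector fields $\widehat{D_E}\in\mathfrak{X}^l(E)$ and $\widehat{D_F}\in\mathfrak{X}^l(F)$. Then the flow $\Phi$ of $\widehat D\in\mathfrak{X}^l(E\otimes F)$ is pointwise the tensor product of the flows $\Phi^E$ and $\Phi^F$: it is the fibrewise linear map \[ \Phi\colon\{(t,\tau)\in\mathbb{R}\times(E\otimes F)\mid(t,q_{E\otimes F}(\tau))\in\Omega\}\to E\otimes F \] given on elementary tensors by \[ \Phi(t,e\otimes f)=\Phi^E_t(e)\otimes\Phi^F_t(f) \] for all $x\in M$, $e\in E_x$, $f\in F_x$ and $t\in\mathbb{R}$ with $(t,x)\in\Omega$.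
   Context: All manifolds and vector bundles are smooth and real; flows are maximal flows on their maximal flow domains; $q_{E\otimes F}\colon E\otimes F\to M$ is the bundle projection. A linear derivation of a vector bundle $q_G\colon G\to M$ with symbol $X\in\mathfrak{X}(M)$ is an $\mathbb{R}$-linear map $D\colon\Gamma(G)\to\Gamma(G)$ with $D(hg)=X(h)g+hD(g)$ for all $h\in C^\infty(M)$, $g\in\Gamma(G)$. Its dual derivation $D^*\colon\Gamma(G^* )\to\Gamma(G^* )$ is defined by $\langle D^*\gamma,g\rangle=X\langle\gamma,g\rangle-\langle\gamma,Dg\rangle$. For $\gamma\in\Gamma(G^* )$, $\ell_\gamma\colon G\to\mathbb{R}$ is the fibrewise linear function $g_x\mapsto\langle\gamma(x),g_x\rangle$. A vector field $\chi\colon G\to TG$ is linear over $X$ if it is a morphism of vector bundles from $q_G\colon G\to M$ to $Tq_G\colon TG\to TM$ over $X\colon M\to TM$, where $Tq_G\colon TG\to TM$ carries the vector bundle structure whose addition and scalar multiplications are the tangent maps of those of $G$; $\mathfrak{X}^l(G)$ is the set of these. The linear vector field $\widehat D\in\mathfrak{X}^l(G)$ over $X$ associated with a derivation $D$ of $G$ is the unique vector field on $G$ with $\widehat D(\ell_\gamma)=\ell_{D^*\gamma}$ and $\widehat D(q_G^*h)=q_G^*(X(h))$ for all $\gamma\in\Gamma(G^* )$ and $h\in C^\infty(M)$. The flow of $\widehat D$ on $G$ has flow domain $\{(t,g)\in\mathbb{R}\times G\mid(t,q_G(g))\in\Omega\}$ and at each time $t$ it restricts to linear isomorphisms $G_x\to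 G_{\phi_t(x)}$ for all $x$ with $(t,x)\in\Omega$. *)

theory Defs
  imports "HOL-Analysis.Analysis"
begin

section \<open>Smooth maps between finite-dimensional normed spaces\<close>

text \<open>Model spaces are finite-dimensional real normed spaces rather than members of class
  \<open>euclidean_space\<close>, whose dimension is positive: manifolds of dimension 0 and bundles of rank 0
  are not excluded.\<close>

definition finite_dim :: "'a::real_vector itself \<Rightarrow> bool" where
  "finite_dim _ \<longleftrightarrow> (\<exists>B::'a set. finite B \<and> span B = UNIV)"

primrec Ck_on :: "nat \<Rightarrow> 'a::real_normed_vector set \<Rightarrow> ('a \<Rightarrow> 'b::real_normed_vector) \<Rightarrow> bool" where
  "Ck_on 0 S f \<longleftrightarrow> continuous_on S f"
| "Ck_on (Suc k) S f \<longleftrightarrow> (\<forall>x\<in>S. f differentiable (at x)) \<and>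
     (\<forall>v. Ck_on k S (\<lambda>x. frechet_derivative f (at x) v))"

text \<open>Used for open sets \<open>S\<close> only; the values of \<open>f\<close> outside \<open>S\<close> are then irrelevant.\<close>

definition smooth_on :: "'a::real_normed_vector set \<Rightarrow> ('a \<Rightarrow> 'b::real_normed_vector) \<Rightarrow> bool" where
  "smooth_on S f \<longleftrightarrow> (\<forall>k. Ck_on k S f)"


section \<open>Smooth manifolds\<close>

text \<open>A chart is its domain together with its coordinate map, whose values outside the domain are
  irrelevant. The topology of a manifold is the one determined by the atlas.\<close>

type_synonym ('p, 'a) chart = "'p set \<times> ('p \<Rightarrow> 'a)"

record ('p, 'a) manifold =
  pts :: "'p set"
  atlas :: "('p, 'a) chart set"

definition mtop :: "('p, 'a::real_normed_vector) manifold \<Rightarrow> 'p topology" where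
  "mtop M = topology (\<lambda>W. W \<subseteq> pts M \<and> (\<forall>(U, \<kappa>)\<in>atlas M. open (\<kappa> ` (W \<inter> U))))"

definition smooth_manifold :: "('p, 'a::real_normed_vector) manifold \<Rightarrow> bool" where
  "smooth_manifold M \<longleftrightarrow>
     finite_dim TYPE('a) \<and>
     (\<forall>(U, \<kappa>)\<in>atlas M. U \<subseteq> pts M \<and> inj_on \<kappa> U \<and> open (\<kappa> ` U)) \<and>
     (\<Union>(fst ` atlas M) = pts M) \<and>
     (\<forall>(U, \<kappa>)\<in>atlas M. \<forall>(V, \<mu>)\<in>atlas M.
        open (\<kappa> ` (U \<inter> V)) \<and> smooth_on (\<kappa> ` (U \<inter> V)) (\<mu> \<circ> inv_into U \<kappa>)) \<and>
     Hausdorff_space (mtop M) \<and> second_countable (mtop M)"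

definition charts_at :: "('p, 'a) manifold \<Rightarrow> 'p \<Rightarrow> ('p, 'a) chart set" where
  "charts_at M p = {c \<in> atlas M. p \<in> fst c}"

text \<open>Smoothness of a function with values in a normed space on an open subset \<open>W\<close> of \<open>M\<close>.\<close>

definition smooth_fun_on ::
  "('p, 'a::real_normed_vector) manifold \<Rightarrow> 'p set \<Rightarrow> ('p \<Rightarrow> 'b::real_normed_vector) \<Rightarrow> bool" where
  "smooth_fun_on M W f \<longleftrightarrow>
     (\<forall>(U, \<kappa>)\<in>atlas M. smooth_on (\<kappa> ` (U \<inter> W)) (f \<circ> inv_into U \<kappa>))"

text \<open>Functions and sections are \<open>undefined\<close> outside their domain, so that equality of functions
  and of sections is equality in HOL.\<close>

definition Cinf :: "('p, 'a::real_normed_vector) manifold \<Rightarrow> ('p \<Rightarrow> real) set" where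
  "Cinf M = {h \<in> extensional (pts M). smooth_fun_on M (pts M) h}"


section \<open>Smooth vector bundles\<close>

text \<open>A local trivialization over \<open>U\<close> is a pair \<open>(U, \<psi>)\<close> where \<open>\<psi>\<close> is the second component of
  the usual map from the part of the bundle over \<open>U\<close> to \<open>U \<times> V\<close>.\<close>

record ('p, 'e, 'v) vbundle =
  tspace :: "'e set"
  bproj :: "'e \<Rightarrow> 'p"
  fadd :: "'e \<Rightarrow> 'e \<Rightarrow> 'e"
  fscale :: "real \<Rightarrow> 'e \<Rightarrow> 'e"
  trivs :: "('p set \<times> ('e \<Rightarrow> 'v)) set"

definition fibre :: "('p, 'e, 'v) vbundle \<Rightarrow> 'p \<Rightarrow> 'e set" where
  "fibre E x = {e \<in> tspace E. bproj E e = x}"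

definition triv_inv :: "('p, 'e, 'v) vbundle \<Rightarrow> ('e \<Rightarrow> 'v) \<Rightarrow> 'p \<Rightarrow> 'v \<Rightarrow> 'e" where
  "triv_inv E \<psi> x = inv_into (fibre E x) \<psi>"

text \<open>The vector space axioms for the fibres are not listed: every fibre is closed under the two
  operations, and trivializations are bijections onto a vector space intertwining the operations.\<close>

definition smooth_vector_bundle ::
  "('p, 'a::real_normed_vector) manifold \<Rightarrow> ('p, 'e, 'v::real_normed_vector) vbundle \<Rightarrow> bool" where
  "smooth_vector_bundle M E \<longleftrightarrow>
     smooth_manifold M \<and> finite_dim TYPE('v) \<and>
     bproj E ` tspace E \<subseteq> pts M \<and>
     (\<forall>x\<in>pts M. \<forall>e\<in>fibre E x. \<forall>r.
        fscale E r e \<in> fibre E x \<and> (\<forall>e'\<in>fibre E x. fadd E e e' \<in> fibre E x)) \<and>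
     \<Union>(fst ` trivs E) = pts M \<and>
     (\<forall>(U, \<psi>)\<in>trivs E. openin (mtop M) U \<and>
        (\<forall>x\<in>U. bij_betw \<psi> (fibre E x) UNIV \<and>
          (\<forall>e\<in>fibre E x. \<forall>r. \<psi> (fscale E r e) = r *\<^sub>R \<psi> e) \<and>
          (\<forall>e\<in>fibre E x. \<forall>e'\<in>fibre E x. \<psi> (fadd E e e') = \<psi> e + \<psi> e'))) \<and>
     (\<forall>(U, \<psi>)\<in>trivs E. \<forall>(V, \<theta>)\<in>trivs E. \<forall>v.
        smooth_fun_on M (U \<inter> V) (\<lambda>x. \<theta> (triv_inv E \<psi> x v)))"

text \<open>The total space, as a manifold.\<close>

definition tot ::
  "('p, 'a) manifold \<Rightarrow> ('p, 'e, 'v) vbundle \<Rightarrow> ('e, 'a \<times> 'v) manifold" where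
  "tot M E = \<lparr> pts = tspace E,
     atlas = {({e \<in> tspace E. bproj E e \<in> U \<inter> V}, \<lambda>e. (\<kappa> (bproj E e), \<psi> e)) | U \<kappa> V \<psi>.
                (U, \<kappa>) \<in> atlas M \<and> (V, \<psi>) \<in> trivs E} \<rparr>"

definition sections ::
  "('p, 'a::real_normed_vector) manifold \<Rightarrow> ('p, 'e, 'v::real_normed_vector) vbundle
     \<Rightarrow> ('p \<Rightarrow> 'e) set" where
  "sections M E = {s \<in> (\<Pi>\<^sub>E x\<in>pts M. fibre E x). \<forall>(U, \<psi>)\<in>trivs E. smooth_fun_on M U (\<psi> \<circ> s)}"

definition sec_add ::
  "('p, 'a) manifold \<Rightarrow> ('p, 'e, 'v) vbundle \<Rightarrow> ('p \<Rightarrow> 'e) \<Rightarrow> ('p \<Rightarrow> 'e) \<Rightarrow> 'p \<Rightarrow> 'e" where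
  "sec_add M E s s' = (\<lambda>x\<in>pts M. fadd E (s x) (s' x))"

definition sec_mult ::
  "('p, 'a) manifold \<Rightarrow> ('p, 'e, 'v) vbundle \<Rightarrow> ('p \<Rightarrow> real) \<Rightarrow> ('p \<Rightarrow> 'e) \<Rightarrow> 'p \<Rightarrow> 'e" where
  "sec_mult M E h s = (\<lambda>x\<in>pts M. fscale E (h x) (s x))"


section \<open>Dual bundle, Whitney sum and tensor product\<close>

definition dual_space :: "('p, 'e, 'v) vbundle \<Rightarrow> 'p \<Rightarrow> ('e \<Rightarrow> real) set" where
  "dual_space E x = {\<alpha> \<in> extensional (fibre E x).
     (\<forall>e\<in>fibre E x. \<forall>r. \<alpha> (fscale E r e) = r * \<alpha> e) \<and>
     (\<forall>e\<in>fibre E x. \<forall>e'\<in>fibre E x. \<alpha> (fadd E e e') = \<alpha> e + \<alpha> e')}"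

definition dual_bundle ::
  "('p, 'a) manifold \<Rightarrow> ('p, 'e, 'v::real_normed_vector) vbundle
     \<Rightarrow> ('p, 'p \<times> ('e \<Rightarrow> real), 'v \<Rightarrow>\<^sub>L real) vbundle" where
  "dual_bundle M E = \<lparr>
     tspace = Sigma (pts M) (dual_space E),
     bproj = fst,
     fadd = (\<lambda>(x, \<alpha>) (_, \<beta>). (x, \<lambda>e\<in>fibre E x. \<alpha> e + \<beta> e)),
     fscale = (\<lambda>r (x, \<alpha>). (x, \<lambda>e\<in>fibre E x. r * \<alpha> e)),
     trivs = {(U, \<lambda>(x, \<alpha>). Blinfun (\<lambda>v. \<alpha> (triv_inv E \<psi> x v))) | U \<psi>. (U, \<psi>) \<in> trivs E} \<rparr>"

definition whitney_sum ::
  "('p, 'e, 'v) vbundle \<Rightarrow> ('p, 'f, 'w) vbundle \<Rightarrow> ('p, 'e \<times> 'f, 'v \<times> 'w) vbundle" where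
  "whitney_sum E F = \<lparr>
     tspace = {(e, f). e \<in> tspace E \<and> f \<in> tspace F \<and> bproj E e = bproj F f},
     bproj = (\<lambda>(e, f). bproj E e),
     fadd = (\<lambda>(e, f) (e', f'). (fadd E e e', fadd F f f')),
     fscale = (\<lambda>r (e, f). (fscale E r e, fscale F r f)),
     trivs = {(U \<inter> V, \<lambda>(e, f). (\<psi> e, \<theta> f)) | U \<psi> V \<theta>. (U, \<psi>) \<in> trivs E \<and> (V, \<theta>) \<in> trivs F} \<rparr>"

text \<open>The tensor product of the finite-dimensional spaces \<open>E\<^sub>x\<close> and \<open>F\<^sub>x\<close> is realized as the space
  of bilinear forms on the product of their duals, with \<open>e \<otimes> f = ((\<alpha>, \<beta>) \<mapsto> \<alpha>(e) \<beta>(f))\<close>.\<close>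

definition tensor_space ::
  "('p, 'e, 'v) vbundle \<Rightarrow> ('p, 'f, 'w) vbundle \<Rightarrow> 'p \<Rightarrow> (('e \<Rightarrow> real) \<times> ('f \<Rightarrow> real) \<Rightarrow> real) set" where
  "tensor_space E F x = {b \<in> extensional (dual_space E x \<times> dual_space F x).
     (\<forall>\<alpha>\<in>dual_space E x. \<forall>\<beta>\<in>dual_space F x. \<forall>r.
        b (\<lambda>e\<in>fibre E x. r * \<alpha> e, \<beta>) = r * b (\<alpha>, \<beta>) \<and>
        b (\<alpha>, \<lambda>f\<in>fibre F x. r * \<beta> f) = r * b (\<alpha>, \<beta>) \<and>
        (\<forall>\<alpha>'\<in>dual_space E x. b (\<lambda>e\<in>fibre E x. \<alpha> e + \<alpha>' e, \<beta>) = b (\<alpha>, \<beta>) + b (\<alpha>', \<beta>)) \<and>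
        (\<forall>\<beta>'\<in>dual_space F x. b (\<alpha>, \<lambda>f\<in>fibre F x. \<beta> f + \<beta>' f) = b (\<alpha>, \<beta>) + b (\<alpha>, \<beta>')))}"

definition tensor_bundle ::
  "('p, 'a) manifold \<Rightarrow> ('p, 'e, 'v::real_normed_vector) vbundle \<Rightarrow>
   ('p, 'f, 'w::real_normed_vector) vbundle \<Rightarrow>
   ('p, 'p \<times> (('e \<Rightarrow> real) \<times> ('f \<Rightarrow> real) \<Rightarrow> real),
    ('v \<Rightarrow>\<^sub>L real) \<Rightarrow>\<^sub>L ('w \<Rightarrow>\<^sub>L real) \<Rightarrow>\<^sub>L real) vbundle" where
  "tensor_bundle M E F = \<lparr>
     tspace = Sigma (pts M) (tensor_space E F),
     bproj = fst,
     fadd = (\<lambda>(x, b) (_, b'). (x, \<lambda>z\<in>dual_space E x \<times> dual_space F x. b z + b' z)),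
     fscale = (\<lambda>r (x, b). (x, \<lambda>z\<in>dual_space E x \<times> dual_space F x. r * b z)),
     trivs = {(U \<inter> V, \<lambda>(x, b). Blinfun (\<lambda>k. Blinfun (\<lambda>l.
                  b (\<lambda>e\<in>fibre E x. blinfun_apply k (\<psi> e), \<lambda>f\<in>fibre F x. blinfun_apply l (\<theta> f)))))
              | U \<psi> V \<theta>. (U, \<psi>) \<in> trivs E \<and> (V, \<theta>) \<in> trivs F} \<rparr>"

definition tensor ::
  "('p, 'e, 'v) vbundle \<Rightarrow> ('p, 'f, 'w) vbundle \<Rightarrow> 'e \<Rightarrow> 'f
     \<Rightarrow> 'p \<times> (('e \<Rightarrow> real) \<times> ('f \<Rightarrow> real) \<Rightarrow> real)" where
  "tensor E F e f = (bproj E e,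
     \<lambda>(\<alpha>, \<beta>)\<in>dual_space E (bproj E e) \<times> dual_space F (bproj E e). \<alpha> e * \<beta> f)"

definition sec_tensor ::
  "('p, 'a) manifold \<Rightarrow> ('p, 'e, 'v) vbundle \<Rightarrow> ('p, 'f, 'w) vbundle \<Rightarrow> ('p \<Rightarrow> 'e) \<Rightarrow> ('p \<Rightarrow> 'f)
     \<Rightarrow> 'p \<Rightarrow> 'p \<times> (('e \<Rightarrow> real) \<times> ('f \<Rightarrow> real) \<Rightarrow> real)" where
  "sec_tensor M E F s t = (\<lambda>x\<in>pts M. tensor E F (s x) (t x))"


section \<open>Tangent bundle, tangent maps and vector fields\<close>

text \<open>A tangent vector at \<open>p\<close> is a family of coordinate vectors, one for every chart around \<open>p\<close>,
  related by the derivatives of the coordinate changes.\<close>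

definition tangent_space ::
  "('p, 'a::real_normed_vector) manifold \<Rightarrow> 'p \<Rightarrow> (('p, 'a) chart \<Rightarrow> 'a) set" where
  "tangent_space M p = {v \<in> extensional (charts_at M p).
     \<forall>(U, \<kappa>)\<in>charts_at M p. \<forall>(V, \<mu>)\<in>charts_at M p.
       v (V, \<mu>) = frechet_derivative (\<mu> \<circ> inv_into U \<kappa>) (at (\<kappa> p)) (v (U, \<kappa>))}"

definition tangent_bundle ::
  "('p, 'a::real_normed_vector) manifold \<Rightarrow> ('p, 'p \<times> (('p, 'a) chart \<Rightarrow> 'a), 'a) vbundle" where
  "tangent_bundle M = \<lparr>
     tspace = Sigma (pts M) (tangent_space M),
     bproj = fst,
     fadd = (\<lambda>(p, v) (_, w). (p, \<lambda>c\<in>charts_at M p. v c + w c)),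
     fscale = (\<lambda>r (p, v). (p, \<lambda>c\<in>charts_at M p. r *\<^sub>R v c)),
     trivs = {(fst c, \<lambda>\<xi>. snd \<xi> c) | c. c \<in> atlas M} \<rparr>"

definition vector_fields ::
  "('p, 'a::real_normed_vector) manifold \<Rightarrow> ('p \<Rightarrow> 'p \<times> (('p, 'a) chart \<Rightarrow> 'a)) set" where
  "vector_fields M = sections M (tangent_bundle M)"

definition tangent_map ::
  "('p, 'a::real_normed_vector) manifold \<Rightarrow> ('q, 'b::real_normed_vector) manifold \<Rightarrow> ('p \<Rightarrow> 'q) \<Rightarrow>
   'p \<times> (('p, 'a) chart \<Rightarrow> 'a) \<Rightarrow> 'q \<times> (('q, 'b) chart \<Rightarrow> 'b)" where
  "tangent_map M N f = (\<lambda>(p, v). (f p, \<lambda>(V, \<mu>)\<in>charts_at N (f p).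
     (let (U, \<kappa>) = (SOME c. c \<in> charts_at M p)
      in frechet_derivative (\<mu> \<circ> f \<circ> inv_into U \<kappa>) (at (\<kappa> p)) (v (U, \<kappa>)))))"

text \<open>The function \<open>X(h)\<close>.\<close>

definition vf_apply ::
  "('p, 'a::real_normed_vector) manifold \<Rightarrow> ('p \<Rightarrow> 'p \<times> (('p, 'a) chart \<Rightarrow> 'a)) \<Rightarrow>
   ('p \<Rightarrow> real) \<Rightarrow> 'p \<Rightarrow> real" where
  "vf_apply M X h = (\<lambda>p\<in>pts M.
     (let (U, \<kappa>) = (SOME c. c \<in> charts_at M p)
      in frechet_derivative (h \<circ> inv_into U \<kappa>) (at (\<kappa> p)) (snd (X p) (U, \<kappa>))))"


section \<open>Flows\<close>

definition integral_curve ::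
  "('p, 'a::real_normed_vector) manifold \<Rightarrow> ('p \<Rightarrow> 'p \<times> (('p, 'a) chart \<Rightarrow> 'a)) \<Rightarrow>
   real set \<Rightarrow> (real \<Rightarrow> 'p) \<Rightarrow> bool" where
  "integral_curve M X J c \<longleftrightarrow>
     continuous_map (top_of_set J) (mtop M) c \<and>
     (\<forall>t\<in>J. \<forall>(U, \<kappa>)\<in>charts_at M (c t).
        ((\<kappa> \<circ> c) has_vector_derivative snd (X (c t)) (U, \<kappa>)) (at t))"

text \<open>The maximal flow: \<open>(t, p)\<close> is in the flow domain iff some integral curve through \<open>p\<close> at time 0
  is defined on an open interval containing 0 and \<open>t\<close>; all such curves agree at \<open>t\<close>.\<close>

definition reaches ::
  "('p, 'a::real_normed_vector) manifold \<Rightarrow> ('p \<Rightarrow> 'p \<times> (('p, 'a) chart \<Rightarrow> 'a)) \<Rightarrow>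
   real \<Rightarrow> 'p \<Rightarrow> 'p \<Rightarrow> bool" where
  "reaches M X t p y \<longleftrightarrow>
     (\<exists>J c. open J \<and> is_interval J \<and> 0 \<in> J \<and> t \<in> J \<and> integral_curve M X J c \<and> c 0 = p \<and> c t = y)"

definition flow_dom ::
  "('p, 'a::real_normed_vector) manifold \<Rightarrow> ('p \<Rightarrow> 'p \<times> (('p, 'a) chart \<Rightarrow> 'a)) \<Rightarrow>
   (real \<times> 'p) set" where
  "flow_dom M X = {(t, p). p \<in> pts M \<and> (\<exists>y. reaches M X t p y)}"

definition flow ::
  "('p, 'a::real_normed_vector) manifold \<Rightarrow> ('p \<Rightarrow> 'p \<times> (('p, 'a) chart \<Rightarrow> 'a)) \<Rightarrow>
   real \<Rightarrow> 'p \<Rightarrow> 'p" where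
  "flow M X t p = (THE y. reaches M X t p y)"


section \<open>Linear derivations and linear vector fields\<close>

definition linear_derivation ::
  "('p, 'a::real_normed_vector) manifold \<Rightarrow> ('p, 'e, 'v::real_normed_vector) vbundle \<Rightarrow>
   ('p \<Rightarrow> 'p \<times> (('p, 'a) chart \<Rightarrow> 'a)) \<Rightarrow> (('p \<Rightarrow> 'e) \<Rightarrow> ('p \<Rightarrow> 'e)) \<Rightarrow> bool" where
  "linear_derivation M G X D \<longleftrightarrow>
     X \<in> vector_fields M \<and>
     D \<in> sections M G \<rightarrow> sections M G \<and>
     (\<forall>s\<in>sections M G. \<forall>s'\<in>sections M G. D (sec_add M G s s') = sec_add M G (D s) (D s')) \<and>
     (\<forall>s\<in>sections M G. \<forall>r. D (sec_mult M G (\<lambda>_. r) s) = sec_mult M G (\<lambda>_. r) (D s)) \<and>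
     (\<forall>h\<in>Cinf M. \<forall>s\<in>sections M G.
        D (sec_mult M G h s) = sec_add M G (sec_mult M G (vf_apply M X h) s) (sec_mult M G h (D s)))"

definition pairing ::
  "('p, 'a) manifold \<Rightarrow> ('p \<Rightarrow> 'p \<times> ('e \<Rightarrow> real)) \<Rightarrow> ('p \<Rightarrow> 'e) \<Rightarrow> 'p \<Rightarrow> real" where
  "pairing M \<gamma> s = (\<lambda>x\<in>pts M. snd (\<gamma> x) (s x))"

definition dual_derivation ::
  "('p, 'a::real_normed_vector) manifold \<Rightarrow> ('p, 'e, 'v::real_normed_vector) vbundle \<Rightarrow>
   ('p \<Rightarrow> 'p \<times> (('p, 'a) chart \<Rightarrow> 'a)) \<Rightarrow> (('p \<Rightarrow> 'e) \<Rightarrow> ('p \<Rightarrow> 'e)) \<Rightarrow>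
   ('p \<Rightarrow> 'p \<times> ('e \<Rightarrow> real)) \<Rightarrow> ('p \<Rightarrow> 'p \<times> ('e \<Rightarrow> real))" where
  "dual_derivation M G X D \<gamma> = (THE \<delta>. \<delta> \<in> sections M (dual_bundle M G) \<and>
     (\<forall>s\<in>sections M G. \<forall>x\<in>pts M.
        pairing M \<delta> s x = vf_apply M X (pairing M \<gamma> s) x - pairing M \<gamma> (D s) x))"

text \<open>The fibrewise linear function \<open>\<ell>\<^sub>\<gamma>\<close> and the pullback of a function to the total space.\<close>

definition ell :: "('p, 'e, 'v) vbundle \<Rightarrow> ('p \<Rightarrow> 'p \<times> ('e \<Rightarrow> real)) \<Rightarrow> 'e \<Rightarrow> real" where
  "ell G \<gamma> = (\<lambda>g\<in>tspace G. snd (\<gamma> (bproj G g)) g)"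

definition pullback :: "('p, 'e, 'v) vbundle \<Rightarrow> ('p \<Rightarrow> real) \<Rightarrow> 'e \<Rightarrow> real" where
  "pullback G h = (\<lambda>g\<in>tspace G. h (bproj G g))"

text \<open>Addition of \<open>TG \<rightarrow> TM\<close>: the tangent map of the addition \<open>G \<oplus> G \<rightarrow> G\<close>, where the tangent
  bundle of \<open>G \<oplus> G = G \<times>\<^sub>M G\<close> is identified with the fibre product of \<open>TG\<close> with itself over \<open>TM\<close>
  by means of the tangent maps of the two projections.\<close>

definition prolonged_add ::
  "('p, 'a::real_normed_vector) manifold \<Rightarrow> ('p, 'e, 'v::real_normed_vector) vbundle \<Rightarrow>
   'e \<times> (('e, 'a \<times> 'v) chart \<Rightarrow> 'a \<times> 'v) \<Rightarrow> 'e \<times> (('e, 'a \<times> 'v) chart \<Rightarrow> 'a \<times> 'v) \<Rightarrow>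
   'e \<times> (('e, 'a \<times> 'v) chart \<Rightarrow> 'a \<times> 'v)" where
  "prolonged_add M G \<xi> \<eta> =
     (let P = tot M (whitney_sum G G)
      in tangent_map P (tot M G) (\<lambda>(g, g'). fadd G g g')
           (THE \<zeta>. \<zeta> \<in> tspace (tangent_bundle P) \<and>
              tangent_map P (tot M G) fst \<zeta> = \<xi> \<and> tangent_map P (tot M G) snd \<zeta> = \<eta>))"

definition linear_vector_field ::
  "('p, 'a::real_normed_vector) manifold \<Rightarrow> ('p, 'e, 'v::real_normed_vector) vbundle \<Rightarrow>
   ('p \<Rightarrow> 'p \<times> (('p, 'a) chart \<Rightarrow> 'a)) \<Rightarrow>
   ('e \<Rightarrow> 'e \<times> (('e, 'a \<times> 'v) chart \<Rightarrow> 'a \<times> 'v)) \<Rightarrow> bool" where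
  "linear_vector_field M G X \<Xi> \<longleftrightarrow>
     X \<in> vector_fields M \<and> \<Xi> \<in> vector_fields (tot M G) \<and>
     (\<forall>g\<in>tspace G. tangent_map (tot M G) M (bproj G) (\<Xi> g) = X (bproj G g)) \<and>
     (\<forall>g\<in>tspace G. \<forall>r.
        \<Xi> (fscale G r g) = tangent_map (tot M G) (tot M G) (fscale G r) (\<Xi> g)) \<and>
     (\<forall>g\<in>tspace G. \<forall>g'\<in>tspace G. bproj G g = bproj G g' \<longrightarrow>
        \<Xi> (fadd G g g') = prolonged_add M G (\<Xi> g) (\<Xi> g'))"

text \<open>\<open>\<Xi>\<close> is the linear vector field over \<open>X\<close> associated with the derivation \<open>D\<close> with symbol \<open>X\<close>.\<close>

definition associated_vector_field ::
  "('p, 'a::real_normed_vector) manifold \<Rightarrow> ('p, 'e, 'v::real_normed_vector) vbundle \<Rightarrow>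
   ('p \<Rightarrow> 'p \<times> (('p, 'a) chart \<Rightarrow> 'a)) \<Rightarrow> (('p \<Rightarrow> 'e) \<Rightarrow> ('p \<Rightarrow> 'e)) \<Rightarrow>
   ('e \<Rightarrow> 'e \<times> (('e, 'a \<times> 'v) chart \<Rightarrow> 'a \<times> 'v)) \<Rightarrow> bool" where
  "associated_vector_field M G X D \<Xi> \<longleftrightarrow>
     linear_vector_field M G X \<Xi> \<and>
     (\<forall>\<gamma>\<in>sections M (dual_bundle M G).
        vf_apply (tot M G) \<Xi> (ell G \<gamma>) = ell G (dual_derivation M G X D \<gamma>)) \<and>
     (\<forall>h\<in>Cinf M. vf_apply (tot M G) \<Xi> (pullback G h) = pullback G (vf_apply M X h))"

end

theory Submission
  imports Defs
begin

text \<open>Over an integral curve \<open>c\<close> of \<open>X\<close>, the integral curves of the linear vector field of a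
  derivation are lifts of \<open>c\<close>, and in a trivialization they are the solutions of a linear
  differential equation. Hence they exist as long as \<open>c\<close> does, are unique, and depend linearly on
  the initial value. By means of bump functions there are global sections through every point and
  global dual sections through every covector; testing \<open>\<Xi> \<ell>\<^sub>\<gamma>\<close> against them shows that the vertical
  part of \<open>\<Xi>\<close> at \<open>s x\<close> is the derivative of the section \<open>s\<close> along \<open>X\<close> minus \<open>D s\<close>. For a section
  \<open>e \<otimes> f\<close>, the Leibniz rules of the derivative and of \<open>D\<close> then show that the tensor product of a
  lift to \<open>E\<close> and a lift to \<open>F\<close> is a lift to \<open>E \<otimes> F\<close>, and uniqueness identifies the flows.\<close>

section \<open>Finite-dimensional normed spaces\<close>

text \<open>Two obstacles shape the argument. The dual derivation is a definite description, so
  \<open>\<Xi>\<close> can be evaluated on fibrewise linear functions only once it is known that s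
  |-> X<\<gamma>, s> - <\<gamma>, D s> comes from a dual section; this is the tensoriality statement
  of the locale \<open>function_linear\<close>. And no separation property of total spaces is
  established: uniqueness of curves there comes from uniqueness in the Hausdorff base, followed by a
  linear equation in the fibre. Existence is needed for linear equations only, because a point of
  the flow domain of \<open>X\<close> already carries a curve in \<open>M\<close>. The length on
  which the contraction works depends on the operator bound and not on the initial vector, which is
  why a lift cannot stop before its base curve. Model spaces carry just a norm, so bases with
  bounded coordinate functionals replace orthonormal ones: they turn smoothness, linearity and
  operator bounds into statements about finite sums. The Leibniz rule is assumed for global
  elementary tensors, hence the need for global sections with prescribed values.\<close>

lemma compact_coefficient_box:
  fixes B :: "'a::real_normed_vector set"
  assumes "finite B"
  shows "compact {\<Sum>b\<in>B. c b *\<^sub>R b | c. \<forall>b\<in>B. \<bar>c b\<bar> \<le> r}"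
  using assms
proof (induct B)
  case empty
  then show ?case by simp
next
  case (insert a B)
  let ?K = "\<lambda>B. {\<Sum>b\<in>B. c b *\<^sub>R b | c. \<forall>b\<in>B. \<bar>c b\<bar> \<le> r}"
  \<comment> \<open>The box over \<open>insert a B\<close> is the Minkowski sum of a compact segment
    along \<open>a\<close> and the box over \<open>B\<close>.\<close>
  have "compact ((\<lambda>t. t *\<^sub>R a) ` {-r..r})"
    by (intro compact_continuous_image continuous_intros) auto
  then have "compact {x + y | x y. x \<in> (\<lambda>t. t *\<^sub>R a) ` {-r..r} \<and> y \<in> ?K B}"
    using insert(3) by (rule compact_sums)
  also have "{x + y | x y. x \<in> (\<lambda>t. t *\<^sub>R a) ` {-r..r} \<and> y \<in> ?K B} = ?K (insert a B)"
  proof (intro set_eqI iffI)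
    fix z assume "z \<in> {x + y | x y. x \<in> (\<lambda>t. t *\<^sub>R a) ` {-r..r} \<and> y \<in> ?K B}"
    then obtain t c where z: "z = t *\<^sub>R a + (\<Sum>b\<in>B. c b *\<^sub>R b)" "t \<in> {-r..r}" "\<forall>b\<in>B. \<bar>c b\<bar> \<le> r"
      by auto
    have "(\<Sum>b\<in>B. (c(a := t)) b *\<^sub>R b) = (\<Sum>b\<in>B. c b *\<^sub>R b)"
      using insert(2) by (intro sum.cong) auto
    then have "z = (\<Sum>b\<in>insert a B. (c(a := t)) b *\<^sub>R b)"
      using insert(1,2) z(1) by simp
    moreover have "\<forall>b\<in>insert a B. \<bar>(c(a := t)) b\<bar> \<le> r" using z by auto
    ultimately show "z \<in> ?K (insert a B)" by blast
  next
    fix z assume "z \<in> ?K (insert a B)"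
    then obtain c where z: "z = (\<Sum>b\<in>insert a B. c b *\<^sub>R b)" "\<forall>b\<in>insert a B. \<bar>c b\<bar> \<le> r"
      by auto
    have "z = c a *\<^sub>R a + (\<Sum>b\<in>B. c b *\<^sub>R b)" "c a \<in> {-r..r}"
      using z insert(1,2) by auto
    moreover have "(\<Sum>b\<in>B. c b *\<^sub>R b) \<in> ?K B" using z by auto
    ultimately show "z \<in> {x + y | x y. x \<in> (\<lambda>t. t *\<^sub>R a) ` {-r..r} \<and> y \<in> ?K B}" by blast
  qed
  finally show ?case .
qed

text \<open>The content is the boundedness of the coordinate functionals, that is, the equivalence
  of the given norm with the coefficient norm. \<open>B\<close> may be empty, so dimension 0 is
  covered.\<close>

lemma finite_dim_coordinates:
  assumes "finite_dim TYPE('a::real_normed_vector)"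
  obtains B :: "'a::real_normed_vector set" and c :: "'a::real_normed_vector \<Rightarrow> 'a::real_normed_vector \<Rightarrow>\<^sub>L real"
  where "finite B" "\<And>x. (\<Sum>b\<in>B. c b x *\<^sub>R b) = x"
proof -
  obtain B0 :: "'a set" where B0: "finite B0" "span B0 = UNIV"
    using assms unfolding finite_dim_def by auto
  obtain B where B: "B \<subseteq> B0" "independent B" "span B = UNIV"
    using maximal_independent_subset[of B0] B0(2)
    by (metis span_mono span_span subset_UNIV subset_antisym)
  have fin: "finite B" using B(1) B0(1) finite_subset by blast
  let ?K = "\<lambda>B. {\<Sum>b\<in>B. c b *\<^sub>R b | c. \<forall>b\<in>B. \<bar>c b\<bar> \<le> (1::real)}"
  \<comment> \<open>One coefficient is exactly 1 and the others lie in [-1, 1]: a union of faces of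
    the coefficient cube, compact and, by independence of \<open>B\<close>, free of 0. It takes the
    place of the unit sphere in the usual proof that norms are equivalent.\<close>
  define S where "S = (\<Union>a\<in>B. (\<lambda>y. a + y) ` ?K (B - {a}))"
  have "compact S"
    unfolding S_def using fin
    by (intro compact_UN compact_continuous_image compact_coefficient_box continuous_intros) auto
  moreover have "0 \<notin> S"
  proof
    assume "0 \<in> S"
    then obtain a c where a: "a \<in> B" "0 = a + (\<Sum>b\<in>B - {a}. c b *\<^sub>R b)"
      unfolding S_def by auto
    then have "a = - (\<Sum>b\<in>B - {a}. c b *\<^sub>R b)" by (simp add: eq_neg_iff_add_eq_0)
    moreover have "(\<Sum>b\<in>B - {a}. c b *\<^sub>R b) \<in> span (B - {a})"
      by (intro span_sum span_scale span_base)
    ultimately have "a \<in> span (B - {a})" by (metis span_neg)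
    then show False using a(1) B(2) dependent_def by blast
  qed
  ultimately have "open (- S)" "0 \<in> - S" by (auto dest: compact_imp_closed)
  then obtain d where d: "d > 0" "ball 0 d \<subseteq> - S" using openE by blast
  have dS: "d \<le> norm s" if "s \<in> S" for s
    using d(2) that by (force simp: not_less[symmetric])
  let ?r = "representation B"
  have bound: "\<bar>?r x b\<bar> \<le> norm x * (1 / d)" if b: "b \<in> B" for x b
  proof -
    \<comment> \<open>Dividing \<open>x\<close> by its coefficient of largest modulus moves it into
      \<open>S\<close>. The lower bound \<open>d\<close> on \<open>S\<close> then bounds that
      coefficient, and with it all the others.\<close>
    define m where "m = Max ((\<lambda>b. \<bar>?r x b\<bar>) ` B)"
    have ne: "(\<lambda>b. \<bar>?r x b\<bar>) ` B \<noteq> {}" using b by auto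
    have "m \<in> (\<lambda>b. \<bar>?r x b\<bar>) ` B" unfolding m_def using fin ne by (intro Max_in) auto
    then obtain a where a: "a \<in> B" "\<bar>?r x a\<bar> = m" by auto
    have le: "\<bar>?r x b\<bar> \<le> \<bar>?r x a\<bar>" if "b \<in> B" for b
      using a(2) fin that by (simp add: m_def)
    show ?thesis
    proof (cases "?r x a = 0")
      case True
      then show ?thesis using le[OF b] d(1) by simp
    next
      case False
      have "x = (\<Sum>b\<in>B. ?r x b *\<^sub>R b)"
        using sum_representation_eq[OF B(2), of x B] B(3) fin by auto
      also have "\<dots> = ?r x a *\<^sub>R a + (\<Sum>b\<in>B - {a}. ?r x b *\<^sub>R b)"
        using fin a(1) by (simp add: sum.remove)
      finally have "(1 / ?r x a) *\<^sub>R x = (1 / ?r x a) *\<^sub>R (?r x a *\<^sub>R a + (\<Sum>b\<in>B - {a}. ?r x b *\<^sub>R b))"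
        by simp
      also have "\<dots> = a + (\<Sum>b\<in>B - {a}. (?r x b / ?r x a) *\<^sub>R b)"
        using False by (simp add: scaleR_right_distrib scaleR_sum_right)
      also have "\<dots> \<in> S"
        unfolding S_def using a(1) le False
        by (intro UN_I[of a] imageI) (auto intro!: exI[of _ "\<lambda>b. ?r x b / ?r x a"] simp: divide_le_eq_1)
      finally have "d \<le> norm ((1 / ?r x a) *\<^sub>R x)" by (rule dS)
      then have "\<bar>?r x a\<bar> \<le> norm x * (1 / d)"
        using False d(1) by (simp add: field_simps)
      then show ?thesis using le[OF b] by linarith
    qed
  qed
  define c where "c b = Blinfun (\<lambda>x. ?r x b)" for b
  have bl: "bounded_linear (\<lambda>x. ?r x b)" if "b \<in> B" for b
    using bound[OF that] B(2,3)
    by (intro bounded_linear_intro[where K = "1 / d"])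
      (auto simp: representation_add representation_scale)
  have "(\<Sum>b\<in>B. c b x *\<^sub>R b) = x" for x
  proof -
    have "(\<Sum>b\<in>B. c b x *\<^sub>R b) = (\<Sum>b\<in>B. ?r x b *\<^sub>R b)"
      by (intro sum.cong refl) (simp add: c_def bounded_linear_Blinfun_apply[OF bl])
    also have "\<dots> = x" using sum_representation_eq[OF B(2), of x B] B(3) fin by auto
    finally show ?thesis .
  qed
  with fin show ?thesis by (rule that)
qed

section \<open>Bounded linear maps and finite-dimensional spaces built from others\<close>

lemma finite_dim_real: "finite_dim TYPE(real)"
proof -
  have "x \<in> span {1}" for x :: real
    using span_scale[OF span_base, of 1 "{1::real}" x] by simp
  then show ?thesis unfolding finite_dim_def by (intro exI[of _ "{1}"]) auto
qed

text \<open>In coordinates \<open>f\<close> is a finite sum of bounded functionals times fixed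
  vectors. This is what makes \<open>Blinfun\<close> return the intended map in every
  trivialization.\<close>

lemma finite_dim_linear_bounded:
  fixes f :: "'a::real_normed_vector \<Rightarrow> 'b::real_normed_vector"
  assumes "finite_dim TYPE('a)" "linear f"
  shows "bounded_linear f"
proof -
  obtain B and c :: "'a \<Rightarrow> 'a \<Rightarrow>\<^sub>L real" where B: "\<And>x. (\<Sum>b\<in>B. c b x *\<^sub>R b) = x"
    using finite_dim_coordinates[OF assms(1)] by metis
  have "f = (\<lambda>x. \<Sum>b\<in>B. c b x *\<^sub>R f b)"
  proof
    fix x
    have "f x = f (\<Sum>b\<in>B. c b x *\<^sub>R b)" by (simp add: B)
    also have "\<dots> = (\<Sum>b\<in>B. c b x *\<^sub>R f b)"
      using assms(2) by (simp add: linear_sum linear_scale)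
    finally show "f x = (\<Sum>b\<in>B. c b x *\<^sub>R f b)" .
  qed
  moreover have "bounded_linear (\<lambda>x. \<Sum>b\<in>B. c b x *\<^sub>R f b)"
    by (intro bounded_linear_sum bounded_linear_scaleR_left[THEN bounded_linear_compose]
        blinfun.bounded_linear_right)
  ultimately show ?thesis by simp
qed

text \<open>Writes an operator as a sum of rank-one operators that depends on it only through the
  values \<open>k b\<close>. Smoothness of an operator-valued map for the operator norm thereby
  reduces to smoothness of its evaluations at fixed vectors.\<close>

lemma blinfun_expansion:
  fixes B :: "'v::real_normed_vector set" and c :: "'v \<Rightarrow> 'v \<Rightarrow>\<^sub>L real"
    and k :: "'v \<Rightarrow>\<^sub>L 'w::real_normed_vector"
  assumes "\<And>x. (\<Sum>b\<in>B. c b x *\<^sub>R b) = x"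
  shows "k = (\<Sum>b\<in>B. blinfun_scaleR_left (k b) o\<^sub>L c b)"
proof (rule blinfun_eqI)
  fix v
  have "k v = k (\<Sum>b\<in>B. c b v *\<^sub>R b)" by (simp add: assms)
  also have "\<dots> = (\<Sum>b\<in>B. c b v *\<^sub>R k b)"
    by (simp add: blinfun.sum_right blinfun.scaleR_right)
  finally show "k v = (\<Sum>b\<in>B. blinfun_scaleR_left (k b) o\<^sub>L c b) v"
    by (simp add: blinfun.sum_left)
qed

lemma bounded_linear_rank_one:
  "bounded_linear (\<lambda>w. blinfun_scaleR_left w o\<^sub>L k)"
  by (intro bounded_linear_compose[OF bounded_bilinear.bounded_linear_left[OF bounded_bilinear_blinfun_compose]]
      bounded_linear_blinfun_scaleR_left)

lemma finite_dim_blinfun: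
  assumes "finite_dim TYPE('v::real_normed_vector)" "finite_dim TYPE('w::real_normed_vector)"
  shows "finite_dim TYPE('v \<Rightarrow>\<^sub>L 'w)"
proof -
  obtain B and c :: "'v \<Rightarrow> 'v \<Rightarrow>\<^sub>L real" where B: "finite B" "\<And>x. (\<Sum>b\<in>B. c b x *\<^sub>R b) = x"
    using finite_dim_coordinates[OF assms(1)] by metis
  obtain C and d :: "'w \<Rightarrow> 'w \<Rightarrow>\<^sub>L real" where C: "finite C" "\<And>x. (\<Sum>b\<in>C. d b x *\<^sub>R b) = x"
    using finite_dim_coordinates[OF assms(2)] by metis
  let ?e = "\<lambda>w b. blinfun_scaleR_left w o\<^sub>L c b"
  have "k \<in> span ((\<lambda>(w, b). ?e w b) ` (C \<times> B))" for k :: "'v \<Rightarrow>\<^sub>L 'w"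
  proof -
    have lin: "linear (\<lambda>w. ?e w b)" for b by (rule bounded_linear.linear[OF bounded_linear_rank_one])
    have "k = (\<Sum>b\<in>B. ?e (\<Sum>w\<in>C. d w (k b) *\<^sub>R w) b)"
      using blinfun_expansion[OF B(2)] C(2) by simp
    also have "\<dots> = (\<Sum>b\<in>B. \<Sum>w\<in>C. d w (k b) *\<^sub>R ?e w b)"
      by (simp add: linear_sum[OF lin] linear_scale[OF lin])
    also have "\<dots> \<in> span ((\<lambda>(w, b). ?e w b) ` (C \<times> B))"
      by (intro span_sum span_scale span_base) force
    finally show ?thesis .
  qed
  then show ?thesis unfolding finite_dim_def
    using B(1) C(1) by (intro exI[of _ "(\<lambda>(w, b). ?e w b) ` (C \<times> B)"]) auto
qed

lemma finite_dim_prod: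
  assumes "finite_dim TYPE('a::real_normed_vector)" "finite_dim TYPE('b::real_normed_vector)"
  shows "finite_dim TYPE('a \<times> 'b)"
proof -
  obtain B :: "'a set" and C :: "'b set" where B: "finite B" "span B = UNIV" "finite C" "span C = UNIV"
    using assms unfolding finite_dim_def by auto
  let ?S = "(\<lambda>x. (x, 0)) ` B \<union> (\<lambda>y. (0, y)) ` C"
  have "z \<in> span ?S" for z :: "'a \<times> 'b"
  proof -
    have l: "linear (\<lambda>x::'a. (x, 0::'b))" "linear (\<lambda>y::'b. (0::'a, y))" by (auto intro!: linearI)
    have "(fst z, 0) \<in> span ((\<lambda>x. (x, 0::'b)) ` B)" "(0, snd z) \<in> span ((\<lambda>y. (0::'a, y)) ` C)"
      using B by (auto simp: linear_span_image[OF l(1)] linear_span_image[OF l(2)])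
    then have "(fst z, 0) \<in> span ?S" "(0, snd z) \<in> span ?S"
      by (meson span_mono subsetD sup_ge1 sup_ge2)+
    then have "(fst z, 0) + (0, snd z) \<in> span ?S" by (rule span_add)
    then show ?thesis by simp
  qed
  then show ?thesis unfolding finite_dim_def using B by (intro exI[of _ ?S]) auto
qed

section \<open>Calculus of smooth maps\<close>

text \<open>Replaces \<open>frechet_derivative\<close> in the definition of \<open>Ck_on\<close> by
  any derivative found by hand. The congruence at level \<open>k\<close> is a hypothesis because
  \<open>Ck_on_cong\<close> is itself proved by induction with this rule; \<open>Ck_on_SucI'\<close>
  has it discharged.\<close>

lemma Ck_on_SucI:
  assumes "\<And>x. x \<in> S \<Longrightarrow> (f has_derivative D x) (at x)" and "\<And>v. Ck_on k S (\<lambda>x. D x v)"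
    and "open S"
    and cong: "\<And>f g. (\<And>x. x \<in> S \<Longrightarrow> f x = g x) \<Longrightarrow> Ck_on k S f \<Longrightarrow> Ck_on k S (g :: _ \<Rightarrow> 'b)"
  shows "Ck_on (Suc k) S (f :: 'a::real_normed_vector \<Rightarrow> 'b::real_normed_vector)"
proof -
  have "D x = frechet_derivative f (at x)" if "x \<in> S" for x
    using frechet_derivative_at[OF assms(1)[OF that]] .
  then have "Ck_on k S (\<lambda>x. frechet_derivative f (at x) v)" for v
    by (intro cong[OF _ assms(2)[of v]]) simp
  then show ?thesis using assms(1) by (auto simp: differentiable_def)
qed

lemma Ck_on_cong:
  assumes "open S" "\<And>x. x \<in> S \<Longrightarrow> f x = g x" "Ck_on k S f"
  shows "Ck_on k S g"
  using assms(2,3)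
proof (induct k arbitrary: f g)
  case 0
  then show ?case using continuous_on_cong[of S S f g] by simp
next
  case (Suc k)
  show ?case
  proof (rule Ck_on_SucI[OF _ _ assms(1)])
    fix x assume x: "x \<in> S"
    have "(f has_derivative frechet_derivative f (at x)) (at x)"
      using Suc(3) x frechet_derivative_works by auto
    then show "(g has_derivative frechet_derivative f (at x)) (at x)"
      by (rule has_derivative_transform_within_open[OF _ assms(1) x]) (use Suc(2) in auto)
  qed (use Suc in auto)
qed

lemmas Ck_on_SucI' = Ck_on_SucI[OF _ _ _ Ck_on_cong]

lemma Ck_on_SucD:
  "Ck_on (Suc k) S f \<Longrightarrow> x \<in> S \<Longrightarrow> (f has_derivative frechet_derivative f (at x)) (at x)"
  using frechet_derivative_works by auto

lemma Ck_on_subset: "Ck_on k S f \<Longrightarrow> T \<subseteq> S \<Longrightarrow> Ck_on k T f"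
  by (induct k arbitrary: f) (auto intro: continuous_on_subset)

lemma Ck_on_Suc_imp: "Ck_on (Suc k) S f \<Longrightarrow> Ck_on k S f"
proof (induct k arbitrary: f)
  case 0
  then show ?case
    by (auto intro!: continuous_at_imp_continuous_on differentiable_imp_continuous_within)
next
  case (Suc k)
  have "Ck_on k S (\<lambda>x. frechet_derivative f (at x) v)" for v
    using Suc(2) by (intro Suc(1)) simp
  then show ?case using Suc(2) by simp
qed

lemma Ck_on_local:
  assumes "\<And>x. x \<in> S \<Longrightarrow> \<exists>T. open T \<and> x \<in> T \<and> Ck_on k T f"
  shows "Ck_on k S f"
  using assms
proof (induct k arbitrary: f)
  case 0
  have "isCont f x" if "x \<in> S" for x
    using 0[OF that] by (auto simp: continuous_on_eq_continuous_at)
  then show ?case by (auto intro!: continuous_at_imp_continuous_on)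
next
  case (Suc k)
  have "Ck_on k S (\<lambda>x. frechet_derivative f (at x) v)" for v
    using Suc(2) by (intro Suc(1)) fastforce
  moreover have "\<forall>x\<in>S. f differentiable at x" using Suc(2) by fastforce
  ultimately show ?case by simp
qed

lemma Ck_on_const: "Ck_on k S (\<lambda>x. c)"
  by (induct k arbitrary: c) (auto simp: frechet_derivative_const)

lemma Ck_on_compose_linear:
  assumes "bounded_linear L" "open S" "Ck_on k S f"
  shows "Ck_on k S (\<lambda>x. L (f x))"
  using assms(3)
proof (induct k arbitrary: f)
  case 0
  then show ?case using bounded_linear.continuous_on[OF assms(1)] by simp
next
  case (Suc k)
  show ?case
  proof (rule Ck_on_SucI'[OF _ _ assms(2,2)])
    fix x assume "x \<in> S"
    then show "((\<lambda>x. L (f x)) has_derivative (\<lambda>v. L (frechet_derivative f (at x) v))) (at x)"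
      by (intro bounded_linear.has_derivative[OF assms(1)] Ck_on_SucD[OF Suc(2)])
  qed (use Suc in auto)
qed

lemma Ck_on_linear:
  assumes "bounded_linear L" "open S"
  shows "Ck_on k S L"
proof (cases k)
  case 0
  then show ?thesis using linear_continuous_on[OF assms(1)] by simp
next
  case (Suc j)
  have "Ck_on (Suc j) S L"
    by (rule Ck_on_SucI'[OF _ _ assms(2,2)])
      (auto intro: bounded_linear_imp_has_derivative[OF assms(1)] Ck_on_const)
  then show ?thesis using Suc by simp
qed

lemma Ck_on_add:
  assumes "open S" "Ck_on k S f" "Ck_on k S g"
  shows "Ck_on k S (\<lambda>x. f x + g x)"
  using assms(2,3)
proof (induct k arbitrary: f g)
  case 0
  then show ?case by (auto intro: continuous_on_add)
next
  case (Suc k)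
  show ?case
  proof (rule Ck_on_SucI'[OF _ _ assms(1,1)])
    fix x assume "x \<in> S"
    then show "((\<lambda>x. f x + g x) has_derivative
        (\<lambda>v. frechet_derivative f (at x) v + frechet_derivative g (at x) v)) (at x)"
      by (intro has_derivative_add Ck_on_SucD[OF Suc(2)] Ck_on_SucD[OF Suc(3)])
  qed (use Suc in auto)
qed

lemma Ck_on_sum:
  assumes "open S" "\<And>i. i \<in> I \<Longrightarrow> Ck_on k S (f i)"
  shows "Ck_on k S (\<lambda>x. \<Sum>i\<in>I. f i x)"
  using assms(2)
proof (induct I rule: infinite_finite_induct)
  case (insert i I)
  then show ?case by (simp add: Ck_on_add[OF assms(1)])
qed (auto simp: Ck_on_const)

lemma Ck_on_bilinear:
  assumes "bounded_bilinear p" "open S" "Ck_on k S f" "Ck_on k S g"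
  shows "Ck_on k S (\<lambda>x. p (f x) (g x))"
  using assms(3,4)
proof (induct k arbitrary: f g)
  case 0
  then show ?case using bounded_bilinear.continuous_on[OF assms(1)] by auto
next
  case (Suc k)
  show ?case
  proof (rule Ck_on_SucI'[OF _ _ assms(2,2)])
    fix x assume "x \<in> S"
    then show "((\<lambda>x. p (f x) (g x)) has_derivative
        (\<lambda>v. p (f x) (frechet_derivative g (at x) v) + p (frechet_derivative f (at x) v) (g x))) (at x)"
      by (intro bounded_bilinear.FDERIV[OF assms(1)] Ck_on_SucD[OF Suc(2)] Ck_on_SucD[OF Suc(3)])
  next
    fix v
    show "Ck_on k S (\<lambda>x. p (f x) (frechet_derivative g (at x) v) + p (frechet_derivative f (at x) v) (g x))"
      using Suc(2,3) Ck_on_Suc_imp[OF Suc(2)] Ck_on_Suc_imp[OF Suc(3)]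
      by (intro Ck_on_add[OF assms(2)] Suc(1)) auto
  qed
qed

text \<open>\<open>Ck_on\<close> speaks of derivatives along a fixed vector, while the chain rule
  differentiates \<open>g\<close> along a moving one. Expanding the moving vector in a basis of the
  middle space leaves products of its coordinates with fixed directional derivatives of
  \<open>g\<close> composed with \<open>f\<close>, to which the induction hypothesis applies; this
  is why it is general in \<open>g\<close>.\<close>

lemma Ck_on_compose:
  fixes f :: "'a::real_normed_vector \<Rightarrow> 'b::real_normed_vector"
    and g :: "'b \<Rightarrow> 'c::real_normed_vector"
  assumes "finite_dim TYPE('b)" "open S" "f ` S \<subseteq> T" "Ck_on k S f" "Ck_on k T g"
  shows "Ck_on k S (\<lambda>x. g (f x))"
  using assms(4,5)
proof (induct k arbitrary: g)
  case 0
  then show ?case using assms(3) by (auto intro: continuous_on_compose2)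
next
  case (Suc k)
  obtain B and c :: "'b \<Rightarrow> 'b \<Rightarrow>\<^sub>L real" where B: "\<And>x. (\<Sum>b\<in>B. c b x *\<^sub>R b) = x"
    using finite_dim_coordinates[OF assms(1)] by metis
  let ?D = "\<lambda>x v. \<Sum>b\<in>B. c b (frechet_derivative f (at x) v) *\<^sub>R frechet_derivative g (at (f x)) b"
  show ?case
  proof (rule Ck_on_SucI'[OF _ _ assms(2,2)])
    fix x assume x: "x \<in> S"
    have g: "(g has_derivative frechet_derivative g (at (f x))) (at (f x))"
      using x assms(3) by (intro Ck_on_SucD[OF Suc(3)]) auto
    have "((\<lambda>x. g (f x)) has_derivative (\<lambda>v. frechet_derivative g (at (f x)) (frechet_derivative f (at x) v))) (at x)"
      by (rule has_derivative_compose[OF Ck_on_SucD[OF Suc(2) x] g])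
    moreover have "frechet_derivative g (at (f x)) (frechet_derivative f (at x) v) = ?D x v" for v
    proof -
      have "frechet_derivative g (at (f x)) (frechet_derivative f (at x) v)
          = frechet_derivative g (at (f x)) (\<Sum>b\<in>B. c b (frechet_derivative f (at x) v) *\<^sub>R b)"
        by (simp add: B)
      then show ?thesis
        using has_derivative_linear[OF g] by (simp add: linear_sum linear_scale)
    qed
    ultimately show "((\<lambda>x. g (f x)) has_derivative ?D x) (at x)" by simp
  next
    fix v
    have "Ck_on k S (\<lambda>x. frechet_derivative g (at (f x)) b)" for b
      using Suc(3) Ck_on_Suc_imp[OF Suc(2)] by (intro Suc(1)) auto
    then show "Ck_on k S (\<lambda>x. ?D x v)"
      using Suc(2)
      by (intro Ck_on_sum Ck_on_bilinear[OF bounded_bilinear_scaleR] assms(2)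
          Ck_on_compose_linear[OF blinfun.bounded_linear_right]) auto
  qed
qed

text \<open>The derivative of the reciprocal contains the reciprocal again, but one order of
  smoothness lower, so induction on the order closes.\<close>

lemma Ck_on_inverse:
  fixes f :: "'a::real_normed_vector \<Rightarrow> real"
  assumes "open S" "\<And>x. x \<in> S \<Longrightarrow> f x \<noteq> 0" "Ck_on k S f"
  shows "Ck_on k S (\<lambda>x. inverse (f x))"
  using assms(3)
proof (induct k)
  case 0
  then show ?case using assms(2) by (auto intro: continuous_on_inverse)
next
  case (Suc k)
  show ?case
  proof (rule Ck_on_SucI'[OF _ _ assms(1,1)])
    fix x assume x: "x \<in> S"
    show "((\<lambda>x. inverse (f x)) has_derivative
        (\<lambda>v. - (inverse (f x) * frechet_derivative f (at x) v * inverse (f x)))) (at x)"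
      by (rule Deriv.has_derivative_inverse[where f = f and x = x, OF assms(2)[OF x] Ck_on_SucD[OF Suc(2) x]])
  next
    fix v
    note * = Suc(1)[OF Ck_on_Suc_imp[OF Suc(2)]]
    show "Ck_on k S (\<lambda>x. - (inverse (f x) * frechet_derivative f (at x) v * inverse (f x)))"
      using Suc(2)
      by (intro Ck_on_compose_linear[OF bounded_linear_minus[OF bounded_linear_ident]]
          Ck_on_bilinear[OF bounded_bilinear_mult] assms(1) *) auto
  qed
qed

section \<open>Smooth maps as maps of class \<open>Ck_on\<close> for every order\<close>

lemma smooth_on_cong: "open S \<Longrightarrow> (\<And>x. x \<in> S \<Longrightarrow> f x = g x) \<Longrightarrow> smooth_on S f \<Longrightarrow> smooth_on S g"
  unfolding smooth_on_def using Ck_on_cong by blast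

lemma smooth_on_subset: "smooth_on S f \<Longrightarrow> T \<subseteq> S \<Longrightarrow> smooth_on T f"
  unfolding smooth_on_def using Ck_on_subset by blast

lemma smooth_on_local:
  "(\<And>x. x \<in> S \<Longrightarrow> \<exists>T. open T \<and> x \<in> T \<and> smooth_on T f) \<Longrightarrow> smooth_on S f"
  unfolding smooth_on_def by (meson Ck_on_local)

lemma smooth_on_const: "smooth_on S (\<lambda>x. c)"
  unfolding smooth_on_def using Ck_on_const by blast

lemma smooth_on_compose_linear:
  "bounded_linear L \<Longrightarrow> open S \<Longrightarrow> smooth_on S f \<Longrightarrow> smooth_on S (\<lambda>x. L (f x))"
  unfolding smooth_on_def using Ck_on_compose_linear by blast

lemma smooth_on_linear: "bounded_linear L \<Longrightarrow> open S \<Longrightarrow> smooth_on S L"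
  unfolding smooth_on_def using Ck_on_linear by blast

lemma smooth_on_add:
  "open S \<Longrightarrow> smooth_on S f \<Longrightarrow> smooth_on S g \<Longrightarrow> smooth_on S (\<lambda>x. f x + g x)"
  unfolding smooth_on_def using Ck_on_add by blast

lemma smooth_on_sum:
  "open S \<Longrightarrow> (\<And>i. i \<in> I \<Longrightarrow> smooth_on S (f i)) \<Longrightarrow> smooth_on S (\<lambda>x. \<Sum>i\<in>I. f i x)"
  unfolding smooth_on_def by (intro allI Ck_on_sum) auto

lemma smooth_on_bilinear:
  "bounded_bilinear p \<Longrightarrow> open S \<Longrightarrow> smooth_on S f \<Longrightarrow> smooth_on S g \<Longrightarrow> smooth_on S (\<lambda>x. p (f x) (g x))"
  unfolding smooth_on_def using Ck_on_bilinear by blast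

lemma smooth_on_compose:
  fixes f :: "'a::real_normed_vector \<Rightarrow> 'b::real_normed_vector"
  assumes "finite_dim TYPE('b)" "open S" "f ` S \<subseteq> T" "smooth_on S f" "smooth_on T g"
  shows "smooth_on S (\<lambda>x. g (f x))"
  using assms(4,5) Ck_on_compose[OF assms(1-3)] unfolding smooth_on_def by blast

lemma smooth_on_inverse:
  "open S \<Longrightarrow> (\<And>x. x \<in> S \<Longrightarrow> f x \<noteq> (0::real)) \<Longrightarrow> smooth_on S f \<Longrightarrow> smooth_on S (\<lambda>x. inverse (f x))"
  unfolding smooth_on_def using Ck_on_inverse by blast

lemma smooth_on_has_derivative:
  "smooth_on S f \<Longrightarrow> x \<in> S \<Longrightarrow> (f has_derivative frechet_derivative f (at x)) (at x)"
  unfolding smooth_on_def using Ck_on_SucD by blast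

lemma smooth_on_frechet_derivative:
  assumes "smooth_on S f"
  shows "smooth_on S (\<lambda>x. frechet_derivative f (at x) v)"
proof -
  have "Ck_on (Suc k) S f" for k using assms unfolding smooth_on_def by blast
  then show ?thesis by (simp add: smooth_on_def)
qed

lemma smooth_on_continuous_on: "smooth_on S f \<Longrightarrow> continuous_on S f"
  unfolding smooth_on_def by (metis Ck_on.simps(1))

lemma smooth_on_Pair:
  assumes "open S" "smooth_on S f" "smooth_on S g"
  shows "smooth_on S (\<lambda>x. (f x, g x))"
proof -
  have "smooth_on S (\<lambda>x. (f x, 0) + (0, g x))"
    by (intro smooth_on_add assms(1) smooth_on_compose_linear[OF _ assms(1) assms(2)]
        smooth_on_compose_linear[OF _ assms(1) assms(3)] bounded_linear_Pair bounded_linear_ident bounded_linear_zero)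
  then show ?thesis by simp
qed

lemma smooth_on_compose_fst:
  assumes "finite_dim TYPE('a::real_normed_vector)" "open A" "smooth_on A f"
  shows "smooth_on (A \<times> (UNIV :: 'b::real_normed_vector set)) (\<lambda>p. f (fst p :: 'a))"
  by (rule smooth_on_compose[OF assms(1) _ _ smooth_on_linear[OF bounded_linear_fst] assms(3)])
    (use assms(2) in \<open>auto intro: open_Times\<close>)

section \<open>A smooth bump function\<close>

text \<open>The family \<open>flat n\<close> is closed under differentiation up to linear combinations, which gives
  the smoothness of \<open>flat 0\<close>, the function \<open>exp (-1/t)\<close>, at 0.\<close>

definition flat :: "nat \<Rightarrow> real \<Rightarrow> real" where
  "flat n t = (if t > 0 then inverse t ^ n * exp (- inverse t) else 0)"

text \<open>From the right, substitute x = 1/t and use that x^n / exp x tends to 0; from the left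
  the function vanishes.\<close>

lemma flat_tendsto_0: "(flat n \<longlongrightarrow> 0) (at 0)"
proof -
  have "((\<lambda>t::real. inverse t ^ n / exp (inverse t)) \<longlongrightarrow> 0) (at_right 0)"
    using filterlim_compose[OF tendsto_power_div_exp_0 filterlim_inverse_at_top_right] .
  then have "(flat n \<longlongrightarrow> 0) (at_right 0)"
    by (rule Lim_transform_eventually)
      (auto simp: flat_def eventually_at_filter exp_minus divide_inverse)
  moreover have "(flat n \<longlongrightarrow> 0) (at_left 0)"
    by (rule tendsto_eventually) (auto simp: flat_def eventually_at_filter)
  ultimately show ?thesis using filterlim_split_at by blast
qed

lemma flat_has_derivative:
  "(flat n has_field_derivative (flat (n + 2) t - n * flat (Suc n) t)) (at t)"
proof -
  consider "t > 0" | "t < 0" | "t = 0" by linarith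
  then show ?thesis
  proof cases
    case 1
    have inv: "(inverse has_field_derivative - (inverse t ^ 2)) (at t)"
      using DERIV_inverse[of t] 1 by (simp add: numeral_2_eq_2)
    have "((\<lambda>t. inverse t ^ n * exp (- inverse t)) has_field_derivative
        (real n * (- (inverse t ^ 2) * inverse t ^ (n - Suc 0)) * exp (- inverse t)
          + exp (- inverse t) * (- (- (inverse t ^ 2))) * inverse t ^ n)) (at t)"
      by (intro DERIV_mult DERIV_power DERIV_fun_exp DERIV_minus inv)
    moreover have "real n * (- (inverse t ^ 2) * inverse t ^ (n - Suc 0)) * exp (- inverse t)
          + exp (- inverse t) * (- (- (inverse t ^ 2))) * inverse t ^ n = flat (n + 2) t - n * flat (Suc n) t"
      using 1 by (cases n) (simp_all add: flat_def power2_eq_square algebra_simps)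
    ultimately have "((\<lambda>t. inverse t ^ n * exp (- inverse t)) has_field_derivative
        (flat (n + 2) t - n * flat (Suc n) t)) (at t)"
      by (simp only:)
    then show ?thesis
      by (rule has_field_derivative_transform_within_open[of _ _ _ "{0<..}"])
        (use 1 in \<open>auto simp: flat_def\<close>)
  next
    case 2
    have "((\<lambda>t. 0) has_field_derivative (flat (n + 2) t - n * flat (Suc n) t)) (at t)"
      using 2 by (simp add: flat_def)
    then show ?thesis
      by (rule has_field_derivative_transform_within_open[of _ _ _ "{..<0}"])
        (use 2 in \<open>auto simp: flat_def\<close>)
  next
    case 3
    \<comment> \<open>At 0 the difference quotient of \<open>flat n\<close> is
      \<open>flat (Suc n)\<close>, so the preceding limit gives derivative 0, which is also the
      value of the right-hand side at 0.\<close>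
    have "((\<lambda>t. (flat n t - flat n 0) / (t - 0)) \<longlongrightarrow> 0) (at 0)"
      by (rule Lim_transform_eventually[OF flat_tendsto_0[of "Suc n"]])
        (auto simp: flat_def eventually_at_filter divide_inverse)
    then show ?thesis using 3 by (simp add: has_field_derivative_iff flat_def)
  qed
qed

lemma smooth_on_flat: "smooth_on UNIV (flat n)"
proof -
  have "Ck_on k UNIV (flat n)" for k
  proof (induct k arbitrary: n)
    case 0
    show ?case
      using flat_has_derivative by (auto intro!: DERIV_continuous_on)
  next
    case (Suc k)
    show ?case
    proof (rule Ck_on_SucI')
      show "(flat n has_derivative (\<lambda>v. (flat (n + 2) t + (- real n) * flat (Suc n) t) * v)) (at t)" for t
        using flat_has_derivative[of n t] by (simp add: has_field_derivative_def)
      show "Ck_on k UNIV (\<lambda>t. (flat (n + 2) t + (- real n) * flat (Suc n) t) * v)" for v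
        by (intro Ck_on_bilinear[OF bounded_bilinear_mult] Ck_on_add Ck_on_const Suc) auto
    qed auto
  qed
  then show ?thesis unfolding smooth_on_def by blast
qed

text \<open>The norm need not be differentiable, so the radial variable is \<open>q\<close>, the sum
  of the squared coordinates of x - x0. Its sublevel set \<open>K\<close> is closed and lies in a
  translated coefficient box, hence is compact.\<close>

lemma smooth_bump_normed:
  fixes x0 :: "'a::real_normed_vector"
  assumes "finite_dim TYPE('a)" "open A" "x0 \<in> A"
  obtains \<rho> :: "'a \<Rightarrow> real" and K where
    "smooth_on UNIV \<rho>" "\<rho> x0 = 1" "compact K" "K \<subseteq> A" "\<And>x. x \<notin> K \<Longrightarrow> \<rho> x = 0"
proof -
  obtain B and c :: "'a \<Rightarrow> 'a \<Rightarrow>\<^sub>L real" where B: "finite B" "\<And>x. (\<Sum>b\<in>B. c b x *\<^sub>R b) = x"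
    using finite_dim_coordinates[OF assms(1)] by metis
  obtain e where e: "e > 0" "ball x0 e \<subseteq> A" using assms(2,3) openE by blast
  \<comment> \<open>On \<open>K\<close> every coordinate is at most \<open>s\<close> in modulus, so
    the distance from \<open>x0\<close> is at most \<open>s\<close> times the sum of the norms of
    the basis vectors, which is less than \<open>e\<close>. The summand 1 makes the inequality
    strict and the denominator positive even when \<open>B\<close> is empty.\<close>
  define s where "s = e / (1 + (\<Sum>b\<in>B. norm b))"
  have N: "0 \<le> (\<Sum>b\<in>B. norm b)" by (simp add: sum_nonneg)
  then have s: "s > 0" using e(1) by (simp add: s_def add_pos_nonneg)
  define q where "q x = (\<Sum>b\<in>B. (c b (x - x0))\<^sup>2)" for x
  define K where "K = {x. q x \<le> s\<^sup>2}"
  define \<rho> where "\<rho> x = flat 0 (s\<^sup>2 - q x) / flat 0 (s\<^sup>2)" for x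
  have contq: "continuous_on UNIV q" unfolding q_def by (intro continuous_intros)
  have le: "\<bar>c b (x - x0)\<bar> \<le> s" if "x \<in> K" "b \<in> B" for x b
  proof -
    have "(c b (x - x0))\<^sup>2 \<le> q x" unfolding q_def using B(1) that(2) by (intro member_le_sum) auto
    then have "(c b (x - x0))\<^sup>2 \<le> s\<^sup>2" using that(1) unfolding K_def by simp
    then show ?thesis using s by (simp add: abs_le_square_iff[symmetric])
  qed
  have "K \<subseteq> (\<lambda>y. x0 + y) ` {\<Sum>b\<in>B. c b *\<^sub>R b | c. \<forall>b\<in>B. \<bar>c b\<bar> \<le> s}" (is "_ \<subseteq> ?P")
  proof
    fix x assume x: "x \<in> K"
    show "x \<in> ?P"
    proof (rule image_eqI)
      show "x = x0 + (\<Sum>b\<in>B. c b (x - x0) *\<^sub>R b)" by (simp add: B)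
    qed (use le[OF x] in auto)
  qed
  moreover have "compact ?P"
    by (intro compact_continuous_image compact_coefficient_box B continuous_intros)
  moreover have "closed K" unfolding K_def by (intro closed_Collect_le contq continuous_intros)
  ultimately have K: "compact K" using compact_Int_closed[of ?P K] by (simp add: Int_absorb1)
  have "K \<subseteq> ball x0 e"
  proof
    fix x assume x: "x \<in> K"
    have "norm (x - x0) = norm (\<Sum>b\<in>B. c b (x - x0) *\<^sub>R b)" by (simp add: B)
    also have "\<dots> \<le> (\<Sum>b\<in>B. s * norm b)"
      using le[OF x] by (intro sum_norm_le) (auto intro: mult_right_mono)
    also have "\<dots> = s * (\<Sum>b\<in>B. norm b)" by (simp add: sum_distrib_left)
    also have "\<dots> < s * (1 + (\<Sum>b\<in>B. norm b))" using s by simp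
    also have "\<dots> = e" using N by (simp add: s_def)
    finally show "x \<in> ball x0 e" by (simp add: dist_norm norm_minus_commute)
  qed
  then have "K \<subseteq> A" using e(2) by auto
  moreover have "\<rho> x = 0" if "x \<notin> K" for x
    using that by (simp add: K_def \<rho>_def flat_def)
  moreover have "\<rho> x0 = 1"
    using s by (simp add: \<rho>_def q_def flat_def blinfun.zero_right)
  moreover have "smooth_on UNIV \<rho>"
  proof -
    have c: "smooth_on UNIV (\<lambda>x. c b (x + (- x0)))" for b
      by (intro smooth_on_compose_linear[OF blinfun.bounded_linear_right] smooth_on_add
          smooth_on_linear[OF bounded_linear_ident] smooth_on_const) auto
    have "smooth_on UNIV (\<lambda>x. s\<^sup>2 + - (\<Sum>b\<in>B. c b (x + (- x0)) * c b (x + (- x0))))"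
      by (intro smooth_on_add smooth_on_const smooth_on_compose_linear[OF bounded_linear_minus[OF bounded_linear_ident]]
          smooth_on_sum smooth_on_bilinear[OF bounded_bilinear_mult] c) auto
    then have q: "smooth_on UNIV (\<lambda>x. s\<^sup>2 - q x)" by (simp add: q_def power2_eq_square)
    have "smooth_on UNIV (\<lambda>x. flat 0 (s\<^sup>2 - q x))"
      by (rule smooth_on_compose[OF finite_dim_real open_UNIV _ q smooth_on_flat]) auto
    then show ?thesis unfolding \<rho>_def
      by (rule smooth_on_compose_linear[OF bounded_linear_divide open_UNIV])
  qed
  ultimately show ?thesis using that K by blast
qed

section \<open>Atlases\<close>

text \<open>The separation and countability axioms are left out so that total spaces of bundles can be
  treated as manifolds without verifying these.\<close>

locale smooth_atlas =
  fixes M :: "('p, 'a::real_normed_vector) manifold"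
  assumes model_finite_dim: "finite_dim TYPE('a)"
    and chart_subset: "(U, \<kappa>) \<in> atlas M \<Longrightarrow> U \<subseteq> pts M"
    and chart_inj: "(U, \<kappa>) \<in> atlas M \<Longrightarrow> inj_on \<kappa> U"
    and chart_open_range: "(U, \<kappa>) \<in> atlas M \<Longrightarrow> open (\<kappa> ` U)"
    and charts_cover: "\<Union>(fst ` atlas M) = pts M"
    and transition_open: "(U, \<kappa>) \<in> atlas M \<Longrightarrow> (V, \<mu>) \<in> atlas M \<Longrightarrow> open (\<kappa> ` (U \<inter> V))"
    and transition_smooth:
      "(U, \<kappa>) \<in> atlas M \<Longrightarrow> (V, \<mu>) \<in> atlas M \<Longrightarrow> smooth_on (\<kappa> ` (U \<inter> V)) (\<mu> \<circ> inv_into U \<kappa>)"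
begin

lemma chart_at_ex:
  assumes "x \<in> pts M"
  obtains U \<kappa> where "(U, \<kappa>) \<in> atlas M" "x \<in> U"
  using assms charts_cover by fastforce

text \<open>Injectivity of a chart on its domain makes its image commute with intersections; unions
  need nothing.\<close>

lemma istopology_atlas: "istopology (\<lambda>W. W \<subseteq> pts M \<and> (\<forall>(U, \<kappa>)\<in>atlas M. open (\<kappa> ` (W \<inter> U))))"
  unfolding istopology_def
proof (intro conjI allI impI)
  fix S T
  assume S: "S \<subseteq> pts M \<and> (\<forall>(U, \<kappa>)\<in>atlas M. open (\<kappa> ` (S \<inter> U)))"
    and T: "T \<subseteq> pts M \<and> (\<forall>(U, \<kappa>)\<in>atlas M. open (\<kappa> ` (T \<inter> U)))"
  have "\<kappa> ` (S \<inter> T \<inter> U) = \<kappa> ` (S \<inter> U) \<inter> \<kappa> ` (T \<inter> U)" if "(U, \<kappa>) \<in> atlas M" for U \<kappa>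
    using chart_inj[OF that] by (auto simp: inj_on_def)
  then show "\<forall>(U, \<kappa>)\<in>atlas M. open (\<kappa> ` (S \<inter> T \<inter> U))"
    using S T by (auto intro!: open_Int)
  show "S \<inter> T \<subseteq> pts M" using S by auto
next
  fix \<K> assume K: "\<forall>K\<in>\<K>. K \<subseteq> pts M \<and> (\<forall>(U, \<kappa>)\<in>atlas M. open (\<kappa> ` (K \<inter> U)))"
  have "\<kappa> ` (\<Union>\<K> \<inter> U) = (\<Union>K\<in>\<K>. \<kappa> ` (K \<inter> U))" for U and \<kappa> :: "'p \<Rightarrow> 'a" by auto
  then show "\<forall>(U, \<kappa>)\<in>atlas M. open (\<kappa> ` (\<Union>\<K> \<inter> U))"
    using K by (auto intro!: open_UN)
  show "\<Union>\<K> \<subseteq> pts M" using K by auto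
qed

lemma openin_mtop: "openin (mtop M) W \<longleftrightarrow> W \<subseteq> pts M \<and> (\<forall>(U, \<kappa>)\<in>atlas M. open (\<kappa> ` (W \<inter> U)))"
  unfolding mtop_def using topology_inverse'[OF istopology_atlas] by simp

lemma topspace_mtop: "topspace (mtop M) = pts M"
proof
  show "topspace (mtop M) \<subseteq> pts M" unfolding topspace_def openin_mtop by auto
  have "openin (mtop M) (pts M)"
    unfolding openin_mtop using chart_open_range chart_subset by (auto simp: Int_absorb1)
  then show "pts M \<subseteq> topspace (mtop M)" by (rule openin_subset)
qed

lemma openin_pts: "openin (mtop M) (pts M)"
  using openin_topspace[of "mtop M"] by (simp add: topspace_mtop)

lemma chart_openin: "(U, \<kappa>) \<in> atlas M \<Longrightarrow> openin (mtop M) U"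
  unfolding openin_mtop using chart_subset transition_open by (auto simp: Int_commute)

lemma open_chart_image: "openin (mtop M) W \<Longrightarrow> (U, \<kappa>) \<in> atlas M \<Longrightarrow> open (\<kappa> ` (U \<inter> W))"
  unfolding openin_mtop by (auto simp: Int_commute)

lemma chart_inv: "(U, \<kappa>) \<in> atlas M \<Longrightarrow> x \<in> U \<Longrightarrow> inv_into U \<kappa> (\<kappa> x) = x"
  using chart_inj inv_into_f_f by metis

lemma openin_chart_preimage:
  assumes "(U, \<kappa>) \<in> atlas M" "open A"
  shows "openin (mtop M) {p \<in> U. \<kappa> p \<in> A}"
  unfolding openin_mtop
proof safe
  fix V \<mu> assume V: "(V, \<mu>) \<in> atlas M"
  have "\<mu> ` ({p \<in> U. \<kappa> p \<in> A} \<inter> V) = \<mu> ` (V \<inter> U) \<inter> (\<kappa> \<circ> inv_into V \<mu>) -` A"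
    using chart_inv[OF V] by auto
  also have "open \<dots>"
    by (intro continuous_open_preimage smooth_on_continuous_on transition_smooth[OF V assms(1)]
        transition_open[OF V assms(1)] assms(2))
  finally show "open (\<mu> ` ({p \<in> U. \<kappa> p \<in> A} \<inter> V))" .
qed (use chart_subset assms in auto)

subsection \<open>Smooth functions\<close>

lemma smooth_fun_onD:
  "smooth_fun_on M W f \<Longrightarrow> (U, \<kappa>) \<in> atlas M \<Longrightarrow> smooth_on (\<kappa> ` (U \<inter> W)) (f \<circ> inv_into U \<kappa>)"
  unfolding smooth_fun_on_def by auto

lemma smooth_fun_on_local:
  assumes "\<And>x. x \<in> W \<Longrightarrow> \<exists>W'. openin (mtop M) W' \<and> x \<in> W' \<and> smooth_fun_on M W' f"
  shows "smooth_fun_on M W f"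
  unfolding smooth_fun_on_def
proof safe
  fix U \<kappa> assume U: "(U, \<kappa>) \<in> atlas M"
  show "smooth_on (\<kappa> ` (U \<inter> W)) (f \<circ> inv_into U \<kappa>)"
  proof (rule smooth_on_local)
    fix y assume "y \<in> \<kappa> ` (U \<inter> W)"
    then obtain x where x: "y = \<kappa> x" "x \<in> U" "x \<in> W" by auto
    from assms[OF x(3)] obtain W' where W': "openin (mtop M) W'" "x \<in> W'" "smooth_fun_on M W' f" by auto
    show "\<exists>T. open T \<and> y \<in> T \<and> smooth_on T (f \<circ> inv_into U \<kappa>)"
      using open_chart_image[OF W'(1) U] smooth_fun_onD[OF W'(3) U] x W'(2) by blast
  qed
qed

text \<open>One chart whose domain contains \<open>W\<close> is enough, since all other chart
  expressions arise by composing with transition maps.\<close>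

lemma smooth_fun_on_in_chart:
  assumes "(U, \<kappa>) \<in> atlas M" "openin (mtop M) W" "W \<subseteq> U" "smooth_on (\<kappa> ` W) (f \<circ> inv_into U \<kappa>)"
  shows "smooth_fun_on M W f"
  unfolding smooth_fun_on_def
proof safe
  fix V \<mu> assume V: "(V, \<mu>) \<in> atlas M"
  have im: "(\<kappa> \<circ> inv_into V \<mu>) ` \<mu> ` (V \<inter> W) \<subseteq> \<kappa> ` W"
    using chart_inv[OF V] by auto
  have "smooth_on (\<mu> ` (V \<inter> W)) (\<lambda>y. (f \<circ> inv_into U \<kappa>) ((\<kappa> \<circ> inv_into V \<mu>) y))"
    using assms(3)
    by (intro smooth_on_compose[OF model_finite_dim open_chart_image[OF assms(2) V] im _ assms(4)]
        smooth_on_subset[OF transition_smooth[OF V assms(1)]]) auto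
  then show "smooth_on (\<mu> ` (V \<inter> W)) (f \<circ> inv_into V \<mu>)"
    by (rule smooth_on_cong[OF open_chart_image[OF assms(2) V], rotated])
      (use assms(3) chart_inv[OF V] chart_inv[OF assms(1)] in auto)
qed

lemma smooth_fun_on_cong:
  assumes "openin (mtop M) W" "\<And>x. x \<in> W \<Longrightarrow> f x = g x" "smooth_fun_on M W f"
  shows "smooth_fun_on M W g"
  unfolding smooth_fun_on_def
proof safe
  fix U \<kappa> assume U: "(U, \<kappa>) \<in> atlas M"
  show "smooth_on (\<kappa> ` (U \<inter> W)) (g \<circ> inv_into U \<kappa>)"
    by (rule smooth_on_cong[OF open_chart_image[OF assms(1) U] _ smooth_fun_onD[OF assms(3) U]])
      (use assms(2) chart_inv[OF U] in auto)
qed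

lemma smooth_fun_on_subset: "smooth_fun_on M W f \<Longrightarrow> W' \<subseteq> W \<Longrightarrow> smooth_fun_on M W' f"
  unfolding smooth_fun_on_def by (fast elim: smooth_on_subset)

lemma smooth_fun_on_const: "smooth_fun_on M W (\<lambda>x. c)"
  unfolding smooth_fun_on_def by (auto simp: o_def smooth_on_const)

lemma smooth_fun_on_compose_linear:
  "bounded_linear L \<Longrightarrow> openin (mtop M) W \<Longrightarrow> smooth_fun_on M W f \<Longrightarrow> smooth_fun_on M W (\<lambda>x. L (f x))"
  unfolding smooth_fun_on_def o_def by (auto intro!: smooth_on_compose_linear[where L = L] open_chart_image)

lemma smooth_fun_on_add:
  "openin (mtop M) W \<Longrightarrow> smooth_fun_on M W f \<Longrightarrow> smooth_fun_on M W g \<Longrightarrow> smooth_fun_on M W (\<lambda>x. f x + g x)"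
  unfolding smooth_fun_on_def o_def by (auto intro!: smooth_on_add open_chart_image)

lemma smooth_fun_on_sum:
  "openin (mtop M) W \<Longrightarrow> (\<And>i. i \<in> I \<Longrightarrow> smooth_fun_on M W (f i)) \<Longrightarrow> smooth_fun_on M W (\<lambda>x. \<Sum>i\<in>I. f i x)"
  by (induct I rule: infinite_finite_induct) (auto simp: smooth_fun_on_const smooth_fun_on_add)

lemma smooth_fun_on_bilinear:
  "bounded_bilinear p \<Longrightarrow> openin (mtop M) W \<Longrightarrow> smooth_fun_on M W f \<Longrightarrow> smooth_fun_on M W g \<Longrightarrow>
    smooth_fun_on M W (\<lambda>x. p (f x) (g x))"
  unfolding smooth_fun_on_def o_def by (auto intro!: smooth_on_bilinear[where p = p] open_chart_image)

lemma smooth_fun_on_diff: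
  "openin (mtop M) W \<Longrightarrow> smooth_fun_on M W f \<Longrightarrow> smooth_fun_on M W g \<Longrightarrow> smooth_fun_on M W (\<lambda>x. f x - g x)"
  using smooth_fun_on_add[of W f "\<lambda>x. - g x"]
    smooth_fun_on_compose_linear[OF bounded_linear_minus[OF bounded_linear_ident], of W g] by simp

lemma smooth_fun_on_inverse:
  assumes "openin (mtop M) W" "\<And>x. x \<in> W \<Longrightarrow> f x \<noteq> (0::real)" "smooth_fun_on M W f"
  shows "smooth_fun_on M W (\<lambda>x. inverse (f x))"
  unfolding smooth_fun_on_def
proof safe
  fix U \<kappa> assume U: "(U, \<kappa>) \<in> atlas M"
  have "smooth_on (\<kappa> ` (U \<inter> W)) (\<lambda>y. inverse ((f \<circ> inv_into U \<kappa>) y))"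
    by (rule smooth_on_inverse[OF open_chart_image[OF assms(1) U] _ smooth_fun_onD[OF assms(3) U]])
      (use assms(2) chart_inv[OF U] in auto)
  then show "smooth_on (\<kappa> ` (U \<inter> W)) ((\<lambda>x. inverse (f x)) \<circ> inv_into U \<kappa>)" by (simp add: o_def)
qed

lemma smooth_fun_on_compose_chart:
  assumes "(U, \<kappa>) \<in> atlas M" "open A" "smooth_on A h"
  shows "smooth_fun_on M {p \<in> U. \<kappa> p \<in> A} (\<lambda>p. h (\<kappa> p))"
proof (rule smooth_fun_on_in_chart[OF assms(1) openin_chart_preimage[OF assms(1,2)]])
  let ?W = "{p \<in> U. \<kappa> p \<in> A}"
  have "open (\<kappa> ` ?W)"
    using open_chart_image[OF openin_chart_preimage[OF assms(1,2)] assms(1)] by (simp add: Int_absorb1)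
  then show "smooth_on (\<kappa> ` ?W) ((\<lambda>p. h (\<kappa> p)) \<circ> inv_into U \<kappa>)"
    by (rule smooth_on_cong[OF _ _ smooth_on_subset[OF assms(3)]])
      (use chart_inv[OF assms(1)] in auto)
qed auto

lemma smooth_fun_on_open_preimage:
  assumes "openin (mtop M) W" "smooth_fun_on M W f" "open A"
  shows "openin (mtop M) {x \<in> W. f x \<in> A}"
  unfolding openin_mtop
proof safe
  fix U \<kappa> assume U: "(U, \<kappa>) \<in> atlas M"
  have "\<kappa> ` ({x \<in> W. f x \<in> A} \<inter> U) = \<kappa> ` (U \<inter> W) \<inter> (f \<circ> inv_into U \<kappa>) -` A"
    using chart_inv[OF U] by auto
  also have "open \<dots>"
    by (intro continuous_open_preimage smooth_on_continuous_on smooth_fun_onD open_chart_image U assms)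
  finally show "open (\<kappa> ` ({x \<in> W. f x \<in> A} \<inter> U))" .
qed (use assms(1) openin_mtop in auto)

lemma smooth_fun_on_has_derivative:
  assumes "smooth_fun_on M W f" "(U, \<kappa>) \<in> charts_at M x" "x \<in> W"
  shows "((f \<circ> inv_into U \<kappa>) has_derivative frechet_derivative (f \<circ> inv_into U \<kappa>) (at (\<kappa> x))) (at (\<kappa> x))"
  using assms by (intro smooth_on_has_derivative[OF smooth_fun_onD[OF assms(1)]]) (auto simp: charts_at_def)

lemma smooth_fun_on_blinfun:
  fixes f :: "'p \<Rightarrow> 'v::real_normed_vector \<Rightarrow>\<^sub>L 'w::real_normed_vector"
  assumes "finite_dim TYPE('v)" "openin (mtop M) W" "\<And>v. smooth_fun_on M W (\<lambda>x. f x v)"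
  shows "smooth_fun_on M W f"
proof -
  obtain B and c :: "'v \<Rightarrow> 'v \<Rightarrow>\<^sub>L real" where B: "\<And>x. (\<Sum>b\<in>B. c b x *\<^sub>R b) = x"
    using finite_dim_coordinates[OF assms(1)] by metis
  have "smooth_fun_on M W (\<lambda>x. \<Sum>b\<in>B. blinfun_scaleR_left (f x b) o\<^sub>L c b)"
    by (intro smooth_fun_on_sum smooth_fun_on_compose_linear[OF bounded_linear_rank_one] assms(2,3))
  then show ?thesis
    by (rule smooth_fun_on_cong[OF assms(2), rotated]) (rule blinfun_expansion[OF B, symmetric])
qed

subsection \<open>Tangent vectors and vector fields\<close>

lemma has_derivative_chart_change:
  assumes "(U, \<kappa>) \<in> charts_at M p" "(V, \<mu>) \<in> charts_at M p"
    and "((h \<circ> inv_into V \<mu>) has_derivative D) (at (\<mu> p))"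
  shows "((h \<circ> inv_into U \<kappa>) has_derivative (\<lambda>v. D (frechet_derivative (\<mu> \<circ> inv_into U \<kappa>) (at (\<kappa> p)) v))) (at (\<kappa> p))"
proof -
  have U: "(U, \<kappa>) \<in> atlas M" "p \<in> U" and V: "(V, \<mu>) \<in> atlas M" "p \<in> V"
    using assms(1,2) by (auto simp: charts_at_def)
  have p: "\<kappa> p \<in> \<kappa> ` (U \<inter> V)" using U V by auto
  have t: "((\<mu> \<circ> inv_into U \<kappa>) has_derivative frechet_derivative (\<mu> \<circ> inv_into U \<kappa>) (at (\<kappa> p))) (at (\<kappa> p))"
    by (rule smooth_on_has_derivative[OF transition_smooth[OF U(1) V(1)] p])
  have "((\<lambda>y. (h \<circ> inv_into V \<mu>) ((\<mu> \<circ> inv_into U \<kappa>) y)) has_derivative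
      (\<lambda>v. D (frechet_derivative (\<mu> \<circ> inv_into U \<kappa>) (at (\<kappa> p)) v))) (at (\<kappa> p))"
    by (rule has_derivative_compose[OF t]) (use assms(3) chart_inv[OF U] in \<open>simp add: o_def\<close>)
  then show ?thesis
    by (rule has_derivative_transform_within_open[OF _ transition_open[OF U(1) V(1)] p])
      (use chart_inv[OF U(1)] chart_inv[OF V(1)] in auto)
qed

text \<open>The chain rule matches the compatibility condition on the family \<open>v\<close>. The
  charts chosen by \<open>SOME\<close> in \<open>vf_apply\<close> and \<open>tangent_map\<close> can
  therefore be replaced by any convenient ones.\<close>

lemma tangent_chart_independent:
  assumes "v \<in> tangent_space M p" "(U, \<kappa>) \<in> charts_at M p" "(V, \<mu>) \<in> charts_at M p"
    and "((h \<circ> inv_into V \<mu>) has_derivative D) (at (\<mu> p))"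
  shows "frechet_derivative (h \<circ> inv_into U \<kappa>) (at (\<kappa> p)) (v (U, \<kappa>)) = D (v (V, \<mu>))"
proof -
  have "v (V, \<mu>) = frechet_derivative (\<mu> \<circ> inv_into U \<kappa>) (at (\<kappa> p)) (v (U, \<kappa>))"
    using assms(1-3) unfolding tangent_space_def by auto
  then show ?thesis
    using frechet_derivative_at[OF has_derivative_chart_change[OF assms(2-4)]] by metis
qed

lemma some_chart: "x \<in> pts M \<Longrightarrow> (SOME c. c \<in> charts_at M x) \<in> charts_at M x"
  by (rule someI_ex) (metis (mono_tags, lifting) charts_at_def chart_at_ex fst_conv mem_Collect_eq)

lemma vf_apply_chart:
  assumes "snd (X p) \<in> tangent_space M p" "(U, \<kappa>) \<in> charts_at M p"
    and "((h \<circ> inv_into U \<kappa>) has_derivative D) (at (\<kappa> p))"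
  shows "vf_apply M X h p = D (snd (X p) (U, \<kappa>))"
proof -
  have p: "p \<in> pts M" using assms(2) chart_subset by (auto simp: charts_at_def)
  obtain V \<mu> where V: "(SOME c. c \<in> charts_at M p) = (V, \<mu>)" by fastforce
  with some_chart[OF p] have "(V, \<mu>) \<in> charts_at M p" by simp
  then show ?thesis
    using tangent_chart_independent[OF assms(1) _ assms(2,3)] p V by (simp add: vf_apply_def)
qed

lemma vector_fieldsD:
  assumes "X \<in> vector_fields M"
  shows "p \<in> pts M \<Longrightarrow> fst (X p) = p" "p \<in> pts M \<Longrightarrow> snd (X p) \<in> tangent_space M p"
    and "(U, \<kappa>) \<in> atlas M \<Longrightarrow> smooth_fun_on M U (\<lambda>p. snd (X p) (U, \<kappa>))"
proof -
  have X: "X p \<in> fibre (tangent_bundle M) p" if "p \<in> pts M" for p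
    using assms that unfolding vector_fields_def sections_def by blast
  show "p \<in> pts M \<Longrightarrow> fst (X p) = p" "p \<in> pts M \<Longrightarrow> snd (X p) \<in> tangent_space M p"
    using X[of p] by (auto simp: fibre_def tangent_bundle_def)
  show "(U, \<kappa>) \<in> atlas M \<Longrightarrow> smooth_fun_on M U (\<lambda>p. snd (X p) (U, \<kappa>))"
    using assms unfolding vector_fields_def sections_def tangent_bundle_def by (force simp: o_def)
qed

text \<open>Near a point, expanding the coordinate vector of \<open>X\<close> in a basis makes X(h)
  a finite sum of products of its smooth components with directional derivatives of \<open>h\<close>
  along fixed vectors.\<close>

lemma vf_apply_smooth:
  assumes X: "X \<in> vector_fields M" and "openin (mtop M) W" "smooth_fun_on M W h"
  shows "smooth_fun_on M W (vf_apply M X h)"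
proof (rule smooth_fun_on_local)
  fix x assume x: "x \<in> W"
  then have "x \<in> pts M" using assms(2) openin_mtop by auto
  then obtain U \<kappa> where U: "(U, \<kappa>) \<in> atlas M" "x \<in> U" by (rule chart_at_ex)
  obtain B and c :: "'a \<Rightarrow> 'a \<Rightarrow>\<^sub>L real" where B: "\<And>x. (\<Sum>b\<in>B. c b x *\<^sub>R b) = x"
    using finite_dim_coordinates[OF model_finite_dim] by metis
  let ?W = "U \<inter> W" and ?h = "h \<circ> inv_into U \<kappa>"
  have oW: "openin (mtop M) ?W" using chart_openin[OF U(1)] assms(2) by (rule openin_Int)
  have D: "(?h has_derivative frechet_derivative ?h (at (\<kappa> p))) (at (\<kappa> p))" if "p \<in> ?W" for p
    using that U by (intro smooth_fun_on_has_derivative[OF assms(3)]) (auto simp: charts_at_def)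
  have e: "vf_apply M X h p = (\<Sum>b\<in>B. c b (snd (X p) (U, \<kappa>)) * frechet_derivative ?h (at (\<kappa> p)) b)"
    if p: "p \<in> ?W" for p
  proof -
    have "vf_apply M X h p = frechet_derivative ?h (at (\<kappa> p)) (snd (X p) (U, \<kappa>))"
      using p U chart_subset[OF U(1)] by (intro vf_apply_chart vector_fieldsD(2)[OF X] D) (auto simp: charts_at_def)
    also have "\<dots> = frechet_derivative ?h (at (\<kappa> p)) (\<Sum>b\<in>B. c b (snd (X p) (U, \<kappa>)) *\<^sub>R b)"
      by (simp add: B)
    finally show ?thesis
      using has_derivative_linear[OF D[OF p]] by (simp add: linear_sum linear_scale)
  qed
  have Db: "smooth_fun_on M ?W (\<lambda>p. frechet_derivative ?h (at (\<kappa> p)) b)" for b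
  proof (rule smooth_fun_on_in_chart[OF U(1) oW])
    have "smooth_on (\<kappa> ` ?W) (\<lambda>y. frechet_derivative ?h (at y) b)"
      by (rule smooth_on_frechet_derivative[OF smooth_fun_onD[OF assms(3) U(1)]])
    moreover have "open (\<kappa> ` ?W)" by (rule open_chart_image[OF assms(2) U(1)])
    ultimately show "smooth_on (\<kappa> ` ?W) ((\<lambda>p. frechet_derivative ?h (at (\<kappa> p)) b) \<circ> inv_into U \<kappa>)"
      using smooth_on_cong chart_inv[OF U(1)] by (smt (verit) IntE comp_apply imageE)
  qed auto
  have "smooth_fun_on M ?W (\<lambda>p. \<Sum>b\<in>B. c b (snd (X p) (U, \<kappa>)) * frechet_derivative ?h (at (\<kappa> p)) b)"
    by (intro smooth_fun_on_sum smooth_fun_on_bilinear[OF bounded_bilinear_mult] Db oW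
        smooth_fun_on_compose_linear[OF blinfun.bounded_linear_right]
        smooth_fun_on_subset[OF vector_fieldsD(3)[OF X U(1)]]) auto
  then have "smooth_fun_on M ?W (vf_apply M X h)"
    by (rule smooth_fun_on_cong[OF oW, rotated]) (simp add: e)
  then show "\<exists>W'. openin (mtop M) W' \<and> x \<in> W' \<and> smooth_fun_on M W' (vf_apply M X h)"
    using oW x U(2) by blast
qed

lemma vf_apply_at:
  assumes "X \<in> vector_fields M" "(U, \<kappa>) \<in> charts_at M p" "smooth_fun_on M W h" "p \<in> W"
  shows "vf_apply M X h p = frechet_derivative (h \<circ> inv_into U \<kappa>) (at (\<kappa> p)) (snd (X p) (U, \<kappa>))"
proof -
  have "p \<in> pts M" using assms(2) chart_subset by (auto simp: charts_at_def)
  then show ?thesis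
    using assms by (intro vf_apply_chart vector_fieldsD(2) smooth_fun_on_has_derivative)
qed

text \<open>Derivatives are local. This lets a restricted function, \<open>undefined\<close> off
  \<open>pts M\<close>, be exchanged for the plain expression it equals on
  \<open>pts M\<close>.\<close>

lemma vf_apply_cong:
  assumes "X \<in> vector_fields M" "openin (mtop M) W" "p \<in> W" "\<And>x. x \<in> W \<Longrightarrow> h x = h' x" "smooth_fun_on M W h"
  shows "vf_apply M X h p = vf_apply M X h' p"
proof -
  have p: "p \<in> pts M" using assms(2,3) openin_mtop by auto
  then obtain U \<kappa> where U: "(U, \<kappa>) \<in> atlas M" "p \<in> U" by (rule chart_at_ex)
  then have ch: "(U, \<kappa>) \<in> charts_at M p" by (simp add: charts_at_def)
  have "((h' \<circ> inv_into U \<kappa>) has_derivative frechet_derivative (h \<circ> inv_into U \<kappa>) (at (\<kappa> p))) (at (\<kappa> p))"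
    by (rule has_derivative_transform_within_open[OF smooth_fun_on_has_derivative[OF assms(5) ch assms(3)]
          open_chart_image[OF assms(2) U(1)]])
      (use U assms(3,4) chart_inv[OF U(1)] in auto)
  then show ?thesis
    using vf_apply_at[OF assms(1) ch assms(5,3)]
      vf_apply_chart[where X = X and p = p and h = h', OF vector_fieldsD(2)[OF assms(1) p] ch] by metis
qed

lemma vf_apply_add:
  assumes "X \<in> vector_fields M" "smooth_fun_on M W h" "smooth_fun_on M W k" "p \<in> W" "p \<in> pts M"
  shows "vf_apply M X (\<lambda>x. h x + k x) p = vf_apply M X h p + vf_apply M X k p"
proof -
  obtain U \<kappa> where "(U, \<kappa>) \<in> atlas M" "p \<in> U" using chart_at_ex[OF assms(5)] .
  then have ch: "(U, \<kappa>) \<in> charts_at M p" by (simp add: charts_at_def)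
  have "(((\<lambda>x. h x + k x) \<circ> inv_into U \<kappa>) has_derivative
      (\<lambda>v. frechet_derivative (h \<circ> inv_into U \<kappa>) (at (\<kappa> p)) v
        + frechet_derivative (k \<circ> inv_into U \<kappa>) (at (\<kappa> p)) v)) (at (\<kappa> p))"
    using has_derivative_add[OF smooth_fun_on_has_derivative[OF assms(2) ch assms(4)]
        smooth_fun_on_has_derivative[OF assms(3) ch assms(4)]] by (simp add: o_def)
  from vf_apply_chart[where X = X, OF vector_fieldsD(2)[OF assms(1,5)] ch this] show ?thesis
    unfolding vf_apply_at[OF assms(1) ch assms(2,4)] vf_apply_at[OF assms(1) ch assms(3,4)] .
qed

lemma vf_apply_mult:
  assumes "X \<in> vector_fields M" "smooth_fun_on M W h" "smooth_fun_on M W k" "p \<in> W" "p \<in> pts M"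
  shows "vf_apply M X (\<lambda>x. h x * k x) p = h p * vf_apply M X k p + vf_apply M X h p * k p"
proof -
  obtain U \<kappa> where U: "(U, \<kappa>) \<in> atlas M" "p \<in> U" using chart_at_ex[OF assms(5)] .
  then have ch: "(U, \<kappa>) \<in> charts_at M p" by (simp add: charts_at_def)
  have "(((\<lambda>x. h x * k x) \<circ> inv_into U \<kappa>) has_derivative
      (\<lambda>v. h p * frechet_derivative (k \<circ> inv_into U \<kappa>) (at (\<kappa> p)) v
        + frechet_derivative (h \<circ> inv_into U \<kappa>) (at (\<kappa> p)) v * k p)) (at (\<kappa> p))"
    using has_derivative_mult[OF smooth_fun_on_has_derivative[OF assms(2) ch assms(4)]
        smooth_fun_on_has_derivative[OF assms(3) ch assms(4)]] by (simp add: o_def chart_inv[OF U])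
  from vf_apply_chart[where X = X, OF vector_fieldsD(2)[OF assms(1,5)] ch this] show ?thesis
    unfolding vf_apply_at[OF assms(1) ch assms(2,4)] vf_apply_at[OF assms(1) ch assms(3,4)] .
qed

end

section \<open>Manifolds\<close>

locale smooth_mfd = smooth_atlas M for M :: "('p, 'a::real_normed_vector) manifold" +
  assumes Hausdorff: "Hausdorff_space (mtop M)"

lemma smooth_mfdI: "smooth_manifold M \<Longrightarrow> smooth_mfd M"
  unfolding smooth_manifold_def by unfold_locales (fast+)

context smooth_mfd
begin

text \<open>The compact support in the model is carried over by the inverse chart, which is
  continuous. Hausdorffness makes the resulting \<open>K\<close> closed, so that the complement of
  \<open>K\<close> is open and the extension by zero is smooth there as well.\<close>

lemma bump_exists:
  assumes "openin (mtop M) W" "x0 \<in> W"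
  obtains \<phi> :: "'p \<Rightarrow> real" and K where
    "smooth_fun_on M (pts M) \<phi>" "\<phi> x0 = 1" "closedin (mtop M) K" "K \<subseteq> W" "\<And>x. x \<notin> K \<Longrightarrow> \<phi> x = 0"
proof -
  have "x0 \<in> pts M" using assms openin_mtop by auto
  then obtain U \<kappa> where U: "(U, \<kappa>) \<in> atlas M" "x0 \<in> U" by (rule chart_at_ex)
  have "open (\<kappa> ` (U \<inter> W))" "\<kappa> x0 \<in> \<kappa> ` (U \<inter> W)"
    using open_chart_image[OF assms(1) U(1)] U assms by auto
  then obtain \<rho> :: "'a \<Rightarrow> real" and C where \<rho>: "smooth_on UNIV \<rho>" "\<rho> (\<kappa> x0) = 1" "compact C"
      "C \<subseteq> \<kappa> ` (U \<inter> W)" "\<And>y. y \<notin> C \<Longrightarrow> \<rho> y = 0"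
    using smooth_bump_normed[OF model_finite_dim] by metis
  define K where "K = inv_into U \<kappa> ` C"
  define \<phi> where "\<phi> x = (if x \<in> U then \<rho> (\<kappa> x) else 0)" for x
  have "continuous_map (top_of_set (\<kappa> ` U)) (mtop M) (inv_into U \<kappa>)"
    unfolding continuous_map
  proof (intro conjI allI impI)
    show "inv_into U \<kappa> ` topspace (top_of_set (\<kappa> ` U)) \<subseteq> topspace (mtop M)"
      using chart_inv[OF U(1)] chart_subset[OF U(1)] by (auto simp: topspace_mtop)
    fix W' assume "openin (mtop M) W'"
    then have "open (\<kappa> ` (U \<inter> W'))" by (rule open_chart_image[OF _ U(1)])
    moreover have "{y \<in> topspace (top_of_set (\<kappa> ` U)). inv_into U \<kappa> y \<in> W'} = \<kappa> ` (U \<inter> W')"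
      using chart_inv[OF U(1)] by auto
    ultimately show "openin (top_of_set (\<kappa> ` U)) {y \<in> topspace (top_of_set (\<kappa> ` U)). inv_into U \<kappa> y \<in> W'}"
      by (simp add: open_subset image_mono)
  qed
  moreover have "compactin (top_of_set (\<kappa> ` U)) C"
    using \<rho>(3,4) by (auto simp: compactin_subtopology)
  ultimately have "compactin (mtop M) K"
    unfolding K_def using image_compactin by blast
  then have cK: "closedin (mtop M) K" using Hausdorff compactin_imp_closedin by blast
  have KW: "K \<subseteq> W \<inter> U" unfolding K_def using \<rho>(4) chart_inv[OF U(1)] by auto
  have z: "\<phi> x = 0" if "x \<notin> K" for x
  proof (cases "x \<in> U")
    case True
    then have "\<kappa> x \<notin> C" using that chart_inv[OF U(1) True] by (force simp: K_def)
    then show ?thesis by (simp add: \<phi>_def \<rho>(5))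
  qed (simp add: \<phi>_def)
  have "smooth_fun_on M (pts M) \<phi>"
  proof (rule smooth_fun_on_local)
    fix x assume x: "x \<in> pts M"
    show "\<exists>W'. openin (mtop M) W' \<and> x \<in> W' \<and> smooth_fun_on M W' \<phi>"
    proof (cases "x \<in> U")
      case True
      have "smooth_fun_on M U (\<lambda>x. \<rho> (\<kappa> x))"
        using smooth_fun_on_compose_chart[OF U(1) open_UNIV \<rho>(1)] by simp
      then have "smooth_fun_on M U \<phi>"
        by (rule smooth_fun_on_cong[OF chart_openin[OF U(1)], rotated]) (simp add: \<phi>_def)
      then show ?thesis using True chart_openin[OF U(1)] by blast
    next
      case False
      have o: "openin (mtop M) (pts M - K)"
        using cK openin_pts by (rule openin_diff[rotated])
      have "smooth_fun_on M (pts M - K) \<phi>"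
        by (rule smooth_fun_on_cong[OF o _ smooth_fun_on_const[of _ 0]]) (simp add: z)
      moreover have "x \<in> pts M - K" using x False KW by auto
      ultimately show ?thesis using o by blast
    qed
  qed
  moreover have "\<phi> x0 = 1" using U \<rho>(2) by (simp add: \<phi>_def)
  ultimately show ?thesis using that cK KW z by blast
qed

text \<open>The open sets \<open>W\<close> and \<open>pts M - K\<close> cover everything, and on the
  second the function is 0. The additional open set \<open>V\<close> allows \<open>g\<close> to be
  an expression that makes sense only over the domain of a second trivialization.\<close>

lemma smooth_extend_by_zero:
  assumes "openin (mtop M) W" "smooth_fun_on M (pts M) \<phi>" "closedin (mtop M) K" "K \<subseteq> W"
    and "\<And>x. x \<notin> K \<Longrightarrow> \<phi> x = (0::real)" and "openin (mtop M) V" "smooth_fun_on M (W \<inter> V) g"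
  shows "smooth_fun_on M V (\<lambda>x. if x \<in> W then \<phi> x *\<^sub>R g x else 0)"
proof (rule smooth_fun_on_local)
  fix x assume x: "x \<in> V"
  let ?f = "\<lambda>x. if x \<in> W then \<phi> x *\<^sub>R g x else 0"
  have W: "W \<subseteq> pts M" "V \<subseteq> pts M" using assms(1,6) openin_mtop by auto
  show "\<exists>W'. openin (mtop M) W' \<and> x \<in> W' \<and> smooth_fun_on M W' ?f"
  proof (cases "x \<in> W")
    case True
    have o: "openin (mtop M) (W \<inter> V)" using assms(1,6) by (rule openin_Int)
    have "smooth_fun_on M (W \<inter> V) (\<lambda>x. \<phi> x *\<^sub>R g x)"
      using W by (intro smooth_fun_on_bilinear[OF bounded_bilinear_scaleR o] assms(7)
          smooth_fun_on_subset[OF assms(2)]) auto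
    then have "smooth_fun_on M (W \<inter> V) ?f"
      by (rule smooth_fun_on_cong[OF o, rotated]) simp
    then show ?thesis using True x o by blast
  next
    case False
    have o: "openin (mtop M) (pts M - K)"
      using assms(3) openin_pts by (rule openin_diff[rotated])
    have "smooth_fun_on M (pts M - K) ?f"
      by (rule smooth_fun_on_cong[OF o _ smooth_fun_on_const[of _ 0]]) (simp add: assms(5))
    moreover have "x \<in> pts M - K" using x W False assms(4) by auto
    ultimately show ?thesis using o by blast
  qed
qed

end

section \<open>Vector bundles\<close>

locale smooth_bundle =
  fixes M :: "('p, 'a::real_normed_vector) manifold"
    and G :: "('p, 'e, 'v::real_normed_vector) vbundle"
  assumes is_bundle: "smooth_vector_bundle M G"

sublocale smooth_bundle \<subseteq> smooth_mfd M
  using is_bundle by (intro smooth_mfdI) (simp add: smooth_vector_bundle_def)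

context smooth_bundle
begin

lemma fibre_model_finite_dim: "finite_dim TYPE('v)"
  using is_bundle by (simp add: smooth_vector_bundle_def)

lemma bproj_in: "e \<in> tspace G \<Longrightarrow> bproj G e \<in> pts M"
  using is_bundle[unfolded smooth_vector_bundle_def, THEN conjunct2, THEN conjunct2, THEN conjunct1] by blast

lemma fadd_in: "x \<in> pts M \<Longrightarrow> e \<in> fibre G x \<Longrightarrow> e' \<in> fibre G x \<Longrightarrow> fadd G e e' \<in> fibre G x"
  using is_bundle[unfolded smooth_vector_bundle_def, THEN conjunct2, THEN conjunct2, THEN conjunct2, THEN conjunct1] by blast

lemma fscale_in: "x \<in> pts M \<Longrightarrow> e \<in> fibre G x \<Longrightarrow> fscale G r e \<in> fibre G x"
  using is_bundle[unfolded smooth_vector_bundle_def, THEN conjunct2, THEN conjunct2, THEN conjunct2, THEN conjunct1] by blast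

lemma triv_at_ex:
  assumes "x \<in> pts M"
  obtains U \<psi> where "(U, \<psi>) \<in> trivs G" "x \<in> U"
proof -
  have "\<Union>(fst ` trivs G) = pts M" using is_bundle by (simp add: smooth_vector_bundle_def)
  then show ?thesis using assms that by fastforce
qed

lemma
  assumes "(U, \<psi>) \<in> trivs G"
  shows triv_openin: "openin (mtop M) U"
    and triv_bij: "x \<in> U \<Longrightarrow> bij_betw \<psi> (fibre G x) UNIV"
    and triv_scale: "x \<in> U \<Longrightarrow> e \<in> fibre G x \<Longrightarrow> \<psi> (fscale G r e) = r *\<^sub>R \<psi> e"
    and triv_add: "x \<in> U \<Longrightarrow> e \<in> fibre G x \<Longrightarrow> e' \<in> fibre G x \<Longrightarrow> \<psi> (fadd G e e') = \<psi> e + \<psi> e'"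
proof -
  from bspec[OF is_bundle[unfolded smooth_vector_bundle_def, THEN conjunct2, THEN conjunct2, THEN conjunct2, THEN conjunct2, THEN conjunct2, THEN conjunct1] assms]
  show "openin (mtop M) U" "x \<in> U \<Longrightarrow> bij_betw \<psi> (fibre G x) UNIV"
    "x \<in> U \<Longrightarrow> e \<in> fibre G x \<Longrightarrow> \<psi> (fscale G r e) = r *\<^sub>R \<psi> e"
    "x \<in> U \<Longrightarrow> e \<in> fibre G x \<Longrightarrow> e' \<in> fibre G x \<Longrightarrow> \<psi> (fadd G e e') = \<psi> e + \<psi> e'"
    by auto
qed

lemma triv_subset: "(U, \<psi>) \<in> trivs G \<Longrightarrow> U \<subseteq> pts M"
  using triv_openin openin_mtop by blast

lemma triv_transition:
  assumes "(U, \<psi>) \<in> trivs G" "(V, \<theta>) \<in> trivs G"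
  shows "smooth_fun_on M (U \<inter> V) (\<lambda>x. \<theta> (triv_inv G \<psi> x v))"
proof -
  from bspec[OF is_bundle[unfolded smooth_vector_bundle_def, THEN conjunct2, THEN conjunct2, THEN conjunct2, THEN conjunct2, THEN conjunct2, THEN conjunct2] assms(1)]
  show ?thesis using assms(2) by auto
qed

lemma triv_inv_in: "(U, \<psi>) \<in> trivs G \<Longrightarrow> x \<in> U \<Longrightarrow> triv_inv G \<psi> x v \<in> fibre G x"
  unfolding triv_inv_def using triv_bij[of U \<psi> x] by (metis UNIV_I bij_betw_def inv_into_into)

lemma triv_triv_inv: "(U, \<psi>) \<in> trivs G \<Longrightarrow> x \<in> U \<Longrightarrow> \<psi> (triv_inv G \<psi> x v) = v"
  unfolding triv_inv_def using triv_bij[of U \<psi> x] by (simp add: bij_betw_inv_into_right)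

lemma triv_inv_triv: "(U, \<psi>) \<in> trivs G \<Longrightarrow> x \<in> U \<Longrightarrow> e \<in> fibre G x \<Longrightarrow> triv_inv G \<psi> x (\<psi> e) = e"
  unfolding triv_inv_def using triv_bij[of U \<psi> x] by (simp add: bij_betw_inv_into_left)

lemma triv_eqD:
  "(U, \<psi>) \<in> trivs G \<Longrightarrow> x \<in> U \<Longrightarrow> e \<in> fibre G x \<Longrightarrow> e' \<in> fibre G x \<Longrightarrow> \<psi> e = \<psi> e' \<Longrightarrow> e = e'"
  by (metis triv_inv_triv)

lemma triv_inv_add:
  assumes "(U, \<psi>) \<in> trivs G" "x \<in> U"
  shows "triv_inv G \<psi> x (v + w) = fadd G (triv_inv G \<psi> x v) (triv_inv G \<psi> x w)"
proof -
  have "x \<in> pts M" using assms triv_subset by blast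
  then show ?thesis
    by (intro triv_eqD[OF assms] triv_inv_in[OF assms] fadd_in)
      (simp_all add: triv_add[OF assms] triv_triv_inv[OF assms] triv_inv_in[OF assms])
qed

lemma triv_inv_scale:
  assumes "(U, \<psi>) \<in> trivs G" "x \<in> U"
  shows "triv_inv G \<psi> x (r *\<^sub>R v) = fscale G r (triv_inv G \<psi> x v)"
proof -
  have "x \<in> pts M" using assms triv_subset by blast
  then show ?thesis
    by (intro triv_eqD[OF assms] triv_inv_in[OF assms] fscale_in)
      (simp_all add: triv_scale[OF assms] triv_triv_inv[OF assms] triv_inv_in[OF assms])
qed

lemma triv_change_linear:
  assumes "(U, \<psi>) \<in> trivs G" "(V, \<theta>) \<in> trivs G" "x \<in> U" "x \<in> V"
  shows "linear (\<lambda>v. \<theta> (triv_inv G \<psi> x v))"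
  by (rule linearI)
    (simp_all add: triv_inv_add[OF assms(1,3)] triv_inv_scale[OF assms(1,3)]
      triv_add[OF assms(2,4)] triv_scale[OF assms(2,4)] triv_inv_in[OF assms(1,3)])

text \<open>The bundle axioms give smooth transition functions for each constant vector; linearity
  in the fibre and a basis extend this to vectors varying smoothly with the base point.\<close>

lemma smooth_triv_change:
  assumes "(U, \<psi>) \<in> trivs G" "(V, \<theta>) \<in> trivs G" "openin (mtop M) W" "W \<subseteq> U \<inter> V" "smooth_fun_on M W g"
  shows "smooth_fun_on M W (\<lambda>x. \<theta> (triv_inv G \<psi> x (g x)))"
proof -
  obtain B and c :: "'v \<Rightarrow> 'v \<Rightarrow>\<^sub>L real" where B: "\<And>x. (\<Sum>b\<in>B. c b x *\<^sub>R b) = x"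
    using finite_dim_coordinates[OF fibre_model_finite_dim] by metis
  have "smooth_fun_on M W (\<lambda>x. \<Sum>b\<in>B. c b (g x) *\<^sub>R \<theta> (triv_inv G \<psi> x b))"
    by (intro smooth_fun_on_sum smooth_fun_on_bilinear[OF bounded_bilinear_scaleR] assms(3)
        smooth_fun_on_compose_linear[OF blinfun.bounded_linear_right] assms(5)
        smooth_fun_on_subset[OF triv_transition[OF assms(1,2)] assms(4)])
  then show ?thesis
  proof (rule smooth_fun_on_cong[OF assms(3), rotated])
    fix x assume "x \<in> W"
    then have lin: "linear (\<lambda>v. \<theta> (triv_inv G \<psi> x v))"
      using assms(4) by (intro triv_change_linear[OF assms(1,2)]) auto
    have "\<theta> (triv_inv G \<psi> x (g x)) = \<theta> (triv_inv G \<psi> x (\<Sum>b\<in>B. c b (g x) *\<^sub>R b))" by (simp add: B)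
    also have "\<dots> = (\<Sum>b\<in>B. c b (g x) *\<^sub>R \<theta> (triv_inv G \<psi> x b))"
      by (simp add: linear_sum[OF lin] linear_scale[OF lin])
    finally show "(\<Sum>b\<in>B. c b (g x) *\<^sub>R \<theta> (triv_inv G \<psi> x b)) = \<theta> (triv_inv G \<psi> x (g x))" by simp
  qed
qed

subsection \<open>Sections\<close>

lemma sectionsI:
  assumes "s \<in> extensional (pts M)" "\<And>x. x \<in> pts M \<Longrightarrow> s x \<in> fibre G x"
    and "\<And>U \<psi>. (U, \<psi>) \<in> trivs G \<Longrightarrow> smooth_fun_on M U (\<lambda>x. \<psi> (s x))"
  shows "s \<in> sections M G"
  using assms unfolding sections_def by (auto simp: PiE_def o_def)

lemma section_in: "s \<in> sections M G \<Longrightarrow> x \<in> pts M \<Longrightarrow> s x \<in> fibre G x"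
  unfolding sections_def by blast

lemma section_smooth: "s \<in> sections M G \<Longrightarrow> (U, \<psi>) \<in> trivs G \<Longrightarrow> smooth_fun_on M U (\<lambda>x. \<psi> (s x))"
  unfolding sections_def by (force simp: o_def)

lemma section_eqI:
  assumes "s \<in> sections M G" "s' \<in> sections M G"
    and "\<And>x U \<psi>. (U, \<psi>) \<in> trivs G \<Longrightarrow> x \<in> U \<Longrightarrow> \<psi> (s x) = \<psi> (s' x)"
  shows "s = s'"
proof (rule extensionalityI[of _ "pts M"])
  show "s \<in> extensional (pts M)" "s' \<in> extensional (pts M)"
    using assms(1,2) by (auto simp: sections_def PiE_def)
  fix x assume x: "x \<in> pts M"
  then obtain U \<psi> where U: "(U, \<psi>) \<in> trivs G" "x \<in> U" by (rule triv_at_ex)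
  then show "s x = s' x"
    using triv_eqD[OF U] section_in assms x by blast
qed

lemma sec_add_in:
  assumes "s \<in> sections M G" "s' \<in> sections M G"
  shows "sec_add M G s s' \<in> sections M G"
proof (rule sectionsI)
  fix U \<psi> assume U: "(U, \<psi>) \<in> trivs G"
  have "smooth_fun_on M U (\<lambda>x. \<psi> (s x) + \<psi> (s' x))"
    by (intro smooth_fun_on_add triv_openin[OF U] section_smooth U assms)
  then show "smooth_fun_on M U (\<lambda>x. \<psi> (sec_add M G s s' x))"
    by (rule smooth_fun_on_cong[OF triv_openin[OF U], rotated])
      (use triv_subset[OF U] in \<open>auto simp: sec_add_def triv_add[OF U] section_in assms subset_iff\<close>)
qed (auto simp: sec_add_def fadd_in section_in assms)

lemma sec_mult_in:
  assumes "smooth_fun_on M (pts M) h" "s \<in> sections M G"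
  shows "sec_mult M G h s \<in> sections M G"
proof (rule sectionsI)
  fix U \<psi> assume U: "(U, \<psi>) \<in> trivs G"
  have "smooth_fun_on M U (\<lambda>x. h x *\<^sub>R \<psi> (s x))"
    by (intro smooth_fun_on_bilinear[OF bounded_bilinear_scaleR] triv_openin[OF U] section_smooth U assms
        smooth_fun_on_subset[OF assms(1)] triv_subset[OF U])
  then show "smooth_fun_on M U (\<lambda>x. \<psi> (sec_mult M G h s x))"
    by (rule smooth_fun_on_cong[OF triv_openin[OF U], rotated])
      (use triv_subset[OF U] in \<open>auto simp: sec_mult_def triv_scale[OF U] section_in assms subset_iff\<close>)
qed (auto simp: sec_mult_def fscale_in section_in assms)

lemma triv_sec_add:
  "s \<in> sections M G \<Longrightarrow> s' \<in> sections M G \<Longrightarrow> (U, \<psi>) \<in> trivs G \<Longrightarrow> x \<in> U \<Longrightarrow>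
    \<psi> (sec_add M G s s' x) = \<psi> (s x) + \<psi> (s' x)"
  using triv_subset by (auto simp: sec_add_def triv_add section_in subset_iff)

lemma triv_sec_mult:
  "s \<in> sections M G \<Longrightarrow> (U, \<psi>) \<in> trivs G \<Longrightarrow> x \<in> U \<Longrightarrow> \<psi> (sec_mult M G h s x) = h x *\<^sub>R \<psi> (s x)"
  using triv_subset by (auto simp: sec_mult_def triv_scale section_in subset_iff)

lemma fibre_nonempty: "x \<in> pts M \<Longrightarrow> \<exists>e. e \<in> fibre G x"
  using triv_at_ex triv_inv_in by metis

text \<open>The bundle record has no zero section; the zero vector of a fibre is obtained as 0 times
  an arbitrary element.\<close>

definition zero_at :: "'p \<Rightarrow> 'e" where
  "zero_at x = fscale G 0 (SOME e. e \<in> fibre G x)"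

lemma zero_at_in: "x \<in> pts M \<Longrightarrow> zero_at x \<in> fibre G x"
  unfolding zero_at_def by (intro fscale_in someI_ex[OF fibre_nonempty])

lemma triv_zero_at:
  assumes "(U, \<psi>) \<in> trivs G" "x \<in> U"
  shows "\<psi> (zero_at x) = 0"
proof -
  have "x \<in> pts M" using triv_subset assms by blast
  from triv_scale[OF assms someI_ex[OF fibre_nonempty[OF this]], of 0] show ?thesis
    by (simp add: zero_at_def)
qed

text \<open>Seen in another trivialization, the section becomes a vector-valued function extended by
  zero, because transition functions are linear and send 0 to 0.\<close>

lemma section_extend_by_zero:
  assumes "(U, \<psi>) \<in> trivs G" "smooth_fun_on M (pts M) \<phi>" "closedin (mtop M) K" "K \<subseteq> U"
    and "\<And>x. x \<notin> K \<Longrightarrow> \<phi> x = 0" "smooth_fun_on M U g"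
  shows "(\<lambda>x\<in>pts M. if x \<in> U then triv_inv G \<psi> x (\<phi> x *\<^sub>R g x) else zero_at x) \<in> sections M G"
    (is "?s \<in> _")
proof (rule sectionsI)
  fix V \<theta> assume V: "(V, \<theta>) \<in> trivs G"
  have oUV: "openin (mtop M) (U \<inter> V)" using triv_openin assms(1) V by blast
  have "smooth_fun_on M V (\<lambda>x. if x \<in> U then \<phi> x *\<^sub>R \<theta> (triv_inv G \<psi> x (g x)) else 0)"
    by (rule smooth_extend_by_zero[OF triv_openin[OF assms(1)] assms(2-5) triv_openin[OF V]])
      (auto intro!: smooth_triv_change[OF assms(1) V oUV] smooth_fun_on_subset[OF assms(6)])
  then show "smooth_fun_on M V (\<lambda>x. \<theta> (?s x))"
    by (rule smooth_fun_on_cong[OF triv_openin[OF V], rotated])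
      (use triv_subset[OF V] in \<open>auto simp: triv_zero_at[OF V] triv_inv_scale[OF assms(1)] triv_scale[OF V]
          triv_inv_in[OF assms(1)]\<close>)
qed (auto simp: triv_inv_in[OF assms(1)] zero_at_in)

lemma section_through:
  assumes "x \<in> pts M" "e \<in> fibre G x"
  obtains s where "s \<in> sections M G" "s x = e"
proof -
  obtain U \<psi> where U: "(U, \<psi>) \<in> trivs G" "x \<in> U" using assms(1) by (rule triv_at_ex)
  obtain \<phi> :: "'p \<Rightarrow> real" and K where \<phi>: "smooth_fun_on M (pts M) \<phi>" "\<phi> x = 1" "closedin (mtop M) K" "K \<subseteq> U"
    "\<And>x. x \<notin> K \<Longrightarrow> \<phi> x = 0"
    using bump_exists[OF triv_openin[OF U(1)] U(2)] by metis
  note s = section_extend_by_zero[OF U(1) \<phi>(1,3-5) smooth_fun_on_const[of U "\<psi> e"]]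
  show ?thesis
    using that[OF s] assms U \<phi>(2) by (simp add: triv_inv_triv[OF U])
qed

lemma Cinf_restrict:
  assumes "smooth_fun_on M (pts M) h"
  shows "restrict h (pts M) \<in> Cinf M"
  unfolding Cinf_def using smooth_fun_on_cong[OF openin_pts _ assms] by auto

lemma Cinf_smooth: "h \<in> Cinf M \<Longrightarrow> smooth_fun_on M (pts M) h"
  unfolding Cinf_def by auto

subsection \<open>Dual sections from function-linear maps\<close>

text \<open>The fibre coordinate of \<open>dual_bundle\<close> belonging to \<open>\<psi>\<close>,
  with the base point as a separate argument.\<close>

definition covec :: "('e \<Rightarrow> 'v) \<Rightarrow> 'p \<Rightarrow> ('e \<Rightarrow> real) \<Rightarrow> 'v \<Rightarrow>\<^sub>L real" where
  "covec \<psi> x \<alpha> = Blinfun (\<lambda>v. \<alpha> (triv_inv G \<psi> x v))"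

lemma dual_spaceD:
  assumes "\<alpha> \<in> dual_space G x"
  shows "e \<in> fibre G x \<Longrightarrow> \<alpha> (fscale G r e) = r * \<alpha> e"
    and "e \<in> fibre G x \<Longrightarrow> e' \<in> fibre G x \<Longrightarrow> \<alpha> (fadd G e e') = \<alpha> e + \<alpha> e'"
    and "\<alpha> \<in> extensional (fibre G x)"
  using assms unfolding dual_space_def by auto

lemma dual_spaceI:
  assumes "x \<in> pts M"
    and "\<And>e r. e \<in> fibre G x \<Longrightarrow> \<alpha> (fscale G r e) = r * \<alpha> e"
    and "\<And>e e'. e \<in> fibre G x \<Longrightarrow> e' \<in> fibre G x \<Longrightarrow> \<alpha> (fadd G e e') = \<alpha> e + \<alpha> e'"
  shows "restrict \<alpha> (fibre G x) \<in> dual_space G x"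
  using assms unfolding dual_space_def by (auto simp: fadd_in fscale_in)

text \<open>\<open>Blinfun\<close> says something only for bounded linear arguments: linearity comes
  from the trivialization, boundedness from finite dimension.\<close>

lemma covec_apply:
  assumes "(U, \<psi>) \<in> trivs G" "x \<in> U" "\<alpha> \<in> dual_space G x"
  shows "covec \<psi> x \<alpha> v = \<alpha> (triv_inv G \<psi> x v)"
proof -
  have "linear (\<lambda>v. \<alpha> (triv_inv G \<psi> x v))"
    by (rule linearI)
      (simp_all add: triv_inv_add[OF assms(1,2)] triv_inv_scale[OF assms(1,2)] dual_spaceD[OF assms(3)]
        triv_inv_in[OF assms(1,2)])
  then show ?thesis unfolding covec_def
    by (simp add: bounded_linear_Blinfun_apply finite_dim_linear_bounded[OF fibre_model_finite_dim])
qed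

lemma covec_triv:
  "(U, \<psi>) \<in> trivs G \<Longrightarrow> x \<in> U \<Longrightarrow> \<alpha> \<in> dual_space G x \<Longrightarrow> g \<in> fibre G x \<Longrightarrow> covec \<psi> x \<alpha> (\<psi> g) = \<alpha> g"
  by (simp add: covec_apply triv_inv_triv)

lemma dual_of_covec:
  fixes k :: "'v \<Rightarrow>\<^sub>L real"
  assumes "(U, \<psi>) \<in> trivs G" "x \<in> U"
  shows "(\<lambda>e\<in>fibre G x. k (\<psi> e)) \<in> dual_space G x"
  using assms triv_subset[OF assms(1)]
  by (intro dual_spaceI)
    (auto simp: triv_add[OF assms] triv_scale[OF assms] blinfun.add_right blinfun.scaleR_right)

lemma covec_dual:
  fixes k :: "'v \<Rightarrow>\<^sub>L real"
  assumes "(U, \<psi>) \<in> trivs G" "x \<in> U"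
  shows "covec \<psi> x (\<lambda>e\<in>fibre G x. k (\<psi> e)) = k"
  by (rule blinfun_eqI)
    (simp add: covec_apply[OF assms dual_of_covec[OF assms]] triv_inv_in[OF assms] triv_triv_inv[OF assms])

lemma dual_of_covec_covec:
  assumes "(U, \<psi>) \<in> trivs G" "x \<in> U" "\<alpha> \<in> dual_space G x"
  shows "(\<lambda>e\<in>fibre G x. covec \<psi> x \<alpha> (\<psi> e)) = \<alpha>"
  by (rule extensionalityI[OF _ dual_spaceD(3)[OF assms(3)]]) (auto simp: covec_triv[OF assms])

lemma fibre_dual: "x \<in> pts M \<Longrightarrow> fibre (dual_bundle M G) x = {x} \<times> dual_space G x"
  unfolding fibre_def dual_bundle_def by auto

lemma dual_section_in:
  assumes "\<gamma> \<in> sections M (dual_bundle M G)" "x \<in> pts M"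
  shows "fst (\<gamma> x) = x" "snd (\<gamma> x) \<in> dual_space G x"
proof -
  have "\<gamma> x \<in> fibre (dual_bundle M G) x" using assms unfolding sections_def by blast
  then show "fst (\<gamma> x) = x" "snd (\<gamma> x) \<in> dual_space G x" by (auto simp: fibre_dual[OF assms(2)])
qed

lemma dual_section_smooth:
  assumes "\<gamma> \<in> sections M (dual_bundle M G)" "(U, \<psi>) \<in> trivs G"
  shows "smooth_fun_on M U (\<lambda>x. covec \<psi> x (snd (\<gamma> x)))"
proof -
  have "(U, \<lambda>(x, \<alpha>). Blinfun (\<lambda>v. \<alpha> (triv_inv G \<psi> x v))) \<in> trivs (dual_bundle M G)"
    using assms(2) by (auto simp: dual_bundle_def)
  then have "smooth_fun_on M U ((\<lambda>(x, \<alpha>). Blinfun (\<lambda>v. \<alpha> (triv_inv G \<psi> x v))) \<circ> \<gamma>)"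
    using assms(1) unfolding sections_def by blast
  then show ?thesis
    by (rule smooth_fun_on_cong[OF triv_openin[OF assms(2)], rotated])
      (use triv_subset[OF assms(2)] dual_section_in[OF assms(1)] in \<open>auto simp: covec_def split_beta subset_iff\<close>)
qed

lemma dual_sectionsI:
  assumes "\<gamma> \<in> extensional (pts M)"
    and "\<And>x. x \<in> pts M \<Longrightarrow> fst (\<gamma> x) = x \<and> snd (\<gamma> x) \<in> dual_space G x"
    and "\<And>U \<psi>. (U, \<psi>) \<in> trivs G \<Longrightarrow> smooth_fun_on M U (\<lambda>x. covec \<psi> x (snd (\<gamma> x)))"
  shows "\<gamma> \<in> sections M (dual_bundle M G)"
proof -
  have "smooth_fun_on M U (\<theta> \<circ> \<gamma>)" if "(U, \<theta>) \<in> trivs (dual_bundle M G)" for U \<theta>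
  proof -
    from that obtain \<psi> where \<psi>: "(U, \<psi>) \<in> trivs G" "\<theta> = (\<lambda>(x, \<alpha>). Blinfun (\<lambda>v. \<alpha> (triv_inv G \<psi> x v)))"
      by (auto simp: dual_bundle_def)
    show ?thesis
      by (rule smooth_fun_on_cong[OF triv_openin[OF \<psi>(1)] _ assms(3)[OF \<psi>(1)]])
        (use triv_subset[OF \<psi>(1)] assms(2) in \<open>auto simp: \<psi>(2) covec_def split_beta subset_iff\<close>)
  qed
  moreover have "\<gamma> x \<in> fibre (dual_bundle M G) x" if "x \<in> pts M" for x
    using assms(2)[OF that] by (auto simp: fibre_dual[OF that] mem_Times_iff)
  ultimately show ?thesis using assms(1) unfolding sections_def by (auto simp: PiE_def)
qed

end

text \<open>Maps from sections to functions that are linear over smooth functions are pairings with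
  dual sections. The locale serves twice: for the map defining the dual derivation, and for
  producing dual sections with a prescribed value.\<close>

locale function_linear = smooth_bundle M G
  for M :: "('p, 'a::real_normed_vector) manifold" and G :: "('p, 'e, 'v::real_normed_vector) vbundle" +
  fixes L :: "('p \<Rightarrow> 'e) \<Rightarrow> 'p \<Rightarrow> real"
  assumes L_add: "s \<in> sections M G \<Longrightarrow> s' \<in> sections M G \<Longrightarrow> x \<in> pts M \<Longrightarrow> L (sec_add M G s s') x = L s x + L s' x"
    and L_mult: "h \<in> Cinf M \<Longrightarrow> s \<in> sections M G \<Longrightarrow> x \<in> pts M \<Longrightarrow> L (sec_mult M G h s) x = h x * L s x"
    and L_smooth: "s \<in> sections M G \<Longrightarrow> smooth_fun_on M (pts M) (L s)"
begin

text \<open>Module linearity of \<open>L\<close> iterated over a finite family of sections with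
  variable coefficients. The fixed section \<open>s\<close> is there for the empty
  combination.\<close>

lemma finite_combination:
  assumes "finite I" "\<And>i. i \<in> I \<Longrightarrow> h i \<in> Cinf M" "\<And>i. i \<in> I \<Longrightarrow> t i \<in> sections M G" "s \<in> sections M G"
  shows "\<exists>S\<in>sections M G. (\<forall>U \<psi> x. (U, \<psi>) \<in> trivs G \<longrightarrow> x \<in> U \<longrightarrow> \<psi> (S x) = (\<Sum>i\<in>I. h i x *\<^sub>R \<psi> (t i x))) \<and>
    (\<forall>x\<in>pts M. L S x = (\<Sum>i\<in>I. h i x * L (t i) x))"
  using assms
proof (induct I)
  case empty
  let ?z = "restrict (\<lambda>x. 0) (pts M)"
  have z: "?z \<in> Cinf M" by (rule Cinf_restrict[OF smooth_fun_on_const])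
  show ?case
    \<comment> \<open>The zero section, obtained as a zero multiple of the given section
      \<open>s\<close>.\<close>
    by (rule bexI[of _ "sec_mult M G ?z s"])
      (use triv_subset in \<open>auto simp: triv_sec_mult empty subset_iff L_mult z intro!: sec_mult_in Cinf_smooth\<close>)
next
  case (insert i I)
  from insert obtain S where S: "S \<in> sections M G"
    "\<And>U \<psi> x. (U, \<psi>) \<in> trivs G \<Longrightarrow> x \<in> U \<Longrightarrow> \<psi> (S x) = (\<Sum>i\<in>I. h i x *\<^sub>R \<psi> (t i x))"
    "\<And>x. x \<in> pts M \<Longrightarrow> L S x = (\<Sum>i\<in>I. h i x * L (t i) x)" by auto
  have hi: "h i \<in> Cinf M" "t i \<in> sections M G" using insert by auto
  have m: "sec_mult M G (h i) (t i) \<in> sections M G" by (intro sec_mult_in Cinf_smooth hi)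
  show ?case
    by (rule bexI[of _ "sec_add M G (sec_mult M G (h i) (t i)) S"])
      (use insert(1,2) in \<open>auto simp: triv_sec_add triv_sec_mult S m hi L_add L_mult intro!: sec_add_in\<close>)
qed

text \<open>Near \<open>x0\<close>, a section \<open>s\<close> is \<open>(1 - \<phi>\<^sup>2) s\<close> plus a combination of the global sections
  \<open>\<phi> b\<close> with global coefficient functions \<open>\<phi> s\<^sub>b\<close>, where \<open>\<phi>\<close> is a bump function at \<open>x0\<close>.\<close>

lemma local_representation:
  assumes U: "(U, \<psi>) \<in> trivs G" and x0: "x0 \<in> U"
  obtains W and a :: "'p \<Rightarrow> 'v \<Rightarrow>\<^sub>L real" where
    "openin (mtop M) W" "x0 \<in> W" "W \<subseteq> U" "smooth_fun_on M W a"
    "\<And>s x. s \<in> sections M G \<Longrightarrow> x \<in> W \<Longrightarrow> L s x = a x (\<psi> (s x))"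
proof -
  obtain B and c :: "'v \<Rightarrow> 'v \<Rightarrow>\<^sub>L real" where B: "finite B" "\<And>x. (\<Sum>b\<in>B. c b x *\<^sub>R b) = x"
    using finite_dim_coordinates[OF fibre_model_finite_dim] by metis
  obtain \<phi> :: "'p \<Rightarrow> real" and K where \<phi>: "smooth_fun_on M (pts M) \<phi>" "\<phi> x0 = 1" "closedin (mtop M) K" "K \<subseteq> U"
    "\<And>x. x \<notin> K \<Longrightarrow> \<phi> x = 0"
    using bump_exists[OF triv_openin[OF U] x0] by metis
  define \<epsilon> where "\<epsilon> b = (\<lambda>x\<in>pts M. if x \<in> U then triv_inv G \<psi> x (\<phi> x *\<^sub>R b) else zero_at x)" for b
  have \<epsilon>: "\<epsilon> b \<in> sections M G" for b
    unfolding \<epsilon>_def by (rule section_extend_by_zero[OF U \<phi>(1,3-5) smooth_fun_on_const])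
  \<comment> \<open>Nonvanishing of \<open>\<phi>\<close> is an open condition that holds at
    \<open>x0\<close>, and it is all that the divisions by \<open>\<phi>\<close> require.\<close>
  define W where "W = {x \<in> U. \<phi> x \<in> - {0}}"
  have oW: "openin (mtop M) W"
    unfolding W_def
    by (rule smooth_fun_on_open_preimage[OF triv_openin[OF U] smooth_fun_on_subset[OF \<phi>(1) triv_subset[OF U]]]) auto
  have WU: "W \<subseteq> U" "W \<subseteq> pts M" using triv_subset[OF U] by (auto simp: W_def)
  define a where "a x = (\<Sum>b\<in>B. (inverse (\<phi> x) * L (\<epsilon> b) x) *\<^sub>R c b)" for x
  have "smooth_fun_on M W a"
    unfolding a_def
    by (intro smooth_fun_on_sum smooth_fun_on_bilinear[OF bounded_bilinear_scaleR] oW smooth_fun_on_const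
        smooth_fun_on_bilinear[OF bounded_bilinear_mult] smooth_fun_on_inverse
        smooth_fun_on_subset[OF \<phi>(1) WU(2)] smooth_fun_on_subset[OF L_smooth[OF \<epsilon>] WU(2)])
      (auto simp: W_def)
  moreover have "L s x = a x (\<psi> (s x))" if s: "s \<in> sections M G" and x: "x \<in> W" for s x
  proof -
    \<comment> \<open>The frame sections \<open>\<epsilon> b\<close> and the coefficients of
      \<open>s\<close> exist only over \<open>U\<close>, so each needs its own factor
      \<open>\<phi>\<close> to become global. This is the origin of the square in
      \<open>k\<close>.\<close>
    define h where "h b = restrict (\<lambda>x. if x \<in> U then \<phi> x *\<^sub>R c b (\<psi> (s x)) else 0) (pts M)" for b
    have "smooth_fun_on M (pts M) (\<lambda>x. if x \<in> U then \<phi> x *\<^sub>R c b (\<psi> (s x)) else 0)" for b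
      by (rule smooth_extend_by_zero[OF triv_openin[OF U] \<phi>(1,3-5) openin_pts])
        (use triv_subset[OF U] in \<open>auto simp: Int_absorb2 intro!: triv_openin[OF U]
          smooth_fun_on_compose_linear[OF blinfun.bounded_linear_right] section_smooth[OF s U]\<close>)
    then have h: "h b \<in> Cinf M" for b unfolding h_def by (rule Cinf_restrict)
    define k where "k = restrict (\<lambda>x. 1 - \<phi> x * \<phi> x) (pts M)"
    have k: "k \<in> Cinf M"
      unfolding k_def
      by (intro Cinf_restrict smooth_fun_on_diff openin_pts smooth_fun_on_const
          smooth_fun_on_bilinear[OF bounded_bilinear_mult] \<phi>(1))
    obtain S where S: "S \<in> sections M G"
      "\<And>U \<psi> x. (U, \<psi>) \<in> trivs G \<Longrightarrow> x \<in> U \<Longrightarrow> \<psi> (S x) = (\<Sum>b\<in>B. h b x *\<^sub>R \<psi> (\<epsilon> b x))"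
      "\<And>x. x \<in> pts M \<Longrightarrow> L S x = (\<Sum>b\<in>B. h b x * L (\<epsilon> b) x)"
      using finite_combination[OF B(1), of h \<epsilon> s] h \<epsilon> s by auto
    have ks: "sec_mult M G k s \<in> sections M G" by (intro sec_mult_in Cinf_smooth k s)
    have "s = sec_add M G (sec_mult M G k s) S"
    proof (rule section_eqI[OF s sec_add_in[OF ks S(1)]])
      fix x V \<theta> assume V: "(V, \<theta>) \<in> trivs G" "x \<in> V"
      then have xp: "x \<in> pts M" using triv_subset by blast
      have "\<theta> (sec_add M G (sec_mult M G k s) S x) = k x *\<^sub>R \<theta> (s x) + (\<Sum>b\<in>B. h b x *\<^sub>R \<theta> (\<epsilon> b x))"
        by (simp add: triv_sec_add[OF ks S(1) V] triv_sec_mult[OF s V] S(2)[OF V])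
      also have "\<dots> = \<theta> (s x)"
      proof (cases "x \<in> U")
        case True
        have lin: "linear (\<lambda>v. \<theta> (triv_inv G \<psi> x v))"
          by (rule triv_change_linear[OF U V(1) True V(2)])
        have "(\<Sum>b\<in>B. h b x *\<^sub>R \<theta> (\<epsilon> b x)) = (\<phi> x * \<phi> x) *\<^sub>R (\<Sum>b\<in>B. c b (\<psi> (s x)) *\<^sub>R \<theta> (triv_inv G \<psi> x b))"
          using xp True by (simp add: h_def \<epsilon>_def linear_scale[OF lin] scaleR_sum_right mult_ac)
        also have "(\<Sum>b\<in>B. c b (\<psi> (s x)) *\<^sub>R \<theta> (triv_inv G \<psi> x b)) = \<theta> (triv_inv G \<psi> x (\<Sum>b\<in>B. c b (\<psi> (s x)) *\<^sub>R b))"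
          by (simp add: linear_sum[OF lin] linear_scale[OF lin])
        also have "\<dots> = \<theta> (s x)"
          using triv_inv_triv[OF U True section_in[OF s xp]] by (simp add: B(2))
        finally show ?thesis using xp by (simp add: k_def algebra_simps)
      next
        case False
        then have "\<phi> x = 0" using \<phi>(4,5) by blast
        then show ?thesis using False xp by (simp add: k_def h_def)
      qed
      finally show "\<theta> (s x) = \<theta> (sec_add M G (sec_mult M G k s) S x)" by simp
    qed
    \<comment> \<open>After inserting the decomposition, \<open>L s x\<close> cancels on both sides
      up to the factor \<phi>^2. One factor is removed against the one in the coefficients
      \<open>h b\<close>, the other is inverted and goes into \<open>a\<close>.\<close>
    then have "L s x = L (sec_add M G (sec_mult M G k s) S) x" by simp
    also have "\<dots> = (1 - \<phi> x * \<phi> x) * L s x + (\<Sum>b\<in>B. (\<phi> x * c b (\<psi> (s x))) * L (\<epsilon> b) x)"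
      using x WU by (simp add: L_add ks S L_mult k s subset_iff) (simp add: k_def h_def subset_iff)
    finally have "\<phi> x * (\<phi> x * L s x) = \<phi> x * (\<Sum>b\<in>B. c b (\<psi> (s x)) * L (\<epsilon> b) x)"
      by (simp add: algebra_simps sum_distrib_left)
    moreover have nz: "\<phi> x \<noteq> 0" using x by (simp add: W_def)
    ultimately have "\<phi> x * L s x = (\<Sum>b\<in>B. c b (\<psi> (s x)) * L (\<epsilon> b) x)" by simp
    then have "L s x = inverse (\<phi> x) * (\<Sum>b\<in>B. c b (\<psi> (s x)) * L (\<epsilon> b) x)"
      using nz by (simp add: field_simps)
    also have "\<dots> = a x (\<psi> (s x))"
      by (simp add: a_def blinfun.sum_left blinfun.scaleR_left sum_distrib_left mult_ac)
    finally show ?thesis .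
  qed
  moreover have "x0 \<in> W" using x0 \<phi>(2) by (simp add: W_def)
  ultimately show ?thesis using that oW WU(1) by blast
qed

text \<open>Locally \<open>L s x\<close> is a smooth covector applied to s(x), so it depends on s(x)
  alone and smoothly on \<open>x\<close>. For uniqueness, every fibre vector is the value of a
  global section, so the pairings determine the dual section.\<close>

lemma dual_section_ex1:
  "\<exists>!\<delta>. \<delta> \<in> sections M (dual_bundle M G) \<and> (\<forall>s\<in>sections M G. \<forall>x\<in>pts M. pairing M \<delta> s x = L s x)"
proof (rule ex_ex1I)
  \<comment> \<open>An arbitrary global section through \<open>g\<close>; the local representation
    shows that the choice does not affect the value of \<open>L\<close> at \<open>x\<close>.\<close>
  define S where "S x g = (SOME s. s \<in> sections M G \<and> s x = g)" for x g
  have S: "S x g \<in> sections M G \<and> S x g x = g" if xg: "x \<in> pts M" "g \<in> fibre G x" for x g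
  proof -
    obtain s where "s \<in> sections M G" "s x = g" using section_through[OF xg] .
    then show ?thesis unfolding S_def using someI[of "\<lambda>s. s \<in> sections M G \<and> s x = g" s] by simp
  qed
  define \<delta> where "\<delta> = (\<lambda>x\<in>pts M. (x, \<lambda>g\<in>fibre G x. L (S x g) x))"
  have rep: "\<exists>W a. openin (mtop M) W \<and> x0 \<in> W \<and> W \<subseteq> U \<and> smooth_fun_on M W a \<and>
      (\<forall>x\<in>W. \<forall>s\<in>sections M G. L s x = blinfun_apply (a x) (\<psi> (s x))) \<and>
      (\<forall>x\<in>W. \<forall>g\<in>fibre G x. snd (\<delta> x) g = blinfun_apply (a x) (\<psi> g))"
    if U: "(U, \<psi>) \<in> trivs G" "x0 \<in> U" for U \<psi> x0
  proof -
    obtain W and a :: "'p \<Rightarrow> 'v \<Rightarrow>\<^sub>L real" where W: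
      "openin (mtop M) W" "x0 \<in> W" "W \<subseteq> U" "smooth_fun_on M W a"
      "\<And>s x. s \<in> sections M G \<Longrightarrow> x \<in> W \<Longrightarrow> L s x = a x (\<psi> (s x))"
      using local_representation[OF U] by metis
    have "snd (\<delta> x) g = a x (\<psi> g)" if "x \<in> W" "g \<in> fibre G x" for x g
    proof -
      have "x \<in> pts M" using that W(3) triv_subset[OF U(1)] by blast
      then show ?thesis using S[OF _ that(2)] W(5)[OF _ that(1)] that(2) by (auto simp: \<delta>_def)
    qed
    then show ?thesis using W by blast
  qed
  have in_dual: "snd (\<delta> x) \<in> dual_space G x" if x: "x \<in> pts M" for x
  proof -
    obtain U \<psi> where U: "(U, \<psi>) \<in> trivs G" "x \<in> U" using x by (rule triv_at_ex)
    from rep[OF U] obtain W and a :: "'p \<Rightarrow> 'v \<Rightarrow>\<^sub>L real" where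
      "x \<in> W" "\<forall>x\<in>W. \<forall>g\<in>fibre G x. snd (\<delta> x) g = a x (\<psi> g)" by auto
    then have a: "\<And>g. g \<in> fibre G x \<Longrightarrow> snd (\<delta> x) g = a x (\<psi> g)" by blast
    have "restrict (snd (\<delta> x)) (fibre G x) \<in> dual_space G x"
      by (intro dual_spaceI x)
        (simp_all add: a fadd_in fscale_in x triv_add[OF U] triv_scale[OF U] blinfun.add_right blinfun.scaleR_right)
    moreover have "restrict (snd (\<delta> x)) (fibre G x) = snd (\<delta> x)" using x by (simp add: \<delta>_def)
    ultimately show ?thesis by simp
  qed
  have "\<delta> \<in> sections M (dual_bundle M G)"
  proof (rule dual_sectionsI)
    fix U \<psi> assume U: "(U, \<psi>) \<in> trivs G"
    show "smooth_fun_on M U (\<lambda>x. covec \<psi> x (snd (\<delta> x)))"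
    proof (rule smooth_fun_on_local)
      fix x0 assume x0: "x0 \<in> U"
      from rep[OF U x0] obtain W and a :: "'p \<Rightarrow> 'v \<Rightarrow>\<^sub>L real" where
        W: "openin (mtop M) W" "x0 \<in> W" "W \<subseteq> U" "smooth_fun_on M W a"
        "\<forall>x\<in>W. \<forall>g\<in>fibre G x. snd (\<delta> x) g = a x (\<psi> g)" by auto
      have "smooth_fun_on M W (\<lambda>x. covec \<psi> x (snd (\<delta> x)))"
      proof (rule smooth_fun_on_cong[OF W(1) _ W(4)])
        fix x assume x: "x \<in> W"
        then have xU: "x \<in> U" using W(3) by auto
        show "a x = covec \<psi> x (snd (\<delta> x))"
        proof (rule blinfun_eqI)
          fix v
          have "covec \<psi> x (snd (\<delta> x)) v = snd (\<delta> x) (triv_inv G \<psi> x v)"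
            using triv_subset[OF U] xU by (intro covec_apply[OF U xU] in_dual) auto
          also have "\<dots> = a x v" using W(5) x by (simp add: triv_inv_in[OF U xU] triv_triv_inv[OF U xU])
          finally show "a x v = covec \<psi> x (snd (\<delta> x)) v" by simp
        qed
      qed
      then show "\<exists>W'. openin (mtop M) W' \<and> x0 \<in> W' \<and> smooth_fun_on M W' (\<lambda>x. covec \<psi> x (snd (\<delta> x)))"
        using W(1,2) by blast
    qed
  qed (use in_dual in \<open>auto simp: \<delta>_def\<close>)
  moreover have "pairing M \<delta> s x = L s x" if s: "s \<in> sections M G" and x: "x \<in> pts M" for s x
  proof -
    obtain U \<psi> where U: "(U, \<psi>) \<in> trivs G" "x \<in> U" using x by (rule triv_at_ex)
    from rep[OF U] s section_in[OF s x] show ?thesis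
      using x by (auto simp: pairing_def)
  qed
  ultimately show "\<exists>\<delta>. \<delta> \<in> sections M (dual_bundle M G) \<and>
      (\<forall>s\<in>sections M G. \<forall>x\<in>pts M. pairing M \<delta> s x = L s x)" by blast
next
  fix \<delta> \<delta>'
  assume \<delta>: "\<delta> \<in> sections M (dual_bundle M G) \<and> (\<forall>s\<in>sections M G. \<forall>x\<in>pts M. pairing M \<delta> s x = L s x)"
    and \<delta>': "\<delta>' \<in> sections M (dual_bundle M G) \<and> (\<forall>s\<in>sections M G. \<forall>x\<in>pts M. pairing M \<delta>' s x = L s x)"
  show "\<delta> = \<delta>'"
  proof (rule extensionalityI[of _ "pts M"])
    show "\<delta> \<in> extensional (pts M)" "\<delta>' \<in> extensional (pts M)"
      using \<delta> \<delta>' by (auto simp: sections_def PiE_def)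
    fix x assume x: "x \<in> pts M"
    have "snd (\<delta> x) = snd (\<delta>' x)"
    proof (rule extensionalityI[of _ "fibre G x"])
      show "snd (\<delta> x) \<in> extensional (fibre G x)" "snd (\<delta>' x) \<in> extensional (fibre G x)"
        using \<delta> \<delta>' x dual_section_in(2) dual_spaceD(3) by blast+
      fix g assume "g \<in> fibre G x"
      then obtain s where s: "s \<in> sections M G" "s x = g" using section_through[OF x] by metis
      have "pairing M \<delta> s x = pairing M \<delta>' s x" using \<delta> \<delta>' s(1) x by simp
      then show "snd (\<delta> x) g = snd (\<delta>' x) g" using s(2) x by (simp add: pairing_def)
    qed
    moreover have "fst (\<delta> x) = fst (\<delta>' x)" using \<delta> \<delta>' x dual_section_in(1) by metis
    ultimately show "\<delta> x = \<delta>' x" by (rule prod_eqI[rotated])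
  qed
qed

end

section \<open>The tensor product bundle\<close>

text \<open>The elementary tensor of two model vectors, in the same realization as bilinear forms on
  the duals that \<open>tensor_bundle\<close> uses for its model fibre.\<close>

definition tens :: "'v::real_normed_vector \<Rightarrow> 'w::real_normed_vector \<Rightarrow> ('v \<Rightarrow>\<^sub>L real) \<Rightarrow>\<^sub>L ('w \<Rightarrow>\<^sub>L real) \<Rightarrow>\<^sub>L real" where
  "tens v w = Blinfun (\<lambda>k. Blinfun (\<lambda>l. blinfun_apply k v * blinfun_apply l w))"

text \<open>The nested \<open>Blinfun\<close> has to be opened level by level, with boundedness
  checked each time; \<open>H\<close> is the inner functional.\<close>

lemma tens_apply:
  fixes v :: "'a::real_normed_vector" and w :: "'b::real_normed_vector"
  shows "tens v w k l = k v * l w"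
proof -
  define H where "H k = Blinfun (\<lambda>l. blinfun_apply k v * blinfun_apply l w)" for k :: "'a \<Rightarrow>\<^sub>L real"
  have H: "H k l = k v * l w" for k l
    unfolding H_def by (subst bounded_linear_Blinfun_apply) (auto intro!: bounded_linear_intros)
  have "bounded_linear H"
  proof (rule bounded_linear_intro[where K = "norm v * norm w"])
    fix k k' :: "'a \<Rightarrow>\<^sub>L real" and r :: real
    show "H (k + k') = H k + H k'" "H (r *\<^sub>R k) = r *\<^sub>R H k"
      by (rule blinfun_eqI; simp add: H blinfun.add_left blinfun.scaleR_left algebra_simps)+
    show "norm (H k) \<le> norm k * (norm v * norm w)"
    proof (rule norm_blinfun_bound)
      fix l :: "'b \<Rightarrow>\<^sub>L real"
      have "norm (k v * l w) \<le> (norm k * norm v) * (norm l * norm w)"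
        unfolding norm_mult by (intro mult_mono norm_blinfun) auto
      then show "norm (H k l) \<le> norm k * (norm v * norm w) * norm l"
        unfolding H by (simp add: mult_ac)
    qed simp
  qed
  then have "blinfun_apply (Blinfun H) = H" by (rule bounded_linear_Blinfun_apply)
  moreover have "tens v w = Blinfun H" unfolding tens_def H_def[abs_def] by simp
  ultimately show ?thesis by (simp only: H)
qed

text \<open>Source of the product rules for elementary tensors, both in charts of the base and along
  curves.\<close>

lemma bounded_bilinear_tens: "bounded_bilinear tens"
proof
  fix v v' :: 'a and w w' :: 'b and r :: real
  show "tens (v + v') w = tens v w + tens v' w" "tens v (w + w') = tens v w + tens v w'"
    by (intro blinfun_eqI; simp add: tens_apply blinfun.add_left blinfun.add_right algebra_simps)+
  show "tens (r *\<^sub>R v) w = r *\<^sub>R tens v w" "tens v (r *\<^sub>R w) = r *\<^sub>R tens v w"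
    by (intro blinfun_eqI; simp add: tens_apply blinfun.scaleR_left blinfun.scaleR_right)+
  show "\<exists>K. \<forall>v w. norm (tens (v::'a) (w::'b)) \<le> norm v * norm w * K"
  proof (intro exI[of _ 1] allI, rule norm_blinfun_bound)
    fix v :: 'a and w :: 'b and k :: "'a \<Rightarrow>\<^sub>L real"
    show "norm (tens v w k) \<le> norm v * norm w * 1 * norm k"
    proof (rule norm_blinfun_bound)
      fix l :: "'b \<Rightarrow>\<^sub>L real"
      have "norm (k v * l w) \<le> (norm k * norm v) * (norm l * norm w)"
        unfolding norm_mult by (intro mult_mono norm_blinfun) auto
      then show "norm (tens v w k l) \<le> norm v * norm w * 1 * norm k * norm l"
        by (simp add: tens_apply mult_ac)
    qed simp
  qed simp
qed

lemma tensor_spaceD: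
  assumes "b \<in> tensor_space E F x" "\<alpha> \<in> dual_space E x" "\<beta> \<in> dual_space F x"
  shows "b (\<lambda>e\<in>fibre E x. r * \<alpha> e, \<beta>) = r * b (\<alpha>, \<beta>)"
    and "b (\<alpha>, \<lambda>f\<in>fibre F x. r * \<beta> f) = r * b (\<alpha>, \<beta>)"
    and "\<alpha>' \<in> dual_space E x \<Longrightarrow> b (\<lambda>e\<in>fibre E x. \<alpha> e + \<alpha>' e, \<beta>) = b (\<alpha>, \<beta>) + b (\<alpha>', \<beta>)"
    and "\<beta>' \<in> dual_space F x \<Longrightarrow> b (\<alpha>, \<lambda>f\<in>fibre F x. \<beta> f + \<beta>' f) = b (\<alpha>, \<beta>) + b (\<alpha>, \<beta>')"
  using assms unfolding tensor_space_def by blast+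

lemma tensor_space_extensional: "b \<in> tensor_space E F x \<Longrightarrow> b \<in> extensional (dual_space E x \<times> dual_space F x)"
  unfolding tensor_space_def by blast

lemma tensor_spaceI:
  assumes "b \<in> extensional (dual_space E x \<times> dual_space F x)"
    and "\<And>\<alpha> \<beta> r. \<alpha> \<in> dual_space E x \<Longrightarrow> \<beta> \<in> dual_space F x \<Longrightarrow> b (\<lambda>e\<in>fibre E x. r * \<alpha> e, \<beta>) = r * b (\<alpha>, \<beta>)"
    and "\<And>\<alpha> \<beta> r. \<alpha> \<in> dual_space E x \<Longrightarrow> \<beta> \<in> dual_space F x \<Longrightarrow> b (\<alpha>, \<lambda>f\<in>fibre F x. r * \<beta> f) = r * b (\<alpha>, \<beta>)"
    and "\<And>\<alpha> \<alpha>' \<beta>. \<alpha> \<in> dual_space E x \<Longrightarrow> \<alpha>' \<in> dual_space E x \<Longrightarrow> \<beta> \<in> dual_space F x \<Longrightarrow>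
      b (\<lambda>e\<in>fibre E x. \<alpha> e + \<alpha>' e, \<beta>) = b (\<alpha>, \<beta>) + b (\<alpha>', \<beta>)"
    and "\<And>\<alpha> \<beta> \<beta>'. \<alpha> \<in> dual_space E x \<Longrightarrow> \<beta> \<in> dual_space F x \<Longrightarrow> \<beta>' \<in> dual_space F x \<Longrightarrow>
      b (\<alpha>, \<lambda>f\<in>fibre F x. \<beta> f + \<beta>' f) = b (\<alpha>, \<beta>) + b (\<alpha>, \<beta>')"
  shows "b \<in> tensor_space E F x"
  using assms unfolding tensor_space_def by blast

section \<open>Linear operations on covectors\<close>

context smooth_bundle
begin

lemma dual_scale_in:
  assumes "x \<in> pts M" "\<alpha> \<in> dual_space G x"
  shows "(\<lambda>e\<in>fibre G x. r * \<alpha> e) \<in> dual_space G x"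
  by (rule dual_spaceI[OF assms(1)]) (simp_all add: dual_spaceD[OF assms(2)] algebra_simps)

lemma dual_add_in:
  assumes "x \<in> pts M" "\<alpha> \<in> dual_space G x" "\<alpha>' \<in> dual_space G x"
  shows "(\<lambda>e\<in>fibre G x. \<alpha> e + \<alpha>' e) \<in> dual_space G x"
  by (rule dual_spaceI[OF assms(1)])
    (simp_all add: dual_spaceD[OF assms(2)] dual_spaceD[OF assms(3)] algebra_simps)

lemma covec_scale:
  assumes "(U, \<psi>) \<in> trivs G" "x \<in> U" "\<alpha> \<in> dual_space G x"
  shows "covec \<psi> x (\<lambda>e\<in>fibre G x. r * \<alpha> e) = r *\<^sub>R covec \<psi> x \<alpha>"
proof -
  have "x \<in> pts M" using triv_subset[OF assms(1)] assms(2) by auto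
  then show ?thesis
    by (intro blinfun_eqI)
      (simp add: covec_apply[OF assms(1,2)] assms(3) dual_scale_in triv_inv_in[OF assms(1,2)] blinfun.scaleR_left)
qed

lemma covec_add:
  assumes "(U, \<psi>) \<in> trivs G" "x \<in> U" "\<alpha> \<in> dual_space G x" "\<alpha>' \<in> dual_space G x"
  shows "covec \<psi> x (\<lambda>e\<in>fibre G x. \<alpha> e + \<alpha>' e) = covec \<psi> x \<alpha> + covec \<psi> x \<alpha>'"
proof -
  have "x \<in> pts M" using triv_subset[OF assms(1)] assms(2) by auto
  then show ?thesis
    by (intro blinfun_eqI)
      (simp add: covec_apply[OF assms(1,2)] assms(3,4) dual_add_in triv_inv_in[OF assms(1,2)] blinfun.add_left)
qed

text \<open>The inner restrictions reproduce literally the arguments in the axioms of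
  \<open>tensor_space\<close>, so that those can be used as rewrite rules.\<close>

lemma dual_of_covec_add:
  "(\<lambda>e\<in>fibre G x. blinfun_apply (k + k') (\<psi> e))
    = (\<lambda>e\<in>fibre G x. (\<lambda>e\<in>fibre G x. blinfun_apply k (\<psi> e)) e + (\<lambda>e\<in>fibre G x. blinfun_apply k' (\<psi> e)) e)"
  by (auto simp: blinfun.add_left)

lemma dual_of_covec_scale:
  "(\<lambda>e\<in>fibre G x. blinfun_apply (r *\<^sub>R k) (\<psi> e))
    = (\<lambda>e\<in>fibre G x. r * (\<lambda>e\<in>fibre G x. blinfun_apply k (\<psi> e)) e)"
  by (auto simp: blinfun.scaleR_left)

end

section \<open>Trivializations of the tensor product bundle\<close>

locale bundle_pair = E: smooth_bundle M E + F: smooth_bundle M F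
  for M :: "('p, 'a::real_normed_vector) manifold"
    and E :: "('p, 'e, 'v::real_normed_vector) vbundle"
    and F :: "('p, 'f, 'w::real_normed_vector) vbundle"
begin

abbreviation T where "T \<equiv> tensor_bundle M E F"

definition tens_triv where
  "tens_triv \<psi> \<theta> = (\<lambda>(x, b). Blinfun (\<lambda>k::'v \<Rightarrow>\<^sub>L real. Blinfun (\<lambda>l::'w \<Rightarrow>\<^sub>L real.
      b (\<lambda>e\<in>fibre E x. blinfun_apply k (\<psi> e), \<lambda>f\<in>fibre F x. blinfun_apply l (\<theta> f)) :: real)))"

text \<open>The form \<open>B\<close> on the duals of the model fibres is pulled back to the dual
  fibres by taking coordinates of covectors. Giving the inverse explicitly makes bijectivity a
  computation.\<close>

definition tens_triv_inv where
  "tens_triv_inv \<psi> \<theta> x B = (x, \<lambda>(\<alpha>, \<beta>)\<in>dual_space E x \<times> dual_space F x.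
     blinfun_apply (blinfun_apply B (E.covec \<psi> x \<alpha>)) (F.covec \<theta> x \<beta>))"

lemma trivs_tensor: "trivs T = {(U \<inter> V, tens_triv \<psi> \<theta>) | U \<psi> V \<theta>. (U, \<psi>) \<in> trivs E \<and> (V, \<theta>) \<in> trivs F}"
  unfolding tensor_bundle_def tens_triv_def by simp

lemma fibre_tensor: "x \<in> pts M \<Longrightarrow> fibre T x = {x} \<times> tensor_space E F x"
  unfolding fibre_def tensor_bundle_def by auto

context
  fixes U \<psi> V \<theta> x
  assumes U: "(U, \<psi>) \<in> trivs E" "x \<in> U" and V: "(V, \<theta>) \<in> trivs F" "x \<in> V"
begin

text \<open>Bilinearity of \<open>b\<close> makes both levels of the nested \<open>Blinfun\<close>
  linear in turn, and finite dimension makes them bounded.\<close>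

lemma tens_triv_apply:
  assumes b: "b \<in> tensor_space E F x"
  shows "tens_triv \<psi> \<theta> (x, b) k l
    = b (\<lambda>e\<in>fibre E x. blinfun_apply k (\<psi> e), \<lambda>f\<in>fibre F x. blinfun_apply l (\<theta> f))"
proof -
  let ?a = "\<lambda>k. \<lambda>e\<in>fibre E x. blinfun_apply k (\<psi> e)" and ?b = "\<lambda>l. \<lambda>f\<in>fibre F x. blinfun_apply l (\<theta> f)"
  note E = E.dual_of_covec[OF U] and F = F.dual_of_covec[OF V]
  have "linear (\<lambda>l. b (?a k, ?b l))" for k
    by (rule linearI)
      (simp_all only: F.dual_of_covec_add F.dual_of_covec_scale tensor_spaceD[OF b E F] F real_scaleR_def)
  then have 1: "blinfun_apply (Blinfun (\<lambda>l. b (?a k, ?b l))) = (\<lambda>l. b (?a k, ?b l))" for k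
    by (intro bounded_linear_Blinfun_apply finite_dim_linear_bounded finite_dim_blinfun
        F.fibre_model_finite_dim finite_dim_real)
  define H where "H k = Blinfun (\<lambda>l. b (?a k, ?b l))" for k
  have H: "H k l = b (?a k, ?b l)" for k l unfolding H_def by (simp add: 1)
  have key: "b (?a (k + k'), ?b l) = b (?a k, ?b l) + b (?a k', ?b l)"
    "b (?a (r *\<^sub>R k), ?b l) = r * b (?a k, ?b l)" for k k' l r
    by (simp_all only: E.dual_of_covec_add E.dual_of_covec_scale tensor_spaceD[OF b E F] E)
  have "linear H"
    by (rule linearI; rule blinfun_eqI)
      (unfold blinfun.add_left blinfun.scaleR_left, simp_all only: H key real_scaleR_def)
  then have "blinfun_apply (Blinfun H) = H"
    by (intro bounded_linear_Blinfun_apply finite_dim_linear_bounded finite_dim_blinfun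
        E.fibre_model_finite_dim finite_dim_real)
  moreover have "tens_triv \<psi> \<theta> (x, b) = Blinfun H" unfolding tens_triv_def H_def[abs_def] by simp
  ultimately show ?thesis by (simp only: H)
qed

lemma tens_triv_inv_in: "tens_triv_inv \<psi> \<theta> x B \<in> fibre T x"
proof -
  have x: "x \<in> pts M" using E.triv_subset U by auto
  have "(\<lambda>(\<alpha>, \<beta>)\<in>dual_space E x \<times> dual_space F x.
      blinfun_apply (blinfun_apply B (E.covec \<psi> x \<alpha>)) (F.covec \<theta> x \<beta>)) \<in> tensor_space E F x"
    by (rule tensor_spaceI)
      (simp_all add: E.dual_scale_in F.dual_scale_in E.dual_add_in F.dual_add_in x E.covec_scale[OF U]
        E.covec_add[OF U] F.covec_scale[OF V] F.covec_add[OF V] blinfun.scaleR_right blinfun.scaleR_left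
        blinfun.add_right blinfun.add_left)
  then show ?thesis unfolding tens_triv_inv_def using x by (simp add: fibre_tensor)
qed

lemma tens_triv_tens_triv_inv: "tens_triv \<psi> \<theta> (tens_triv_inv \<psi> \<theta> x B) = B"
proof -
  have x: "x \<in> pts M" using E.triv_subset U by auto
  have b: "snd (tens_triv_inv \<psi> \<theta> x B) \<in> tensor_space E F x" "fst (tens_triv_inv \<psi> \<theta> x B) = x"
    using tens_triv_inv_in[of B] by (auto simp: fibre_tensor[OF x])
  have "tens_triv \<psi> \<theta> (tens_triv_inv \<psi> \<theta> x B) = tens_triv \<psi> \<theta> (x, snd (tens_triv_inv \<psi> \<theta> x B))"
    using b(2) by (metis prod.collapse)
  also have "\<dots> = B"
  proof (intro blinfun_eqI)
    fix k l
    show "tens_triv \<psi> \<theta> (x, snd (tens_triv_inv \<psi> \<theta> x B)) k l = B k l"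
      unfolding tens_triv_apply[OF b(1)]
      by (simp add: tens_triv_inv_def E.dual_of_covec[OF U] F.dual_of_covec[OF V]
          E.covec_dual[OF U] F.covec_dual[OF V])
  qed
  finally show ?thesis .
qed

lemma tens_triv_inv_tens_triv:
  assumes "\<tau> \<in> fibre T x"
  shows "tens_triv_inv \<psi> \<theta> x (tens_triv \<psi> \<theta> \<tau>) = \<tau>"
proof -
  have x: "x \<in> pts M" using E.triv_subset U by auto
  obtain b where b: "\<tau> = (x, b)" "b \<in> tensor_space E F x" using assms by (auto simp: fibre_tensor[OF x])
  have "(\<lambda>(\<alpha>, \<beta>)\<in>dual_space E x \<times> dual_space F x.
      blinfun_apply (blinfun_apply (tens_triv \<psi> \<theta> \<tau>) (E.covec \<psi> x \<alpha>)) (F.covec \<theta> x \<beta>)) = b"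
    by (rule extensionalityI[OF _ tensor_space_extensional[OF b(2)]])
      (auto simp: b(1) tens_triv_apply[OF b(2)] E.dual_of_covec_covec[OF U] F.dual_of_covec_covec[OF V])
  then show ?thesis unfolding tens_triv_inv_def using b(1) by simp
qed

lemma tens_triv_bij: "bij_betw (tens_triv \<psi> \<theta>) (fibre T x) UNIV"
  by (rule bij_betwI[where g = "tens_triv_inv \<psi> \<theta> x"])
    (auto simp: tens_triv_inv_in tens_triv_tens_triv_inv tens_triv_inv_tens_triv)

lemma triv_inv_tensor: "triv_inv T (tens_triv \<psi> \<theta>) x B = tens_triv_inv \<psi> \<theta> x B"
  unfolding triv_inv_def using tens_triv_bij
  by (metis bij_betw_def inv_into_f_f tens_triv_inv_in tens_triv_tens_triv_inv)

lemma tensor_in: "e \<in> fibre E x \<Longrightarrow> f \<in> fibre F x \<Longrightarrow> tensor E F e f \<in> fibre T x"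
proof -
  assume ef: "e \<in> fibre E x" "f \<in> fibre F x"
  have x: "x \<in> pts M" using E.triv_subset U by auto
  have "(\<lambda>(\<alpha>, \<beta>)\<in>dual_space E x \<times> dual_space F x. \<alpha> e * \<beta> f) \<in> tensor_space E F x"
    by (rule tensor_spaceI)
      (use ef in \<open>simp_all add: E.dual_scale_in F.dual_scale_in E.dual_add_in F.dual_add_in x algebra_simps\<close>)
  moreover have "bproj E e = x" using ef by (simp add: fibre_def)
  ultimately show ?thesis unfolding tensor_def using x by (simp add: fibre_tensor)
qed

lemma tens_triv_tensor:
  assumes "e \<in> fibre E x" "f \<in> fibre F x"
  shows "tens_triv \<psi> \<theta> (tensor E F e f) = tens (\<psi> e) (\<theta> f)"
proof -
  have x: "x \<in> pts M" using E.triv_subset U by auto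
  have p: "bproj E e = x" using assms by (simp add: fibre_def)
  have b: "(\<lambda>(\<alpha>, \<beta>)\<in>dual_space E x \<times> dual_space F x. \<alpha> e * \<beta> f) \<in> tensor_space E F x"
    using tensor_in[OF assms] p by (simp add: tensor_def fibre_tensor[OF x])
  show ?thesis
    unfolding tensor_def p
    by (intro blinfun_eqI)
      (simp add: tens_triv_apply[OF b] E.dual_of_covec[OF U] F.dual_of_covec[OF V] assms tens_apply)
qed

end

text \<open>The transition function evaluates \<open>B\<close> on the covectors \<open>k\<close> and
  \<open>l\<close> pulled back along the transition functions of \<open>E\<close> and
  \<open>F\<close>. Smoothness of operator-valued maps is tested on fixed arguments, once for each
  of the two nested operator spaces.\<close>

lemma tens_triv_change:
  assumes "(U, \<psi>) \<in> trivs E" "(V, \<theta>) \<in> trivs F" "(U', \<psi>') \<in> trivs E" "(V', \<theta>') \<in> trivs F"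
  shows "smooth_fun_on M ((U \<inter> V) \<inter> (U' \<inter> V')) (\<lambda>x. tens_triv \<psi>' \<theta>' (triv_inv T (tens_triv \<psi> \<theta>) x B))"
proof (intro E.smooth_fun_on_blinfun finite_dim_blinfun finite_dim_real E.fibre_model_finite_dim F.fibre_model_finite_dim)
  let ?W = "(U \<inter> V) \<inter> (U' \<inter> V')"
  show oW: "openin (mtop M) ?W"
    using assms by (intro openin_Int[OF openin_Int[OF E.triv_openin F.triv_openin]
        openin_Int[OF E.triv_openin F.triv_openin]])
  then show "openin (mtop M) ?W" .
  fix k l
  \<comment> \<open>\<open>?p\<close> and \<open>?q\<close> are the transposed transition functions
    of \<open>E\<close> and \<open>F\<close> applied to \<open>k\<close> and
    \<open>l\<close>.\<close>
  let ?p = "\<lambda>x. E.covec \<psi> x (\<lambda>e\<in>fibre E x. blinfun_apply k (\<psi>' e))"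
  let ?q = "\<lambda>x. F.covec \<theta> x (\<lambda>f\<in>fibre F x. blinfun_apply l (\<theta>' f))"
  have p: "smooth_fun_on M ?W ?p"
  proof (rule E.smooth_fun_on_blinfun[OF E.fibre_model_finite_dim oW])
    fix v
    have "smooth_fun_on M ?W (\<lambda>x. k (\<psi>' (triv_inv E \<psi> x v)))"
      by (intro E.smooth_fun_on_compose_linear[OF blinfun.bounded_linear_right] oW
          E.smooth_fun_on_subset[OF E.triv_transition[OF assms(1,3)]]) auto
    then show "smooth_fun_on M ?W (\<lambda>x. ?p x v)"
      by (rule E.smooth_fun_on_cong[OF oW, rotated])
        (simp add: E.covec_apply[OF assms(1) _ E.dual_of_covec[OF assms(3)]] E.triv_inv_in[OF assms(1)])
  qed
  have q: "smooth_fun_on M ?W ?q"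
  proof (rule E.smooth_fun_on_blinfun[OF F.fibre_model_finite_dim oW])
    fix v
    have "smooth_fun_on M ?W (\<lambda>x. l (\<theta>' (triv_inv F \<theta> x v)))"
      by (intro E.smooth_fun_on_compose_linear[OF blinfun.bounded_linear_right] oW
          E.smooth_fun_on_subset[OF F.triv_transition[OF assms(2,4)]]) auto
    then show "smooth_fun_on M ?W (\<lambda>x. ?q x v)"
      by (rule E.smooth_fun_on_cong[OF oW, rotated])
        (simp add: F.covec_apply[OF assms(2) _ F.dual_of_covec[OF assms(4)]] F.triv_inv_in[OF assms(2)])
  qed
  have "smooth_fun_on M ?W (\<lambda>x. blinfun_apply (blinfun_apply B (?p x)) (?q x))"
    by (intro E.smooth_fun_on_bilinear[OF bounded_bilinear_blinfun_apply] oW q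
        E.smooth_fun_on_compose_linear[OF blinfun.bounded_linear_right] p)
  then show "smooth_fun_on M ?W
      (\<lambda>x. blinfun_apply (blinfun_apply (tens_triv \<psi>' \<theta>' (triv_inv T (tens_triv \<psi> \<theta>) x B)) k) l)"
  proof (rule E.smooth_fun_on_cong[OF oW, rotated])
    fix x assume x: "x \<in> ?W"
    then have xs: "x \<in> U" "x \<in> V" "x \<in> U'" "x \<in> V'" "x \<in> pts M" using E.triv_subset[OF assms(1)] by auto
    have b: "snd (tens_triv_inv \<psi> \<theta> x B) \<in> tensor_space E F x"
      using tens_triv_inv_in[OF assms(1) xs(1) assms(2) xs(2)] fibre_tensor[OF xs(5)] by (auto simp: mem_Times_iff)
    show "blinfun_apply (blinfun_apply B (?p x)) (?q x)
        = blinfun_apply (blinfun_apply (tens_triv \<psi>' \<theta>' (triv_inv T (tens_triv \<psi> \<theta>) x B)) k) l"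
      using tens_triv_apply[OF assms(3) xs(3) assms(4) xs(4) b, of k l]
      by (simp add: triv_inv_tensor[OF assms(1) xs(1) assms(2) xs(2)] tens_triv_inv_def
          E.dual_of_covec[OF assms(3) xs(3)] F.dual_of_covec[OF assms(4) xs(4)])
  qed
qed

lemma tensor_fscale_fadd:
  assumes x: "x \<in> pts M" and b: "(x, b) \<in> fibre T x" and b': "(x, b') \<in> fibre T x"
  shows "fscale T r (x, b) \<in> fibre T x" "fadd T (x, b) (x, b') \<in> fibre T x"
proof -
  have b: "b \<in> tensor_space E F x" "b' \<in> tensor_space E F x"
    using assms by (auto simp: fibre_tensor[OF x])
  have "(\<lambda>z\<in>dual_space E x \<times> dual_space F x. r * b z) \<in> tensor_space E F x"
    by (rule tensor_spaceI)
      (simp_all add: E.dual_scale_in F.dual_scale_in E.dual_add_in F.dual_add_in x tensor_spaceD[OF b(1)] algebra_simps)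
  moreover have "(\<lambda>z\<in>dual_space E x \<times> dual_space F x. b z + b' z) \<in> tensor_space E F x"
    by (rule tensor_spaceI)
      (simp_all add: E.dual_scale_in F.dual_scale_in E.dual_add_in F.dual_add_in x
        tensor_spaceD[OF b(1)] tensor_spaceD[OF b(2)] algebra_simps)
  ultimately show "fscale T r (x, b) \<in> fibre T x" "fadd T (x, b) (x, b') \<in> fibre T x"
    unfolding fibre_tensor[OF x] by (auto simp: tensor_bundle_def)
qed

lemma tens_triv_fscale_fadd:
  assumes U: "(U, \<psi>) \<in> trivs E" "x \<in> U" and V: "(V, \<theta>) \<in> trivs F" "x \<in> V"
    and t: "\<tau> \<in> fibre T x" "\<tau>' \<in> fibre T x"
  shows "tens_triv \<psi> \<theta> (fscale T r \<tau>) = r *\<^sub>R tens_triv \<psi> \<theta> \<tau>"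
    and "tens_triv \<psi> \<theta> (fadd T \<tau> \<tau>') = tens_triv \<psi> \<theta> \<tau> + tens_triv \<psi> \<theta> \<tau>'"
proof -
  have x: "x \<in> pts M" using E.triv_subset U by auto
  obtain b b' where b: "\<tau> = (x, b)" "\<tau>' = (x, b')" "b \<in> tensor_space E F x" "b' \<in> tensor_space E F x"
    using t by (auto simp: fibre_tensor[OF x])
  note in_T = tensor_fscale_fadd[OF x t[unfolded b(1,2)], unfolded fibre_tensor[OF x]]
  have 1: "(\<lambda>z\<in>dual_space E x \<times> dual_space F x. r * b z) \<in> tensor_space E F x"
    using in_T(1)[of r] by (simp add: tensor_bundle_def)
  have 2: "(\<lambda>z\<in>dual_space E x \<times> dual_space F x. b z + b' z) \<in> tensor_space E F x"
    using in_T(2) by (simp add: tensor_bundle_def)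
  note app = tens_triv_apply[OF U V]
  show "tens_triv \<psi> \<theta> (fscale T r \<tau>) = r *\<^sub>R tens_triv \<psi> \<theta> \<tau>"
    by (intro blinfun_eqI)
      (simp add: b(1) tensor_bundle_def app[OF 1] app[OF b(3)] blinfun.scaleR_left
        E.dual_of_covec[OF U] F.dual_of_covec[OF V])
  show "tens_triv \<psi> \<theta> (fadd T \<tau> \<tau>') = tens_triv \<psi> \<theta> \<tau> + tens_triv \<psi> \<theta> \<tau>'"
    by (intro blinfun_eqI)
      (simp add: b(1,2) tensor_bundle_def app[OF 2] app[OF b(3)] app[OF b(4)] blinfun.add_left
        E.dual_of_covec[OF U] F.dual_of_covec[OF V])
qed

text \<open>With this the whole theory of sections, derivations and lifts applies to
  \<open>T\<close> as to any other bundle.\<close>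

lemma smooth_vector_bundle_tensor: "smooth_vector_bundle M T"
  unfolding smooth_vector_bundle_def
proof (intro conjI)
  show "smooth_manifold M" using E.is_bundle by (simp add: smooth_vector_bundle_def)
  show "finite_dim TYPE(('v \<Rightarrow>\<^sub>L real) \<Rightarrow>\<^sub>L ('w \<Rightarrow>\<^sub>L real) \<Rightarrow>\<^sub>L real)"
    by (intro finite_dim_blinfun finite_dim_real E.fibre_model_finite_dim F.fibre_model_finite_dim)
  show "bproj T ` tspace T \<subseteq> pts M" by (auto simp: tensor_bundle_def)
  show "\<forall>x\<in>pts M. \<forall>e\<in>fibre T x. \<forall>r. fscale T r e \<in> fibre T x \<and> (\<forall>e'\<in>fibre T x. fadd T e e' \<in> fibre T x)"
    using tensor_fscale_fadd fibre_tensor by fastforce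
  show "\<Union>(fst ` trivs T) = pts M"
  proof
    show "\<Union>(fst ` trivs T) \<subseteq> pts M" using E.triv_subset by (fastforce simp: trivs_tensor)
    show "pts M \<subseteq> \<Union>(fst ` trivs T)"
    proof
      fix x assume x: "x \<in> pts M"
      obtain U \<psi> where "(U, \<psi>) \<in> trivs E" "x \<in> U" using x by (rule E.triv_at_ex)
      moreover obtain V \<theta> where "(V, \<theta>) \<in> trivs F" "x \<in> V" using x by (rule F.triv_at_ex)
      ultimately have "(U \<inter> V, tens_triv \<psi> \<theta>) \<in> trivs T" "x \<in> U \<inter> V" by (auto simp: trivs_tensor)
      then show "x \<in> \<Union>(fst ` trivs T)" by (metis UnionI fst_conv imageI)
    qed
  qed
  show "\<forall>(U, \<psi>)\<in>trivs T. openin (mtop M) U \<and> (\<forall>x\<in>U. bij_betw \<psi> (fibre T x) UNIV \<and>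
      (\<forall>e\<in>fibre T x. \<forall>r. \<psi> (fscale T r e) = r *\<^sub>R \<psi> e) \<and>
      (\<forall>e\<in>fibre T x. \<forall>e'\<in>fibre T x. \<psi> (fadd T e e') = \<psi> e + \<psi> e'))"
    unfolding trivs_tensor
    by (auto intro!: openin_Int[OF E.triv_openin F.triv_openin] tens_triv_bij tens_triv_fscale_fadd)
  show "\<forall>(U, \<psi>)\<in>trivs T. \<forall>(V, \<theta>)\<in>trivs T. \<forall>v. smooth_fun_on M (U \<inter> V) (\<lambda>x. \<theta> (triv_inv T \<psi> x v))"
    unfolding trivs_tensor using tens_triv_change by auto
qed

end

section \<open>The total space\<close>

context smooth_bundle
begin

definition tot_chart where
  "tot_chart U \<kappa> V \<psi> = ({e \<in> tspace G. bproj G e \<in> U \<inter> V}, \<lambda>e. (\<kappa> (bproj G e) :: 'a, \<psi> e :: 'v))"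

lemma tot_chart_apply: "snd (tot_chart U \<kappa> V \<psi>) e = (\<kappa> (bproj G e), \<psi> e)"
  by (simp add: tot_chart_def)

lemma atlas_tot: "atlas (tot M G) = {tot_chart U \<kappa> V \<psi> | U \<kappa> V \<psi>. (U, \<kappa>) \<in> atlas M \<and> (V, \<psi>) \<in> trivs G}"
  unfolding tot_def tot_chart_def by simp

lemma pts_tot: "pts (tot M G) = tspace G"
  unfolding tot_def by simp

context
  fixes U \<kappa> V \<psi>
  assumes U: "(U, \<kappa>) \<in> atlas M" and V: "(V, \<psi>) \<in> trivs G"
begin

lemma tot_chart_inj: "inj_on (snd (tot_chart U \<kappa> V \<psi>)) (fst (tot_chart U \<kappa> V \<psi>))"
proof (rule inj_onI)
  fix e e' assume e: "e \<in> fst (tot_chart U \<kappa> V \<psi>)" "e' \<in> fst (tot_chart U \<kappa> V \<psi>)"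
    "snd (tot_chart U \<kappa> V \<psi>) e = snd (tot_chart U \<kappa> V \<psi>) e'"
  then have p: "bproj G e = bproj G e'"
    using chart_inv[OF U] by (metis (mono_tags, lifting) IntE Pair_inject fst_conv mem_Collect_eq snd_conv tot_chart_def)
  show "e = e'"
    by (rule triv_eqD[OF V, of "bproj G e"]) (use e p in \<open>auto simp: tot_chart_def fibre_def\<close>)
qed

lemma tot_chart_image:
  assumes "W \<subseteq> U \<inter> V"
  shows "snd (tot_chart U \<kappa> V \<psi>) ` {e \<in> tspace G. bproj G e \<in> W} = \<kappa> ` W \<times> UNIV"
proof
  show "snd (tot_chart U \<kappa> V \<psi>) ` {e \<in> tspace G. bproj G e \<in> W} \<subseteq> \<kappa> ` W \<times> UNIV"
    by (auto simp: tot_chart_def)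
  show "\<kappa> ` W \<times> UNIV \<subseteq> snd (tot_chart U \<kappa> V \<psi>) ` {e \<in> tspace G. bproj G e \<in> W}"
  proof
    fix p assume "p \<in> \<kappa> ` W \<times> (UNIV :: 'v set)"
    then obtain x v where p: "p = (\<kappa> x, v)" "x \<in> W" by auto
    then have xV: "x \<in> V" using assms by auto
    have "triv_inv G \<psi> x v \<in> fibre G x" by (rule triv_inv_in[OF V xV])
    then show "p \<in> snd (tot_chart U \<kappa> V \<psi>) ` {e \<in> tspace G. bproj G e \<in> W}"
      using p by (intro image_eqI[of _ _ "triv_inv G \<psi> x v"])
        (auto simp: tot_chart_def fibre_def triv_triv_inv[OF V xV])
  qed
qed

lemma tot_chart_inv:
  assumes "x \<in> U" "x \<in> V"
  shows "inv_into (fst (tot_chart U \<kappa> V \<psi>)) (snd (tot_chart U \<kappa> V \<psi>)) (\<kappa> x, v) = triv_inv G \<psi> x v"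
proof (rule inv_into_f_eq[OF tot_chart_inj])
  have "triv_inv G \<psi> x v \<in> fibre G x" by (rule triv_inv_in[OF V assms(2)])
  then show "triv_inv G \<psi> x v \<in> fst (tot_chart U \<kappa> V \<psi>)"
    "snd (tot_chart U \<kappa> V \<psi>) (triv_inv G \<psi> x v) = (\<kappa> x, v)"
    using assms by (auto simp: tot_chart_def fibre_def triv_triv_inv[OF V])
qed

end

text \<open>A change of charts is a base transition together with a fibre map linear in the vector.
  Expanding the vector in a basis separates the variables into linear coordinates and smooth
  functions of the base point.\<close>

lemma tot_transition:
  assumes U: "(U, \<kappa>) \<in> atlas M" and V: "(V, \<psi>) \<in> trivs G"
    and U': "(U', \<kappa>') \<in> atlas M" and V': "(V', \<psi>') \<in> trivs G"
  shows "smooth_on (\<kappa> ` (U \<inter> V \<inter> (U' \<inter> V')) \<times> UNIV)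
    (snd (tot_chart U' \<kappa>' V' \<psi>') \<circ> inv_into (fst (tot_chart U \<kappa> V \<psi>)) (snd (tot_chart U \<kappa> V \<psi>)))"
proof -
  let ?W = "U \<inter> V \<inter> (U' \<inter> V')"
  let ?A = "\<kappa> ` ?W"
  obtain B and c :: "'v \<Rightarrow> 'v \<Rightarrow>\<^sub>L real" where B: "\<And>x. (\<Sum>b\<in>B. c b x *\<^sub>R b) = x"
    using finite_dim_coordinates[OF fibre_model_finite_dim] by metis
  have oW: "openin (mtop M) ?W"
    by (intro openin_Int chart_openin[OF U] chart_openin[OF U'] triv_openin[OF V] triv_openin[OF V'])
  have "U \<inter> ?W = ?W" by auto
  then have A: "open ?A" using open_chart_image[OF oW U] by simp
  then have A': "open (?A \<times> (UNIV :: 'v set))" by (intro open_Times) auto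
  have 1: "smooth_on ?A (\<kappa>' \<circ> inv_into U \<kappa>)"
    by (rule smooth_on_subset[OF transition_smooth[OF U U']]) auto
  have 2: "smooth_on ?A ((\<lambda>x. \<psi>' (triv_inv G \<psi> x b)) \<circ> inv_into U \<kappa>)" for b
    by (rule smooth_on_subset[OF smooth_fun_onD[OF triv_transition[OF V V'] U]]) auto
  have "smooth_on (?A \<times> UNIV) (\<lambda>p. ((\<kappa>' \<circ> inv_into U \<kappa>) (fst p),
      \<Sum>b\<in>B. c b (snd p) *\<^sub>R ((\<lambda>x. \<psi>' (triv_inv G \<psi> x b)) \<circ> inv_into U \<kappa>) (fst p)))"
    by (intro smooth_on_Pair A' smooth_on_sum smooth_on_bilinear[OF bounded_bilinear_scaleR]
        smooth_on_compose_fst[OF model_finite_dim A 1] smooth_on_compose_fst[OF model_finite_dim A 2]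
        smooth_on_linear bounded_linear_compose[OF blinfun.bounded_linear_right bounded_linear_snd])
  then show ?thesis
  proof (rule smooth_on_cong[OF A', rotated])
    fix p assume "p \<in> ?A \<times> (UNIV :: 'v set)"
    then obtain x v where p: "p = (\<kappa> x, v)" "x \<in> ?W" by auto
    then have x: "x \<in> U" "x \<in> V" "x \<in> U'" "x \<in> V'" by auto
    have lin: "linear (\<lambda>v. \<psi>' (triv_inv G \<psi> x v))" by (rule triv_change_linear[OF V V' x(2,4)])
    have "\<psi>' (triv_inv G \<psi> x v) = \<psi>' (triv_inv G \<psi> x (\<Sum>b\<in>B. c b v *\<^sub>R b))" by (simp add: B)
    also have "\<dots> = (\<Sum>b\<in>B. c b v *\<^sub>R \<psi>' (triv_inv G \<psi> x b))"
      by (simp add: linear_sum[OF lin] linear_scale[OF lin])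
    finally have "\<psi>' (triv_inv G \<psi> x v) = (\<Sum>b\<in>B. c b v *\<^sub>R \<psi>' (triv_inv G \<psi> x b))" .
    moreover have "bproj G (triv_inv G \<psi> x v) = x"
      using triv_inv_in[OF V x(2)] by (simp add: fibre_def)
    ultimately show "((\<kappa>' \<circ> inv_into U \<kappa>) (fst p),
        \<Sum>b\<in>B. c b (snd p) *\<^sub>R ((\<lambda>x. \<psi>' (triv_inv G \<psi> x b)) \<circ> inv_into U \<kappa>) (fst p)) =
      (snd (tot_chart U' \<kappa>' V' \<psi>') \<circ> inv_into (fst (tot_chart U \<kappa> V \<psi>)) (snd (tot_chart U \<kappa> V \<psi>))) p"
      using p(1) x by (simp add: tot_chart_inv[OF U V] chart_inv[OF U] tot_chart_apply)
  qed
qed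

lemma smooth_atlas_tot: "smooth_atlas (tot M G)"
proof
  show "finite_dim TYPE('a \<times> 'v)" by (intro finite_dim_prod model_finite_dim fibre_model_finite_dim)
  show "\<Union>(fst ` atlas (tot M G)) = pts (tot M G)"
  proof
    show "\<Union>(fst ` atlas (tot M G)) \<subseteq> pts (tot M G)" by (auto simp: atlas_tot pts_tot tot_chart_def)
    show "pts (tot M G) \<subseteq> \<Union>(fst ` atlas (tot M G))"
    proof
      fix e assume e: "e \<in> pts (tot M G)"
      then have x: "bproj G e \<in> pts M" by (simp add: pts_tot bproj_in)
      obtain U \<kappa> where "(U, \<kappa>) \<in> atlas M" "bproj G e \<in> U" using x by (rule chart_at_ex)
      moreover obtain V \<psi> where "(V, \<psi>) \<in> trivs G" "bproj G e \<in> V" using x by (rule triv_at_ex)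
      ultimately have "tot_chart U \<kappa> V \<psi> \<in> atlas (tot M G)" "e \<in> fst (tot_chart U \<kappa> V \<psi>)"
        using e by (auto simp: atlas_tot pts_tot tot_chart_def)
      then show "e \<in> \<Union>(fst ` atlas (tot M G))" by blast
    qed
  qed
next
  fix C \<omega> assume C: "(C, \<omega>) \<in> atlas (tot M G)"
  then obtain U \<kappa> V \<psi> where U: "(U, \<kappa>) \<in> atlas M" and V: "(V, \<psi>) \<in> trivs G" and c: "(C, \<omega>) = tot_chart U \<kappa> V \<psi>"
    by (auto simp: atlas_tot)
  have C_eq: "C = fst (tot_chart U \<kappa> V \<psi>)" "\<omega> = snd (tot_chart U \<kappa> V \<psi>)" "C = {e \<in> tspace G. bproj G e \<in> U \<inter> V}"
    using c by (metis fst_conv, metis snd_conv, simp add: tot_chart_def)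
  show "C \<subseteq> pts (tot M G)" using C_eq(3) by (auto simp: pts_tot)
  show "inj_on \<omega> C" unfolding C_eq(1,2) by (rule tot_chart_inj[OF U V])
  have oUV: "openin (mtop M) (U \<inter> V)" by (intro openin_Int chart_openin[OF U] triv_openin[OF V])
  have "open (\<kappa> ` (U \<inter> V))" using open_chart_image[OF oUV U] by (simp add: Int_absorb1)
  then show "open (\<omega> ` C)"
    unfolding C_eq(2,3) tot_chart_image[OF U V subset_refl] by (intro open_Times) auto
  fix C' \<omega>' assume "(C', \<omega>') \<in> atlas (tot M G)"
  then obtain U' \<kappa>' V' \<psi>' where U': "(U', \<kappa>') \<in> atlas M" and V': "(V', \<psi>') \<in> trivs G"
    and c': "(C', \<omega>') = tot_chart U' \<kappa>' V' \<psi>'"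
    by (auto simp: atlas_tot)
  let ?W = "U \<inter> V \<inter> (U' \<inter> V')"
  have oW: "openin (mtop M) ?W"
    by (intro openin_Int chart_openin[OF U] chart_openin[OF U'] triv_openin[OF V] triv_openin[OF V'])
  have "C' = {e \<in> tspace G. bproj G e \<in> U' \<inter> V'}" using c' by (simp add: tot_chart_def)
  then have CC: "C \<inter> C' = {e \<in> tspace G. bproj G e \<in> ?W}" using C_eq(3) by auto
  have im: "\<omega> ` (C \<inter> C') = \<kappa> ` ?W \<times> UNIV"
    unfolding CC C_eq(2) by (rule tot_chart_image[OF U V]) auto
  have "U \<inter> ?W = ?W" by auto
  then have "open (\<kappa> ` ?W)" using open_chart_image[OF oW U] by simp
  then show "open (\<omega> ` (C \<inter> C'))" unfolding im by (intro open_Times) auto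
  have "\<omega>' = snd (tot_chart U' \<kappa>' V' \<psi>')" using c' by (metis snd_conv)
  then show "smooth_on (\<omega> ` (C \<inter> C')) (\<omega>' \<circ> inv_into C \<omega>)"
    unfolding im unfolding C_eq(1,2) using tot_transition[OF U V U' V'] by simp
qed

end

sublocale smooth_bundle \<subseteq> tot: smooth_atlas "tot M G"
  by (rule smooth_atlas_tot)

section \<open>Derivations and their linear vector fields\<close>

context smooth_bundle
begin

lemma pairing_smooth:
  assumes "\<gamma> \<in> sections M (dual_bundle M G)" "s \<in> sections M G"
  shows "smooth_fun_on M (pts M) (pairing M \<gamma> s)"
proof (rule smooth_fun_on_local)
  fix x assume "x \<in> pts M"
  then obtain V \<psi> where V: "(V, \<psi>) \<in> trivs G" "x \<in> V" by (rule triv_at_ex)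
  have "smooth_fun_on M V (\<lambda>x. blinfun_apply (covec \<psi> x (snd (\<gamma> x))) (\<psi> (s x)))"
    by (intro smooth_fun_on_bilinear[OF bounded_bilinear_blinfun_apply] triv_openin[OF V(1)]
        dual_section_smooth[OF assms(1) V(1)] section_smooth[OF assms(2) V(1)])
  then have "smooth_fun_on M V (pairing M \<gamma> s)"
    by (rule smooth_fun_on_cong[OF triv_openin[OF V(1)], rotated])
      (use triv_subset[OF V(1)] in \<open>auto simp: pairing_def covec_triv[OF V(1)] dual_section_in[OF assms(1)]
          section_in[OF assms(2)] subset_iff\<close>)
  then show "\<exists>W'. openin (mtop M) W' \<and> x \<in> W' \<and> smooth_fun_on M W' (pairing M \<gamma> s)"
    using triv_openin[OF V(1)] V(2) by blast
qed

text \<open>Evaluating the constant covector \<open>k\<close> in the trivialization and cutting off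
  by a bump function is linear over functions, so \<open>dual_section_ex1\<close> supplies the
  section.\<close>

lemma dual_section_through:
  fixes k :: "'v \<Rightarrow>\<^sub>L real"
  assumes V: "(V, \<psi>) \<in> trivs G" and x0: "x0 \<in> V"
  obtains \<gamma> where "\<gamma> \<in> sections M (dual_bundle M G)" "covec \<psi> x0 (snd (\<gamma> x0)) = k"
proof -
  have x0p: "x0 \<in> pts M" using triv_subset[OF V] x0 by auto
  obtain \<phi> :: "'p \<Rightarrow> real" and K where \<phi>: "smooth_fun_on M (pts M) \<phi>" "\<phi> x0 = 1" "closedin (mtop M) K" "K \<subseteq> V"
    "\<And>x. x \<notin> K \<Longrightarrow> \<phi> x = 0"
    using bump_exists[OF triv_openin[OF V] x0] by metis
  define L where "L s x = (if x \<in> V then \<phi> x *\<^sub>R k (\<psi> (s x)) else 0)" for s x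
  interpret L: function_linear M G L
  proof
    fix s assume s: "s \<in> sections M G"
    show "smooth_fun_on M (pts M) (L s)"
      unfolding L_def
      by (rule smooth_extend_by_zero[OF triv_openin[OF V] \<phi>(1,3-5) openin_pts])
        (use triv_subset[OF V] in \<open>auto simp: Int_absorb2 intro!: triv_openin[OF V]
          smooth_fun_on_compose_linear[OF blinfun.bounded_linear_right] section_smooth[OF s V]\<close>)
  qed (auto simp: L_def triv_sec_add[OF _ _ V] triv_sec_mult[OF _ V] blinfun.add_right blinfun.scaleR_right algebra_simps)
  obtain \<gamma> where \<gamma>: "\<gamma> \<in> sections M (dual_bundle M G)"
    "\<And>s x. s \<in> sections M G \<Longrightarrow> x \<in> pts M \<Longrightarrow> pairing M \<gamma> s x = L s x"
    using L.dual_section_ex1 by blast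
  have "covec \<psi> x0 (snd (\<gamma> x0)) v = k v" for v
  proof -
    obtain s where s: "s \<in> sections M G" "s x0 = triv_inv G \<psi> x0 v"
      using section_through[OF x0p triv_inv_in[OF V x0]] by metis
    have "covec \<psi> x0 (snd (\<gamma> x0)) v = pairing M \<gamma> s x0"
      using x0p by (simp add: covec_apply[OF V x0] dual_section_in[OF \<gamma>(1)] pairing_def s(2))
    also have "\<dots> = k v"
      using x0p x0 \<phi>(2) by (simp add: \<gamma>(2)[OF s(1)] L_def s(2) triv_triv_inv[OF V])
    finally show ?thesis .
  qed
  with \<gamma>(1) show ?thesis by (intro that blinfun_eqI)
qed

end

locale derivation = smooth_bundle M G
  for M :: "('p, 'a::real_normed_vector) manifold" and G :: "('p, 'e, 'v::real_normed_vector) vbundle" +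
  fixes X :: "'p \<Rightarrow> 'p \<times> (('p, 'a) chart \<Rightarrow> 'a)" and D :: "('p \<Rightarrow> 'e) \<Rightarrow> 'p \<Rightarrow> 'e"
  assumes is_derivation: "linear_derivation M G X D"
begin

lemma X_vf: "X \<in> vector_fields M"
  using is_derivation by (simp add: linear_derivation_def)

lemma D_in: "s \<in> sections M G \<Longrightarrow> D s \<in> sections M G"
  using is_derivation by (auto simp: linear_derivation_def)

lemma D_add: "s \<in> sections M G \<Longrightarrow> s' \<in> sections M G \<Longrightarrow> D (sec_add M G s s') = sec_add M G (D s) (D s')"
  using is_derivation by (auto simp: linear_derivation_def)

lemma D_scale: "s \<in> sections M G \<Longrightarrow> D (sec_mult M G (\<lambda>_. r) s) = sec_mult M G (\<lambda>_. r) (D s)"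
  using is_derivation by (auto simp: linear_derivation_def)

lemma D_mult: "h \<in> Cinf M \<Longrightarrow> s \<in> sections M G \<Longrightarrow>
    D (sec_mult M G h s) = sec_add M G (sec_mult M G (vf_apply M X h) s) (sec_mult M G h (D s))"
  using is_derivation by (auto simp: linear_derivation_def)

lemma pairing_sec_add:
  assumes "\<gamma> \<in> sections M (dual_bundle M G)" "s \<in> sections M G" "s' \<in> sections M G" "x \<in> pts M"
  shows "pairing M \<gamma> (sec_add M G s s') x = pairing M \<gamma> s x + pairing M \<gamma> s' x"
  using dual_section_in[OF assms(1,4)] assms(4)
  by (simp add: pairing_def sec_add_def dual_spaceD section_in[OF assms(2)] section_in[OF assms(3)])

lemma pairing_sec_mult:
  assumes "\<gamma> \<in> sections M (dual_bundle M G)" "s \<in> sections M G" "x \<in> pts M"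
  shows "pairing M \<gamma> (sec_mult M G h s) x = h x * pairing M \<gamma> s x"
  using dual_section_in[OF assms(1,3)] assms(3)
  by (simp add: pairing_def sec_mult_def dual_spaceD section_in[OF assms(2)])

text \<open>Existence is essential here: the dual derivation is a definite description.\<close>

lemma dual_derivation:
  assumes \<gamma>: "\<gamma> \<in> sections M (dual_bundle M G)"
  shows "dual_derivation M G X D \<gamma> \<in> sections M (dual_bundle M G)"
    and "s \<in> sections M G \<Longrightarrow> x \<in> pts M \<Longrightarrow>
      pairing M (dual_derivation M G X D \<gamma>) s x = vf_apply M X (pairing M \<gamma> s) x - pairing M \<gamma> (D s) x"
proof -
  define L where "L s x = vf_apply M X (pairing M \<gamma> s) x - pairing M \<gamma> (D s) x" for s x
  interpret L: function_linear M G L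
  proof
    fix s assume s: "s \<in> sections M G"
    note ps = pairing_smooth[OF \<gamma> s]
    show "smooth_fun_on M (pts M) (L s)"
      unfolding L_def
      by (intro smooth_fun_on_diff openin_pts vf_apply_smooth X_vf pairing_smooth \<gamma> s D_in)
    { fix h x assume h: "h \<in> Cinf M" and x: "x \<in> pts M"
      have sh: "smooth_fun_on M (pts M) h" using h by (rule Cinf_smooth)
      have "vf_apply M X (pairing M \<gamma> (sec_mult M G h s)) x = vf_apply M X (\<lambda>x. h x * pairing M \<gamma> s x) x"
        by (rule vf_apply_cong[OF X_vf openin_pts x])
          (auto simp: pairing_sec_mult[OF \<gamma> s] intro!: pairing_smooth \<gamma> sec_mult_in sh s)
      also have "\<dots> = h x * vf_apply M X (pairing M \<gamma> s) x + vf_apply M X h x * pairing M \<gamma> s x"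
        by (rule vf_apply_mult[OF X_vf sh ps x x])
      \<comment> \<open>The Leibniz rule of \<open>D\<close> produces the same term X(h)<\<gamma>,
        s> as the product rule just used for \<open>X\<close>. It cancels in the difference, which
        is therefore linear over functions.\<close>
      moreover have "pairing M \<gamma> (D (sec_mult M G h s)) x
          = vf_apply M X h x * pairing M \<gamma> s x + h x * pairing M \<gamma> (D s) x"
        unfolding D_mult[OF h s]
        by (simp add: pairing_sec_add[OF \<gamma> _ _ x] pairing_sec_mult[OF \<gamma> _ x] sec_mult_in D_in s sh
            vf_apply_smooth[OF X_vf openin_pts])
      ultimately show "L (sec_mult M G h s) x = h x * L s x"
        unfolding L_def by (simp add: algebra_simps) }
    fix s' x assume s': "s' \<in> sections M G" and x: "x \<in> pts M"
    have "vf_apply M X (pairing M \<gamma> (sec_add M G s s')) x = vf_apply M X (\<lambda>x. pairing M \<gamma> s x + pairing M \<gamma> s' x) x"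
      by (rule vf_apply_cong[OF X_vf openin_pts x])
        (auto simp: pairing_sec_add[OF \<gamma> s s'] intro!: pairing_smooth \<gamma> sec_add_in s s')
    also have "\<dots> = vf_apply M X (pairing M \<gamma> s) x + vf_apply M X (pairing M \<gamma> s') x"
      by (rule vf_apply_add[OF X_vf ps pairing_smooth[OF \<gamma> s'] x x])
    finally show "L (sec_add M G s s') x = L s x + L s' x"
      unfolding L_def D_add[OF s s'] pairing_sec_add[OF \<gamma> D_in[OF s] D_in[OF s'] x] by simp
  qed
  have "dual_derivation M G X D \<gamma> \<in> sections M (dual_bundle M G) \<and>
      (\<forall>s\<in>sections M G. \<forall>x\<in>pts M. pairing M (dual_derivation M G X D \<gamma>) s x = L s x)"
    unfolding dual_derivation_def L_def[symmetric] by (rule theI'[OF L.dual_section_ex1])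
  then show "dual_derivation M G X D \<gamma> \<in> sections M (dual_bundle M G)"
    and "s \<in> sections M G \<Longrightarrow> x \<in> pts M \<Longrightarrow>
      pairing M (dual_derivation M G X D \<gamma>) s x = vf_apply M X (pairing M \<gamma> s) x - pairing M \<gamma> (D s) x"
    by (auto simp: L_def)
qed

end

section \<open>The linear vector field in charts of the total space\<close>

locale linear_field = derivation M G X D
  for M :: "('p, 'a::real_normed_vector) manifold" and G :: "('p, 'e, 'v::real_normed_vector) vbundle" and X D +
  fixes \<Xi> :: "'e \<Rightarrow> 'e \<times> (('e, 'a \<times> 'v) chart \<Rightarrow> 'a \<times> 'v)"
  assumes is_associated: "associated_vector_field M G X D \<Xi>"
begin

lemma \<Xi>_vf: "\<Xi> \<in> vector_fields (tot M G)"
  using is_associated by (simp add: associated_vector_field_def linear_vector_field_def)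

lemma \<Xi>_projects: "g \<in> tspace G \<Longrightarrow> tangent_map (tot M G) M (bproj G) (\<Xi> g) = X (bproj G g)"
  using is_associated by (simp add: associated_vector_field_def linear_vector_field_def)

lemma \<Xi>_ell:
  "\<gamma> \<in> sections M (dual_bundle M G) \<Longrightarrow> vf_apply (tot M G) \<Xi> (ell G \<gamma>) = ell G (dual_derivation M G X D \<gamma>)"
  using is_associated by (simp add: associated_vector_field_def)

lemma tot_chart_at:
  assumes "(U, \<kappa>) \<in> atlas M" "(V, \<psi>) \<in> trivs G" "e \<in> fibre G x" "x \<in> U" "x \<in> V"
  shows "tot_chart U \<kappa> V \<psi> \<in> charts_at (tot M G) e"
  using assms by (auto simp: charts_at_def atlas_tot tot_chart_def fibre_def)

text \<open>In adapted charts the bundle projection is \<open>fst\<close>, which is its own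
  derivative. The work lies in passing from the chart chosen inside \<open>tangent_map\<close> to
  the adapted one.\<close>

lemma \<Xi>_base_component:
  assumes U: "(U, \<kappa>) \<in> atlas M" and V: "(V, \<psi>) \<in> trivs G" and e: "e \<in> fibre G x" and x: "x \<in> U" "x \<in> V"
  shows "fst (snd (\<Xi> e) (tot_chart U \<kappa> V \<psi>)) = snd (X x) (U, \<kappa>)"
proof -
  let ?\<chi> = "snd (tot_chart U \<kappa> V \<psi>)" and ?C = "fst (tot_chart U \<kappa> V \<psi>)"
  have et: "e \<in> tspace G" "bproj G e = x" using e by (auto simp: fibre_def)
  have ch: "(?C, ?\<chi>) \<in> charts_at (tot M G) e" using tot_chart_at[OF U V e x] by simp
  have "open (\<kappa> ` (U \<inter> V))" by (rule open_chart_image[OF triv_openin[OF V] U])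
  then have o: "open (\<kappa> ` (U \<inter> V) \<times> (UNIV :: 'v set))" by (intro open_Times) auto
  have \<chi>e: "?\<chi> e = (\<kappa> x, \<psi> e)" using et by (simp add: tot_chart_def)
  have "(fst has_derivative fst) (at (?\<chi> e))" by (rule bounded_linear_imp_has_derivative[OF bounded_linear_fst])
  then have "(((\<kappa> \<circ> bproj G) \<circ> inv_into ?C ?\<chi>) has_derivative fst) (at (?\<chi> e))"
  proof (rule has_derivative_transform_within_open[OF _ o])
    show "?\<chi> e \<in> \<kappa> ` (U \<inter> V) \<times> UNIV" using x by (simp add: \<chi>e)
    fix p assume "p \<in> \<kappa> ` (U \<inter> V) \<times> (UNIV :: 'v set)"
    then obtain y v where p: "p = (\<kappa> y, v)" "y \<in> U" "y \<in> V" by auto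
    then show "fst p = ((\<kappa> \<circ> bproj G) \<circ> inv_into ?C ?\<chi>) p"
      using triv_inv_in[OF V p(3)] by (simp add: tot_chart_inv[OF U V] fibre_def)
  qed
  moreover obtain C' \<chi>' where c': "(SOME c. c \<in> charts_at (tot M G) e) = (C', \<chi>')" by fastforce
  moreover have "(C', \<chi>') \<in> charts_at (tot M G) e" using tot.some_chart[of e] et c' by (simp add: pts_tot)
  moreover have "fst (\<Xi> e) = e" "snd (\<Xi> e) \<in> tangent_space (tot M G) e"
    using tot.vector_fieldsD[OF \<Xi>_vf] et by (auto simp: pts_tot)
  ultimately have "frechet_derivative ((\<kappa> \<circ> bproj G) \<circ> inv_into C' \<chi>') (at (\<chi>' e)) (snd (\<Xi> e) (C', \<chi>'))
      = fst (snd (\<Xi> e) (tot_chart U \<kappa> V \<psi>))"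
    using tot.tangent_chart_independent[OF _ _ ch] by simp
  moreover have "snd (tangent_map (tot M G) M (bproj G) (\<Xi> e)) (U, \<kappa>)
      = frechet_derivative ((\<kappa> \<circ> bproj G) \<circ> inv_into C' \<chi>') (at (\<chi>' e)) (snd (\<Xi> e) (C', \<chi>'))"
    using \<open>fst (\<Xi> e) = e\<close> c' U x et(2) by (simp add: tangent_map_def split_beta charts_at_def o_assoc)
  ultimately show ?thesis using \<Xi>_projects[OF et(1)] et(2) by simp
qed

text \<open>The vertical part of \<open>\<Xi>\<close> along a section \<open>s\<close> measures the difference between the derivative
  of \<open>s\<close> in the direction of \<open>X\<close> and \<open>D s\<close>: test \<open>\<Xi> \<ell>\<^sub>\<gamma> = \<ell>\<close> of the dual derivative of \<open>\<gamma>\<close> on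
  sections \<open>\<gamma>\<close> with prescribed value at \<open>x\<close>.\<close>

lemma \<Xi>_fibre_component:
  assumes U: "(U, \<kappa>) \<in> atlas M" and V: "(V, \<psi>) \<in> trivs G" and s: "s \<in> sections M G" and x: "x \<in> U" "x \<in> V"
  shows "snd (snd (\<Xi> (s x)) (tot_chart U \<kappa> V \<psi>))
    = frechet_derivative ((\<lambda>x. \<psi> (s x)) \<circ> inv_into U \<kappa>) (at (\<kappa> x)) (snd (X x) (U, \<kappa>)) - \<psi> (D s x)"
proof -
  let ?\<chi> = "snd (tot_chart U \<kappa> V \<psi>)" and ?C = "fst (tot_chart U \<kappa> V \<psi>)"
  let ?sl = "(\<lambda>x. \<psi> (s x)) \<circ> inv_into U \<kappa>"
  have xp: "x \<in> pts M" using chart_subset[OF U] x by auto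
  note e = section_in[OF s xp]
  have et: "s x \<in> tspace G" "bproj G (s x) = x" using e by (auto simp: fibre_def)
  have ch: "(?C, ?\<chi>) \<in> charts_at (tot M G) (s x)" using tot_chart_at[OF U V e x] by simp
  have chM: "(U, \<kappa>) \<in> charts_at M x" using U x by (simp add: charts_at_def)
  have oUV: "open (\<kappa> ` (U \<inter> V))" by (rule open_chart_image[OF triv_openin[OF V] U])
  then have o: "open (\<kappa> ` (U \<inter> V) \<times> (UNIV :: 'v set))" by (intro open_Times) auto
  have \<chi>e: "?\<chi> (s x) = (\<kappa> x, \<psi> (s x))" using et by (simp add: tot_chart_def)
  obtain \<xi> u where \<xi>u: "snd (\<Xi> (s x)) (tot_chart U \<kappa> V \<psi>) = (\<xi>, u)" by fastforce
  have \<xi>: "\<xi> = snd (X x) (U, \<kappa>)" using \<Xi>_base_component[OF U V e x] \<xi>u by simp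
  have ds: "(?sl has_derivative frechet_derivative ?sl (at (\<kappa> x))) (at (\<kappa> x))"
    by (rule smooth_fun_on_has_derivative[OF section_smooth[OF s V] chM x(2)])
  \<comment> \<open>Both sides are compared under an arbitrary covector \<open>k\<close>, realized
    as the value at \<open>x\<close> of a global dual section.\<close>
  have test: "k u = k (frechet_derivative ?sl (at (\<kappa> x)) \<xi> - \<psi> (D s x))" for k :: "'v \<Rightarrow>\<^sub>L real"
  proof -
    obtain \<gamma> where \<gamma>: "\<gamma> \<in> sections M (dual_bundle M G)" "covec \<psi> x (snd (\<gamma> x)) = k"
      using dual_section_through[OF V x(2)] by metis
    define g where "g = (\<lambda>x. covec \<psi> x (snd (\<gamma> x))) \<circ> inv_into U \<kappa>"
    have gx: "g (\<kappa> x) = k" using chart_inv[OF U x(1)] \<gamma>(2) by (simp add: g_def)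
    obtain g' where g': "(g has_derivative g') (at (\<kappa> x))"
      using smooth_fun_on_has_derivative[OF dual_section_smooth[OF \<gamma>(1) V] chM x(2)] unfolding g_def by blast
    \<comment> \<open>In the chart, \<open>ell G \<gamma>\<close> is (y, v) |-> g(y) v. Its
      derivative along (\<open>\<xi>\<close>, \<open>u\<close>) is k u plus the variation of
      \<open>g\<close> along \<open>\<xi>\<close> applied to \<open>\<psi> (s x)\<close>.\<close>
    have "((\<lambda>p. blinfun_apply (g (fst p)) (snd p)) has_derivative
        (\<lambda>h. blinfun_apply (g (fst (?\<chi> (s x)))) (snd h) + blinfun_apply (g' (fst h)) (snd (?\<chi> (s x))))) (at (?\<chi> (s x)))"
      by (rule bounded_bilinear.FDERIV[OF bounded_bilinear_blinfun_apply])
        (auto intro!: has_derivative_compose[where f = fst and g = g, simplified] g' has_derivative_fst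
          has_derivative_snd simp: \<chi>e)
    then have "((ell G \<gamma> \<circ> inv_into ?C ?\<chi>) has_derivative
        (\<lambda>h. blinfun_apply k (snd h) + blinfun_apply (g' (fst h)) (\<psi> (s x)))) (at (?\<chi> (s x)))"
      unfolding \<chi>e fst_conv snd_conv gx
    proof (rule has_derivative_transform_within_open[OF _ o])
      show "(\<kappa> x, \<psi> (s x)) \<in> \<kappa> ` (U \<inter> V) \<times> UNIV" using x by simp
      fix p assume "p \<in> \<kappa> ` (U \<inter> V) \<times> (UNIV :: 'v set)"
      then obtain y v where p: "p = (\<kappa> y, v)" "y \<in> U" "y \<in> V" by auto
      then have "y \<in> pts M" using chart_subset[OF U] by auto
      then show "blinfun_apply (g (fst p)) (snd p) = (ell G \<gamma> \<circ> inv_into ?C ?\<chi>) p"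
        using triv_inv_in[OF V p(3)] p
        by (simp add: tot_chart_inv[OF U V] fibre_def g_def chart_inv[OF U] covec_apply[OF V] dual_section_in[OF \<gamma>(1)] ell_def)
    qed
    from tot.vf_apply_chart[OF _ ch this, of \<Xi>]
    have "vf_apply (tot M G) \<Xi> (ell G \<gamma>) (s x) = k u + blinfun_apply (g' \<xi>) (\<psi> (s x))"
      using tot.vector_fieldsD(2)[OF \<Xi>_vf] et by (simp add: pts_tot \<xi>u)
    moreover have "ell G (dual_derivation M G X D \<gamma>) (s x)
        = vf_apply M X (pairing M \<gamma> s) x - pairing M \<gamma> (D s) x"
      using dual_derivation(2)[OF \<gamma>(1) s xp] et xp by (simp add: ell_def pairing_def)
    \<comment> \<open>The same variation of \<open>g\<close> appears here and cancels, so only the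
      value \<open>k\<close> of the test section at \<open>x\<close> survives.\<close>
    moreover have "vf_apply M X (pairing M \<gamma> s) x
        = k (frechet_derivative ?sl (at (\<kappa> x)) \<xi>) + blinfun_apply (g' \<xi>) (\<psi> (s x))"
    proof -
      have "((\<lambda>y. blinfun_apply (g y) (?sl y)) has_derivative
          (\<lambda>h. blinfun_apply (g (\<kappa> x)) (frechet_derivative ?sl (at (\<kappa> x)) h) + blinfun_apply (g' h) (?sl (\<kappa> x)))) (at (\<kappa> x))"
        by (rule bounded_bilinear.FDERIV[OF bounded_bilinear_blinfun_apply g' ds])
      then have "((pairing M \<gamma> s \<circ> inv_into U \<kappa>) has_derivative
          (\<lambda>h. blinfun_apply (g (\<kappa> x)) (frechet_derivative ?sl (at (\<kappa> x)) h) + blinfun_apply (g' h) (?sl (\<kappa> x)))) (at (\<kappa> x))"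
      proof (rule has_derivative_transform_within_open[OF _ oUV])
        show "\<kappa> x \<in> \<kappa> ` (U \<inter> V)" using x by simp
        fix y' assume "y' \<in> \<kappa> ` (U \<inter> V)"
        then obtain y where y: "y' = \<kappa> y" "y \<in> U" "y \<in> V" by auto
        then have "y \<in> pts M" using chart_subset[OF U] by auto
        then show "blinfun_apply (g y') (?sl y') = (pairing M \<gamma> s \<circ> inv_into U \<kappa>) y'"
          using y by (simp add: g_def chart_inv[OF U] covec_triv[OF V] dual_section_in[OF \<gamma>(1)] section_in[OF s] pairing_def)
      qed
      from vf_apply_chart[where X = X and p = x and h = "pairing M \<gamma> s" and U = U and \<kappa> = \<kappa>,
          OF vector_fieldsD(2)[OF X_vf xp] chM this] show ?thesis
        using gx chart_inv[OF U x(1)] by (simp add: \<xi>)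
    qed
    moreover have "pairing M \<gamma> (D s) x = k (\<psi> (D s x))"
      using covec_triv[OF V x(2) dual_section_in(2)[OF \<gamma>(1) xp] section_in[OF D_in[OF s] xp]] \<gamma>(2) xp
      by (simp add: pairing_def)
    ultimately show ?thesis using \<Xi>_ell[OF \<gamma>(1)] by (simp add: blinfun.diff_right)
  qed
  obtain B and c :: "'v \<Rightarrow> 'v \<Rightarrow>\<^sub>L real" where B: "\<And>x. (\<Sum>b\<in>B. c b x *\<^sub>R b) = x"
    using finite_dim_coordinates[OF fibre_model_finite_dim] by metis
  \<comment> \<open>The coordinate functionals are among the covectors tested, and they determine a
    vector.\<close>
  have "u = (\<Sum>b\<in>B. c b u *\<^sub>R b)" by (simp add: B)
  also have "\<dots> = frechet_derivative ?sl (at (\<kappa> x)) \<xi> - \<psi> (D s x)" unfolding test B ..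
  finally show ?thesis using \<xi>u \<xi> by simp
qed

text \<open>With global sections through \<open>e\<close> and \<open>e'\<close>, the formula for the
  vertical part is additive in the section, since both the coordinate derivative and
  \<open>D\<close> are.\<close>

lemma \<Xi>_fibre_component_add:
  assumes U: "(U, \<kappa>) \<in> atlas M" and V: "(V, \<psi>) \<in> trivs G" and e: "e \<in> fibre G x" "e' \<in> fibre G x" and x: "x \<in> U" "x \<in> V"
  shows "snd (snd (\<Xi> (fadd G e e')) (tot_chart U \<kappa> V \<psi>))
    = snd (snd (\<Xi> e) (tot_chart U \<kappa> V \<psi>)) + snd (snd (\<Xi> e') (tot_chart U \<kappa> V \<psi>))"
proof -
  have xp: "x \<in> pts M" using chart_subset[OF U] x by auto
  obtain s where s: "s \<in> sections M G" "s x = e" using section_through[OF xp e(1)] .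
  obtain s' where s': "s' \<in> sections M G" "s' x = e'" using section_through[OF xp e(2)] .
  let ?S = "sec_add M G s s'"
  have chM: "(U, \<kappa>) \<in> charts_at M x" using U x by (simp add: charts_at_def)
  have oUV: "open (\<kappa> ` (U \<inter> V))" by (rule open_chart_image[OF triv_openin[OF V] U])
  note d = smooth_fun_on_has_derivative[OF section_smooth[OF _ V] chM x(2)]
  have "((\<lambda>x. \<psi> (?S x)) \<circ> inv_into U \<kappa> has_derivative
      (\<lambda>v. frechet_derivative ((\<lambda>x. \<psi> (s x)) \<circ> inv_into U \<kappa>) (at (\<kappa> x)) v
        + frechet_derivative ((\<lambda>x. \<psi> (s' x)) \<circ> inv_into U \<kappa>) (at (\<kappa> x)) v)) (at (\<kappa> x))"
    by (rule has_derivative_transform_within_open[OF has_derivative_add[OF d[OF s(1)] d[OF s'(1)]] oUV])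
      (use x in \<open>auto simp: chart_inv[OF U] triv_sec_add[OF s(1) s'(1) V]\<close>)
  note eq = frechet_derivative_at[OF this, symmetric]
  have "?S x = fadd G e e'" using xp s s' by (simp add: sec_add_def)
  then show ?thesis
    using \<Xi>_fibre_component[OF U V sec_add_in[OF s(1) s'(1)] x] \<Xi>_fibre_component[OF U V s(1) x]
      \<Xi>_fibre_component[OF U V s'(1) x]
    by (simp add: eq D_add[OF s(1) s'(1)] triv_sec_add[OF D_in[OF s(1)] D_in[OF s'(1)] V x(2)] s(2) s'(2))
qed

lemma \<Xi>_fibre_component_scale:
  assumes U: "(U, \<kappa>) \<in> atlas M" and V: "(V, \<psi>) \<in> trivs G" and e: "e \<in> fibre G x" and x: "x \<in> U" "x \<in> V"
  shows "snd (snd (\<Xi> (fscale G r e)) (tot_chart U \<kappa> V \<psi>)) = r *\<^sub>R snd (snd (\<Xi> e) (tot_chart U \<kappa> V \<psi>))"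
proof -
  have xp: "x \<in> pts M" using chart_subset[OF U] x by auto
  obtain s where s: "s \<in> sections M G" "s x = e" using section_through[OF xp e] .
  let ?S = "sec_mult M G (\<lambda>_. r) s"
  have chM: "(U, \<kappa>) \<in> charts_at M x" using U x by (simp add: charts_at_def)
  have oUV: "open (\<kappa> ` (U \<inter> V))" by (rule open_chart_image[OF triv_openin[OF V] U])
  note d = smooth_fun_on_has_derivative[OF section_smooth[OF _ V] chM x(2)]
  have "((\<lambda>x. \<psi> (?S x)) \<circ> inv_into U \<kappa> has_derivative
      (\<lambda>v. r *\<^sub>R frechet_derivative ((\<lambda>x. \<psi> (s x)) \<circ> inv_into U \<kappa>) (at (\<kappa> x)) v)) (at (\<kappa> x))"
    by (rule has_derivative_transform_within_open[OF has_derivative_scaleR_right[OF d[OF s(1)]] oUV])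
      (use x in \<open>auto simp: chart_inv[OF U] triv_sec_mult[OF s(1) V]\<close>)
  note eq = frechet_derivative_at[OF this, symmetric]
  have "?S x = fscale G r e" using xp s by (simp add: sec_mult_def)
  then show ?thesis
    using \<Xi>_fibre_component[OF U V sec_mult_in[OF smooth_fun_on_const s(1)] x, of r] \<Xi>_fibre_component[OF U V s(1) x]
    by (simp add: eq D_scale[OF s(1)] triv_sec_mult[OF D_in[OF s(1)] V x(2)] s(2) scaleR_diff_right)
qed

text \<open>Linearity and smoothness of the chart expression of \<open>\<Xi>\<close> give continuity
  for each fixed vector. Assembling the operator from finitely many basis vectors upgrades this to
  continuity in the operator norm.\<close>

lemma \<Xi>_fibre_component_linear:
  assumes U: "(U, \<kappa>) \<in> atlas M" and V: "(V, \<psi>) \<in> trivs G"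
  obtains A :: "'a \<Rightarrow> 'v \<Rightarrow>\<^sub>L 'v" where "continuous_on (\<kappa> ` (U \<inter> V)) A"
    "\<And>x e. x \<in> U \<Longrightarrow> x \<in> V \<Longrightarrow> e \<in> fibre G x \<Longrightarrow> snd (snd (\<Xi> e) (tot_chart U \<kappa> V \<psi>)) = A (\<kappa> x) (\<psi> e)"
proof -
  let ?\<chi> = "snd (tot_chart U \<kappa> V \<psi>)" and ?C = "fst (tot_chart U \<kappa> V \<psi>)"
  obtain B and c :: "'v \<Rightarrow> 'v \<Rightarrow>\<^sub>L real" where B: "\<And>x. (\<Sum>b\<in>B. c b x *\<^sub>R b) = x"
    using finite_dim_coordinates[OF fibre_model_finite_dim] by metis
  define H where "H y v = snd (((\<lambda>e. snd (\<Xi> e) (tot_chart U \<kappa> V \<psi>)) \<circ> inv_into ?C ?\<chi>) (y, v))" for y v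
  have cH: "continuous_on (\<kappa> ` (U \<inter> V)) (\<lambda>y. H y v)" for v
  proof -
    have at: "(?C, ?\<chi>) \<in> atlas (tot M G)" using U V by (auto simp: atlas_tot)
    have "smooth_on (?\<chi> ` (?C \<inter> ?C)) ((\<lambda>e. snd (\<Xi> e) (?C, ?\<chi>)) \<circ> inv_into ?C ?\<chi>)"
      by (rule tot.smooth_fun_onD[OF tot.vector_fieldsD(3)[OF \<Xi>_vf at] at])
    moreover have "?\<chi> ` (?C \<inter> ?C) = \<kappa> ` (U \<inter> V) \<times> UNIV"
      using tot_chart_image[OF U V subset_refl] by (simp add: tot_chart_def)
    ultimately have "smooth_on (\<kappa> ` (U \<inter> V) \<times> UNIV) ((\<lambda>e. snd (\<Xi> e) (tot_chart U \<kappa> V \<psi>)) \<circ> inv_into ?C ?\<chi>)"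
      by (simp only: prod.collapse)
    then have "continuous_on (\<kappa> ` (U \<inter> V) \<times> UNIV) ((\<lambda>e. snd (\<Xi> e) (tot_chart U \<kappa> V \<psi>)) \<circ> inv_into ?C ?\<chi>)"
      by (rule smooth_on_continuous_on)
    moreover have "continuous_on (\<kappa> ` (U \<inter> V)) (\<lambda>y. (y, v))" by (intro continuous_intros)
    ultimately have "continuous_on (\<kappa> ` (U \<inter> V))
        (\<lambda>y. ((\<lambda>e. snd (\<Xi> e) (tot_chart U \<kappa> V \<psi>)) \<circ> inv_into ?C ?\<chi>) (y, v))"
      by (rule continuous_on_compose2) auto
    then show ?thesis unfolding H_def by (rule continuous_on_snd)
  qed
  have H: "H (\<kappa> x) v = snd (snd (\<Xi> (triv_inv G \<psi> x v)) (tot_chart U \<kappa> V \<psi>))" if "x \<in> U" "x \<in> V" for x v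
    using that by (simp add: H_def tot_chart_inv[OF U V])
  have lin: "linear (H (\<kappa> x))" if x: "x \<in> U" "x \<in> V" for x
    by (rule linearI)
      (simp_all add: H[OF x] triv_inv_add[OF V x(2)] triv_inv_scale[OF V x(2)]
        \<Xi>_fibre_component_add[OF U V triv_inv_in[OF V x(2)] triv_inv_in[OF V x(2)] x]
        \<Xi>_fibre_component_scale[OF U V triv_inv_in[OF V x(2)] x])
  define A where "A y = (\<Sum>b\<in>B. blinfun_scaleR_left (H y b) o\<^sub>L c b)" for y
  have "continuous_on (\<kappa> ` (U \<inter> V)) A"
    unfolding A_def by (intro continuous_on_sum bounded_linear.continuous_on[OF bounded_linear_rank_one] cH)
  moreover have "snd (snd (\<Xi> e) (tot_chart U \<kappa> V \<psi>)) = A (\<kappa> x) (\<psi> e)"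
    if x: "x \<in> U" "x \<in> V" and e: "e \<in> fibre G x" for x e
  proof -
    have "snd (snd (\<Xi> e) (tot_chart U \<kappa> V \<psi>)) = H (\<kappa> x) (\<Sum>b\<in>B. c b (\<psi> e) *\<^sub>R b)"
      by (simp add: H[OF x] B triv_inv_triv[OF V x(2) e])
    also have "\<dots> = A (\<kappa> x) (\<psi> e)"
      by (simp add: A_def linear_sum[OF lin[OF x]] linear_scale[OF lin[OF x]] blinfun.sum_left)
    finally show ?thesis .
  qed
  ultimately show ?thesis using that by blast
qed

end

section \<open>Ordinary differential equations\<close>

lemma vector_derivative_bound:
  fixes u :: "real \<Rightarrow> 'a::real_normed_vector"
  assumes "convex S" "\<And>t. t \<in> S \<Longrightarrow> (u has_vector_derivative u' t) (at t within S)"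
    and "\<And>t. t \<in> S \<Longrightarrow> norm (u' t) \<le> B" "s \<in> S" "t \<in> S"
  shows "norm (u t - u s) \<le> B * \<bar>t - s\<bar>"
proof -
  have "norm (u t - u s) \<le> B * norm (t - s)"
  proof (rule differentiable_bound[OF assms(1) _ _ assms(5,4)])
    fix r assume r: "r \<in> S"
    show "(u has_derivative (\<lambda>h. h *\<^sub>R u' r)) (at r within S)"
      using assms(2)[OF r] by (simp add: has_vector_derivative_def)
    show "onorm (\<lambda>h. h *\<^sub>R u' r) \<le> B"
    proof (rule onorm_le)
      fix h :: real
      show "norm (h *\<^sub>R u' r) \<le> B * norm h"
        using mult_right_mono[OF assms(3)[OF r] abs_ge_zero[of h]] by (simp add: mult.commute)
    qed
  qed
  then show ?thesis by simp
qed

text \<open>Iterating the mean value inequality halves the bound on \<open>u\<close> in each step.\<close>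

lemma ode_zero:
  fixes u :: "real \<Rightarrow> 'a::real_normed_vector"
  assumes "\<And>t. t \<in> {t0 - d..t0 + d} \<Longrightarrow> (u has_vector_derivative u' t) (at t)"
    and "\<And>t. t \<in> {t0 - d..t0 + d} \<Longrightarrow> norm (u' t) \<le> K * norm (u t)"
    and "0 \<le> K" "K * d \<le> 1 / 2" "u t0 = 0" "t \<in> {t0 - d..t0 + d}"
  shows "u t = 0"
proof -
  let ?S = "{t0 - d..t0 + d}"
  have d: "0 \<le> d" using assms(6) by auto
  have "continuous_on ?S u"
    using assms(1) by (intro continuous_at_imp_continuous_on ballI) (blast intro: has_vector_derivative_continuous)
  then have "bounded (u ` ?S)" by (intro compact_imp_bounded compact_continuous_image) auto
  then obtain C where C: "\<forall>t\<in>?S. norm (u t) \<le> C" unfolding bounded_iff by auto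
  have C0: "0 \<le> C" using bspec[OF C assms(6)] norm_ge_zero order_trans by blast
  have "norm (u t) \<le> C * (1 / 2) ^ n" if "t \<in> ?S" for n t
    using that
  proof (induct n arbitrary: t)
    case (Suc n)
    have "norm (u t - u t0) \<le> (K * (C * (1 / 2) ^ n)) * \<bar>t - t0\<bar>"
    proof (rule vector_derivative_bound[of ?S])
      fix r assume r: "r \<in> ?S"
      show "norm (u' r) \<le> K * (C * (1 / 2) ^ n)"
        using assms(2)[OF r] mult_left_mono[OF Suc(1)[OF r] assms(3)] by linarith
    qed (use assms(1) Suc(2) d in \<open>auto intro: has_vector_derivative_at_within\<close>)
    also have "\<dots> \<le> (K * (C * (1 / 2) ^ n)) * d"
      using Suc(2) assms(3) C0 by (intro mult_left_mono) auto
    also have "\<dots> = (K * d) * (C * (1 / 2) ^ n)" by simp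
    also have "\<dots> \<le> 1 / 2 * (C * (1 / 2) ^ n)"
      using assms(4) C0 by (intro mult_right_mono) auto
    finally show ?case using assms(5) by simp
  qed (use C in auto)
  moreover have "(\<lambda>n. C * (1 / 2) ^ n) \<longlonglongrightarrow> 0"
    by (intro tendsto_mult_right_zero LIMSEQ_realpow_zero) auto
  ultimately have "norm (u t) \<le> 0"
    using assms(6) by (intro LIMSEQ_le_const[of _ 0]) auto
  then show ?thesis by simp
qed

text \<open>Picard's integral operator as a contraction with factor 1/2 on bounded continuous
  functions. The condition on \<open>K * d\<close> involves neither \<open>y0\<close> nor the size
  of the solution.\<close>

lemma linear_ode_exists:
  fixes A :: "real \<Rightarrow> 'v::banach \<Rightarrow>\<^sub>L 'v"
  assumes "0 < d" and A: "continuous_on {t0 - d..t0 + d} A"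
    and K: "\<And>t. t \<in> {t0 - d..t0 + d} \<Longrightarrow> norm (A t) \<le> K" and Kd: "K * d \<le> 1 / 2"
  obtains y where "y t0 = y0" "\<And>t. t \<in> {t0 - d<..<t0 + d} \<Longrightarrow> (y has_vector_derivative A t (y t)) (at t)"
proof -
  let ?S = "{t0 - d..t0 + d}"
  have K0: "0 \<le> K" by (rule order_trans[OF norm_ge_zero K[of t0]]) (use assms(1) in simp)
  \<comment> \<open>The type of bounded continuous functions lives on the whole line, so time is
    clamped to the interval.\<close>
  define cl where "cl t = max (t0 - d) (min (t0 + d) t)" for t
  have cl: "cl t \<in> ?S" for t using assms(1) by (auto simp: cl_def)
  have cl_id: "cl t = t" if "t \<in> ?S" for t using that by (auto simp: cl_def)
  have ccl: "continuous_on UNIV cl" unfolding cl_def by (intro continuous_intros)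
  \<comment> \<open>Integrating from the left end avoids integrals with reversed limits; subtracting
    the value at \<open>t0\<close> in \<open>Q\<close> restores the initial time.\<close>
  define \<Phi> where "\<Phi> y t = integral {t0 - d..t} (\<lambda>s. A s (apply_bcontfun y s))" for y t
  have d\<Phi>: "(\<Phi> y has_vector_derivative A t (apply_bcontfun y t)) (at t within ?S)" if "t \<in> ?S" for y t
  proof -
    have "continuous_on ?S (\<lambda>s. A s (apply_bcontfun y s))"
      by (intro bounded_bilinear.continuous_on[OF bounded_bilinear_blinfun_apply] A continuous_on_apply_bcontfun)
    then show ?thesis unfolding \<Phi>_def[abs_def] by (rule integral_has_vector_derivative[OF _ that])
  qed
  then have c\<Phi>: "continuous_on ?S (\<Phi> y)" for y
    unfolding continuous_on_eq_continuous_within using has_vector_derivative_continuous[OF d\<Phi>] by blast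
  define Q where "Q y t = y0 + (\<Phi> y (cl t) - \<Phi> y t0)" for y t
  have Q: "Q y \<in> bcontfun" for y
  proof -
    have "continuous_on UNIV (Q y)"
      unfolding Q_def by (intro continuous_intros continuous_on_compose2[OF c\<Phi> ccl]) (use cl in auto)
    moreover have "compact ((\<lambda>s. y0 + (\<Phi> y s - \<Phi> y t0)) ` ?S)"
      by (intro compact_continuous_image continuous_intros c\<Phi>) auto
    then have "bounded (range (Q y))"
      by (rule bounded_subset[OF compact_imp_bounded]) (use cl in \<open>auto simp: Q_def\<close>)
    ultimately show ?thesis by (simp add: bcontfun_def)
  qed
  define P where "P y = Bcontfun (Q y)" for y
  have P: "apply_bcontfun (P y) = Q y" for y unfolding P_def by (rule Bcontfun_inverse[OF Q])
  have "dist (P y) (P z) \<le> 1 / 2 * dist y z" for y z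
  proof (rule dist_bound)
    fix t
    have "norm ((\<Phi> y (cl t) - \<Phi> z (cl t)) - (\<Phi> y t0 - \<Phi> z t0)) \<le> (K * dist y z) * \<bar>cl t - t0\<bar>"
    proof (rule vector_derivative_bound[of ?S])
      fix s assume s: "s \<in> ?S"
      show "((\<lambda>s. \<Phi> y s - \<Phi> z s) has_vector_derivative A s (apply_bcontfun y s) - A s (apply_bcontfun z s)) (at s within ?S)"
        by (intro has_vector_derivative_diff d\<Phi> s)
      have "norm (A s (apply_bcontfun y s) - A s (apply_bcontfun z s)) \<le> norm (A s) * norm (apply_bcontfun y s - apply_bcontfun z s)"
        unfolding blinfun.diff_right[symmetric] by (rule norm_blinfun)
      also have "\<dots> \<le> K * dist y z"
        using K[OF s] dist_bounded[of y s z] K0 by (intro mult_mono) (auto simp: dist_norm)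
      finally show "norm (A s (apply_bcontfun y s) - A s (apply_bcontfun z s)) \<le> K * dist y z" .
    qed (use cl assms(1) in auto)
    also have "\<dots> \<le> (K * dist y z) * d"
      using cl[of t] K0 by (intro mult_left_mono) auto
    also have "\<dots> = (K * d) * dist y z" by simp
    also have "\<dots> \<le> 1 / 2 * dist y z" using Kd by (rule mult_right_mono) simp
    finally show "dist (apply_bcontfun (P y) t) (apply_bcontfun (P z) t) \<le> 1 / 2 * dist y z"
      by (simp add: P Q_def dist_norm algebra_simps)
  qed
  then obtain y where "P y = y" using banach_fix_type[of "1 / 2" P] by auto
  then have y: "apply_bcontfun y t = Q y t" for t using P by metis
  have "apply_bcontfun y t0 = y0" using cl_id[of t0] assms(1) by (simp add: y Q_def)
  moreover have "(apply_bcontfun y has_vector_derivative A t (apply_bcontfun y t)) (at t)"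
    if t: "t \<in> {t0 - d<..<t0 + d}" for t
  proof -
    have "t \<in> interior ?S" using t by simp
    then have "(\<Phi> y has_vector_derivative A t (apply_bcontfun y t)) (at t)"
      using d\<Phi>[of t y] t by (simp add: at_within_interior[of t ?S])
    then have "((\<lambda>t. y0 + (\<Phi> y t - \<Phi> y t0)) has_vector_derivative A t (apply_bcontfun y t)) (at t)"
      using has_vector_derivative_add[OF has_vector_derivative_const[of y0]
          has_vector_derivative_diff[OF _ has_vector_derivative_const[of "\<Phi> y t0"]]] by fastforce
    then show ?thesis
      by (rule has_vector_derivative_transform_within_open[of _ _ _ "{t0 - d<..<t0 + d}"])
        (use t cl_id in \<open>auto simp: y Q_def\<close>)
  qed
  ultimately show ?thesis using that by blast
qed

text \<open>\<open>N\<close> bounds the operator norm of the derivative through its values on a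
  basis and is continuous, so it stays below \<open>N y0 + 1\<close> on a ball, where the mean value
  inequality applies.\<close>

lemma smooth_on_locally_lipschitz:
  fixes f :: "'a::real_normed_vector \<Rightarrow> 'b::real_normed_vector"
  assumes "finite_dim TYPE('a)" "open S" "smooth_on S f" "y0 \<in> S"
  obtains r K where "0 < r" "ball y0 r \<subseteq> S" "0 \<le> K"
    "\<And>x y. x \<in> ball y0 r \<Longrightarrow> y \<in> ball y0 r \<Longrightarrow> norm (f x - f y) \<le> K * norm (x - y)"
proof -
  obtain B and c :: "'a \<Rightarrow> 'a \<Rightarrow>\<^sub>L real" where B: "finite B" "\<And>x. (\<Sum>b\<in>B. c b x *\<^sub>R b) = x"
    using finite_dim_coordinates[OF assms(1)] by metis
  let ?D = "\<lambda>x. frechet_derivative f (at x)"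
  define N where "N x = (\<Sum>b\<in>B. norm (c b) * norm (?D x b))" for x
  have cN: "continuous_on S N"
    unfolding N_def
    by (intro continuous_intros smooth_on_continuous_on smooth_on_frechet_derivative assms(3))
  have "open (S \<inter> N -` {..<N y0 + 1})" by (intro continuous_open_preimage cN assms(2)) auto
  moreover have "y0 \<in> S \<inter> N -` {..<N y0 + 1}" using assms(4) by auto
  ultimately obtain r where r: "0 < r" "ball y0 r \<subseteq> S \<inter> N -` {..<N y0 + 1}" using openE by blast
  have N0: "0 \<le> N y0" unfolding N_def by (intro sum_nonneg) auto
  have der: "(f has_derivative ?D x) (at x)" if "x \<in> ball y0 r" for x
    using that r(2) by (intro smooth_on_has_derivative[OF assms(3)]) auto
  have "onorm (?D x) \<le> N y0 + 1" if x: "x \<in> ball y0 r" for x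
  proof (rule onorm_bound)
    fix v
    have lin: "linear (?D x)" using der[OF x] by (rule has_derivative_linear)
    have "?D x v = ?D x (\<Sum>b\<in>B. c b v *\<^sub>R b)" by (simp add: B)
    also have "\<dots> = (\<Sum>b\<in>B. c b v *\<^sub>R ?D x b)" by (simp add: linear_sum[OF lin] linear_scale[OF lin])
    also have "norm \<dots> \<le> (\<Sum>b\<in>B. (norm (c b) * norm v) * norm (?D x b))"
      by (intro sum_norm_le) (auto intro!: mult_right_mono norm_blinfun[of "c _" v, simplified])
    also have "\<dots> = N x * norm v" by (simp add: N_def sum_distrib_right sum_distrib_left mult_ac)
    also have "\<dots> \<le> (N y0 + 1) * norm v" using r(2) x by (intro mult_right_mono) auto
    finally show "norm (?D x v) \<le> (N y0 + 1) * norm v" .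
  qed (use N0 in simp)
  then have "norm (f x - f y) \<le> (N y0 + 1) * norm (x - y)" if "x \<in> ball y0 r" "y \<in> ball y0 r" for x y
    using that der by (intro differentiable_bound[of "ball y0 r" f ?D]) (auto intro: has_derivative_at_withinI)
  then show ?thesis using that[of r "N y0 + 1"] r N0 by auto
qed

text \<open>On each of the small balls \<open>P\<close> holds everywhere or nowhere. Hence the sets
  where it holds and where it fails are both open in the connected set \<open>J\<close>.\<close>

lemma interval_clopen_induct:
  fixes J :: "real set"
  assumes "open J" "is_interval J" "s \<in> J" "P s" "t \<in> J"
    and "\<And>t. t \<in> J \<Longrightarrow> \<exists>e>0. ball t e \<subseteq> J \<and> ((\<exists>r\<in>ball t e. P r) \<longrightarrow> (\<forall>r\<in>ball t e. P r))"
  shows "P t"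
proof (rule ccontr)
  assume nP: "\<not> P t"
  have 1: "open {t \<in> J. P t}" and 2: "open {t \<in> J. \<not> P t}"
    unfolding open_contains_ball using assms(6) by (fastforce, fastforce)
  have "{t \<in> J. P t} = {} \<or> {t \<in> J. \<not> P t} = {}"
    using connectedD[OF _ 1 2, of J] assms(2) by (auto simp: is_interval_connected_1)
  then show False using assms(3-5) nP by auto
qed

section \<open>Integral curves\<close>

context smooth_atlas
begin

lemma continuous_map_curve_iff:
  assumes "open J"
  shows "continuous_map (top_of_set J) (mtop M) c \<longleftrightarrow>
    (\<forall>t\<in>J. c t \<in> pts M) \<and> (\<forall>W. openin (mtop M) W \<longrightarrow> open {t \<in> J. c t \<in> W})"
  unfolding continuous_map using assms by (auto simp: topspace_mtop openin_open_eq)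

lemma integral_curve_nbhd:
  assumes "open J" "integral_curve M X J c" "openin (mtop M) W" "t \<in> J" "c t \<in> W"
  obtains e where "0 < e" "ball t e \<subseteq> J" "\<And>s. s \<in> ball t e \<Longrightarrow> c s \<in> W"
proof -
  have "open {t \<in> J. c t \<in> W}"
    using assms(2,3) continuous_map_curve_iff[OF assms(1)] by (auto simp: integral_curve_def)
  then obtain e where "0 < e" "ball t e \<subseteq> {t \<in> J. c t \<in> W}" using assms(4,5) openE by blast
  then show ?thesis using that by blast
qed

lemma integral_curve_in: "open J \<Longrightarrow> integral_curve M X J c \<Longrightarrow> t \<in> J \<Longrightarrow> c t \<in> pts M"
  using continuous_map_curve_iff by (auto simp: integral_curve_def)

lemma integral_curve_derivative:
  "integral_curve M X J c \<Longrightarrow> t \<in> J \<Longrightarrow> (U, \<kappa>) \<in> atlas M \<Longrightarrow> c t \<in> U \<Longrightarrow>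
    ((\<kappa> \<circ> c) has_vector_derivative snd (X (c t)) (U, \<kappa>)) (at t)"
  unfolding integral_curve_def charts_at_def by fastforce

lemma integral_curve_subset:
  assumes "integral_curve M X J c" "J' \<subseteq> J"
  shows "integral_curve M X J' c"
  using assms continuous_map_from_subtopology_mono unfolding integral_curve_def by blast

lemma integral_curve_charts:
  assumes "open J" "\<And>W. openin (mtop M) W \<Longrightarrow> open {t \<in> J. c t \<in> W}" "\<And>t. t \<in> J \<Longrightarrow> c t \<in> pts M"
    and "\<And>t U \<kappa>. t \<in> J \<Longrightarrow> (U, \<kappa>) \<in> atlas M \<Longrightarrow> c t \<in> U \<Longrightarrow>
      ((\<kappa> \<circ> c) has_vector_derivative snd (X (c t)) (U, \<kappa>)) (at t)"
  shows "integral_curve M X J c"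
  using assms continuous_map_curve_iff[OF assms(1)] unfolding integral_curve_def charts_at_def by auto

lemma integral_curve_glue:
  assumes "open J1" "open J2" "integral_curve M X J1 c1" "integral_curve M X J2 c2"
    and eq: "\<And>t. t \<in> J1 \<Longrightarrow> t \<in> J2 \<Longrightarrow> c1 t = c2 t"
  shows "integral_curve M X (J1 \<union> J2) (\<lambda>t. if t \<in> J1 then c1 t else c2 t)" (is "integral_curve M X _ ?c")
proof -
  have c1: "?c t = c1 t" if "t \<in> J1" for t using that by simp
  have c2: "?c t = c2 t" if "t \<in> J2" for t using that eq by simp
  have "open {t \<in> J1 \<union> J2. ?c t \<in> W}" if "openin (mtop M) W" for W
  proof -
    have "{t \<in> J1 \<union> J2. ?c t \<in> W} = {t \<in> J1. c1 t \<in> W} \<union> {t \<in> J2. c2 t \<in> W}" by (auto simp: eq)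
    moreover have "open {t \<in> J1. c1 t \<in> W}" "open {t \<in> J2. c2 t \<in> W}"
      using assms(3,4) that continuous_map_curve_iff[OF assms(1)] continuous_map_curve_iff[OF assms(2)]
      by (simp_all add: integral_curve_def)
    ultimately show ?thesis by (metis open_Un)
  qed
  moreover have "?c t \<in> pts M" if "t \<in> J1 \<union> J2" for t
    using that integral_curve_in assms by auto
  moreover have "((\<kappa> \<circ> ?c) has_vector_derivative snd (X (?c t)) (U, \<kappa>)) (at t)"
    if t: "t \<in> J1 \<union> J2" and U: "(U, \<kappa>) \<in> atlas M" "?c t \<in> U" for t U \<kappa>
  proof (cases "t \<in> J1")
    case True
    have "((\<kappa> \<circ> c1) has_vector_derivative snd (X (?c t)) (U, \<kappa>)) (at t)"
      using integral_curve_derivative[OF assms(3) True U(1)] U(2) True by simp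
    then show ?thesis
      by (rule has_vector_derivative_transform_within_open[OF _ assms(1) True]) simp
  next
    case False
    then have t2: "t \<in> J2" using t by simp
    have "((\<kappa> \<circ> c2) has_vector_derivative snd (X (?c t)) (U, \<kappa>)) (at t)"
      using integral_curve_derivative[OF assms(4) t2 U(1)] U(2) False by simp
    then show ?thesis
      by (rule has_vector_derivative_transform_within_open[OF _ assms(2) t2]) (simp add: eq)
  qed
  ultimately show ?thesis
    by (rule integral_curve_charts[OF open_Un[OF assms(1,2)]])
qed

lemma curve_derivative_chart_change:
  assumes v: "v \<in> tangent_space M (c t)" and U: "(U, \<kappa>) \<in> charts_at M (c t)" and V: "(V, \<mu>) \<in> charts_at M (c t)"
    and d: "((\<kappa> \<circ> c) has_vector_derivative v (U, \<kappa>)) (at t)"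
    and N: "open N" "t \<in> N" "\<And>s. s \<in> N \<Longrightarrow> c s \<in> U"
  shows "((\<mu> \<circ> c) has_vector_derivative v (V, \<mu>)) (at t)"
proof -
  have U': "(U, \<kappa>) \<in> atlas M" "c t \<in> U" and V': "(V, \<mu>) \<in> atlas M" "c t \<in> V"
    using U V by (auto simp: charts_at_def)
  let ?t = "\<mu> \<circ> inv_into U \<kappa>"
  have tr: "(?t has_derivative frechet_derivative ?t (at (\<kappa> (c t)))) (at (\<kappa> (c t)))"
    by (rule smooth_on_has_derivative[OF transition_smooth[OF U'(1) V'(1)]]) (use U' V' in auto)
  have "v (V, \<mu>) = frechet_derivative ?t (at (\<kappa> (c t))) (v (U, \<kappa>))"
    using v U V unfolding tangent_space_def by auto
  moreover have "((\<lambda>s. ?t ((\<kappa> \<circ> c) s)) has_derivative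
      (\<lambda>h. frechet_derivative ?t (at (\<kappa> (c t))) (h *\<^sub>R v (U, \<kappa>)))) (at t)"
    by (rule has_derivative_compose[OF d[unfolded has_vector_derivative_def]]) (use tr in \<open>simp add: o_def\<close>)
  ultimately have "((\<lambda>s. ?t ((\<kappa> \<circ> c) s)) has_derivative (\<lambda>h. h *\<^sub>R v (V, \<mu>))) (at t)"
    by (simp only: linear_scale[OF has_derivative_linear[OF tr]])
  then have "((\<lambda>s. ?t ((\<kappa> \<circ> c) s)) has_vector_derivative v (V, \<mu>)) (at t)"
    by (simp add: has_vector_derivative_def)
  then show ?thesis
    by (rule has_vector_derivative_transform_within_open[OF _ N(1,2)]) (use chart_inv[OF U'(1)] N(3) in auto)
qed

text \<open>A single chart at each time suffices. Continuity for the manifold topology is recovered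
  from differentiability in that chart, the other charts from the compatibility of tangent
  vectors.\<close>

lemma integral_curveI:
  assumes "open J" "\<And>t. t \<in> J \<Longrightarrow> snd (X (c t)) \<in> tangent_space M (c t)"
    and "\<And>t. t \<in> J \<Longrightarrow> \<exists>(U, \<kappa>)\<in>atlas M. ((\<kappa> \<circ> c) has_vector_derivative snd (X (c t)) (U, \<kappa>)) (at t) \<and>
      (\<exists>N. open N \<and> t \<in> N \<and> N \<subseteq> J \<and> c ` N \<subseteq> U)"
  shows "integral_curve M X J c"
proof -
  have "open {t \<in> J. c t \<in> W}" if W: "openin (mtop M) W" for W
  proof (subst open_subopen, intro ballI)
    fix t assume "t \<in> {t \<in> J. c t \<in> W}"
    then have t: "t \<in> J" "c t \<in> W" by auto
    from assms(3)[OF t(1)] obtain U \<kappa> N where U: "(U, \<kappa>) \<in> atlas M"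
      "((\<kappa> \<circ> c) has_vector_derivative snd (X (c t)) (U, \<kappa>)) (at t)"
      and N: "open N" "t \<in> N" "N \<subseteq> J" "c ` N \<subseteq> U" by auto
    have "isCont (\<kappa> \<circ> c) t" using U(2) by (rule has_vector_derivative_continuous)
    moreover have "open (\<kappa> ` (U \<inter> W))" by (rule open_chart_image[OF W U(1)])
    moreover have "(\<kappa> \<circ> c) t \<in> \<kappa> ` (U \<inter> W)" using t N by auto
    ultimately obtain A where A: "open A" "t \<in> A" "\<forall>s\<in>A. (\<kappa> \<circ> c) s \<in> \<kappa> ` (U \<inter> W)"
      using continuous_at_open by metis
    \<comment> \<open>Coordinates identify points only inside \<open>U\<close>; the neighbourhood
      \<open>N\<close> keeps the curve there, so that injectivity applies.\<close>
    have "c s \<in> W" if s: "s \<in> A \<inter> N" for s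
    proof -
      obtain x where x: "x \<in> U" "x \<in> W" "\<kappa> (c s) = \<kappa> x" using A(3) s by auto
      then have "c s = x" using chart_inj[OF U(1)] N(4) s by (auto simp: inj_on_def)
      then show ?thesis using x by simp
    qed
    then show "\<exists>T. open T \<and> t \<in> T \<and> T \<subseteq> {t \<in> J. c t \<in> W}"
      using A N by (intro exI[of _ "A \<inter> N"]) auto
  qed
  moreover have "c t \<in> pts M" if t: "t \<in> J" for t
    using assms(3)[OF t] chart_subset by fastforce
  moreover have "((\<mu> \<circ> c) has_vector_derivative snd (X (c t)) (V, \<mu>)) (at t)"
    if t: "t \<in> J" and V: "(V, \<mu>) \<in> atlas M" "c t \<in> V" for t V \<mu>
  proof -
    from assms(3)[OF t] obtain U \<kappa> N where U: "(U, \<kappa>) \<in> atlas M"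
      "((\<kappa> \<circ> c) has_vector_derivative snd (X (c t)) (U, \<kappa>)) (at t)"
      and N: "open N" "t \<in> N" "N \<subseteq> J" "c ` N \<subseteq> U" by auto
    have "(U, \<kappa>) \<in> charts_at M (c t)" "(V, \<mu>) \<in> charts_at M (c t)"
      using U N V by (auto simp: charts_at_def)
    from curve_derivative_chart_change[OF assms(2)[OF t] this U(2) N(1,2)] N(4)
    show ?thesis by auto
  qed
  ultimately show ?thesis
    by (rule integral_curve_charts[OF assms(1)])
qed

end

section \<open>Uniqueness of integral curves in a Hausdorff manifold\<close>

context smooth_mfd
begin

text \<open>Where the curves differ, Hausdorffness keeps them apart on a ball, so the implication is
  vacuous. Where they meet, a Lipschitz bound in a chart and \<open>ode_zero\<close> force them to
  coincide nearby.\<close>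

lemma integral_curve_unique:
  assumes X: "X \<in> vector_fields M" and J: "open J" "is_interval J"
    and c1: "integral_curve M X J c1" and c2: "integral_curve M X J c2"
    and s: "s \<in> J" "c1 s = c2 s" and t: "t \<in> J"
  shows "c1 t = c2 t"
proof (rule interval_clopen_induct[of J s "\<lambda>t. c1 t = c2 t", OF J s t])
  fix t assume t: "t \<in> J"
  show "\<exists>e>0. ball t e \<subseteq> J \<and> ((\<exists>r\<in>ball t e. c1 r = c2 r) \<longrightarrow> (\<forall>r\<in>ball t e. c1 r = c2 r))"
  proof (cases "c1 t = c2 t")
    case False
    then obtain W1 W2 where W: "openin (mtop M) W1" "openin (mtop M) W2" "c1 t \<in> W1" "c2 t \<in> W2" "disjnt W1 W2"
      using Hausdorff integral_curve_in[OF J(1) c1 t] integral_curve_in[OF J(1) c2 t]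
      unfolding Hausdorff_space_def topspace_mtop by metis
    obtain e1 where e1: "0 < e1" "ball t e1 \<subseteq> J" "\<And>s. s \<in> ball t e1 \<Longrightarrow> c1 s \<in> W1"
      using integral_curve_nbhd[OF J(1) c1 W(1) t W(3)] by metis
    obtain e2 where e2: "0 < e2" "ball t e2 \<subseteq> J" "\<And>s. s \<in> ball t e2 \<Longrightarrow> c2 s \<in> W2"
      using integral_curve_nbhd[OF J(1) c2 W(2) t W(4)] by metis
    have "c1 r \<noteq> c2 r" if "r \<in> ball t (min e1 e2)" for r
    proof -
      have "c1 r \<in> W1" "c2 r \<in> W2" using e1(3) e2(3) that by auto
      then show ?thesis using W(5) by (auto simp: disjnt_def)
    qed
    then show ?thesis using e1 e2 by (intro exI[of _ "min e1 e2"]) auto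
  next
    case True
    obtain U \<kappa> where U: "(U, \<kappa>) \<in> atlas M" "c1 t \<in> U"
      using chart_at_ex[OF integral_curve_in[OF J(1) c1 t]] .
    let ?f = "(\<lambda>p. snd (X p) (U, \<kappa>)) \<circ> inv_into U \<kappa>"
    have "smooth_on (\<kappa> ` (U \<inter> U)) ?f" by (rule smooth_fun_onD[OF vector_fieldsD(3)[OF X U(1)] U(1)])
    then have sf: "smooth_on (\<kappa> ` U) ?f" by simp
    obtain \<rho> K where \<rho>: "0 < \<rho>" "ball (\<kappa> (c1 t)) \<rho> \<subseteq> \<kappa> ` U" "0 \<le> K"
      "\<And>x y. x \<in> ball (\<kappa> (c1 t)) \<rho> \<Longrightarrow> y \<in> ball (\<kappa> (c1 t)) \<rho> \<Longrightarrow> norm (?f x - ?f y) \<le> K * norm (x - y)"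
      using smooth_on_locally_lipschitz[OF model_finite_dim chart_open_range[OF U(1)] sf] U(2) by (metis imageI)
    let ?W = "{p \<in> U. \<kappa> p \<in> ball (\<kappa> (c1 t)) \<rho>}"
    have W: "openin (mtop M) ?W" by (rule openin_chart_preimage[OF U(1)]) simp
    obtain e1 where e1: "0 < e1" "ball t e1 \<subseteq> J" "\<And>s. s \<in> ball t e1 \<Longrightarrow> c1 s \<in> ?W"
      using integral_curve_nbhd[OF J(1) c1 W t] U \<rho>(1) by (metis (no_types, lifting) centre_in_ball mem_Collect_eq)
    obtain e2 where e2: "0 < e2" "ball t e2 \<subseteq> J" "\<And>s. s \<in> ball t e2 \<Longrightarrow> c2 s \<in> ?W"
      using integral_curve_nbhd[OF J(1) c2 W t] U \<rho>(1) True by (metis (no_types, lifting) centre_in_ball mem_Collect_eq)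
    \<comment> \<open>Halving \<open>e1\<close> and \<open>e2\<close> puts the closed interval of
      radius \<open>d\<close> inside both open balls. The last entry gives
      \<open>K * d \<le> 1 / 2\<close>; \<open>K + 1\<close> avoids a division by 0.\<close>
    define d where "d = min (min (e1 / 2) (e2 / 2)) (1 / (2 * (K + 1)))"
    have d: "0 < d" "d < e1" "d < e2" using e1(1) e2(1) \<rho>(3) by (auto simp: d_def min_less_iff_disj)
    have "K * d \<le> (K + 1) * (1 / (2 * (K + 1)))"
      using \<rho>(3) d(1) by (intro mult_mono) (auto simp: d_def)
    also have "\<dots> = 1 / 2" using \<rho>(3) by (simp add: field_simps)
    finally have Kd: "K * d \<le> 1 / 2" .
    define u where "u s = (\<kappa> \<circ> c1) s - (\<kappa> \<circ> c2) s" for s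
    have "c1 r = c2 r" if r: "r \<in> ball t d" for r
    proof -
      have "u r = 0"
      proof (rule ode_zero[of t d u "\<lambda>s. snd (X (c1 s)) (U, \<kappa>) - snd (X (c2 s)) (U, \<kappa>)" K])
        fix s assume "s \<in> {t - d..t + d}"
        then have s: "s \<in> ball t e1" "s \<in> ball t e2" using d by (auto simp: dist_real_def)
        note s1 = e1(3)[OF s(1)] and s2 = e2(3)[OF s(2)]
        have sJ: "s \<in> J" using s e1(2) by auto
        show "(u has_vector_derivative snd (X (c1 s)) (U, \<kappa>) - snd (X (c2 s)) (U, \<kappa>)) (at s)"
          unfolding u_def using s1 s2
          by (intro has_vector_derivative_diff integral_curve_derivative[OF c1 sJ U(1)]
              integral_curve_derivative[OF c2 sJ U(1)]) auto
        show "norm (snd (X (c1 s)) (U, \<kappa>) - snd (X (c2 s)) (U, \<kappa>)) \<le> K * norm (u s)"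
          using \<rho>(4)[of "\<kappa> (c1 s)" "\<kappa> (c2 s)"] s1 s2 by (simp add: u_def chart_inv[OF U(1)])
      next
        show "u t = 0" using True by (simp add: u_def)
      qed (use \<rho>(3) Kd r in \<open>auto simp: dist_real_def\<close>)
      then have "\<kappa> (c1 r) = \<kappa> (c2 r)" by (simp add: u_def)
      moreover have "c1 r \<in> U" "c2 r \<in> U" using e1(3)[of r] e2(3)[of r] r d by auto
      ultimately show ?thesis using chart_inj[OF U(1)] by (auto simp: inj_on_def)
    qed
    then show ?thesis using d e1(2) by (intro exI[of _ d]) auto
  qed
qed

lemma reaches_unique:
  assumes X: "X \<in> vector_fields M" and "reaches M X t p y" "reaches M X t p y'"
  shows "y = y'"
proof -
  obtain J c where J: "open J" "is_interval J" "0 \<in> J" "t \<in> J" "integral_curve M X J c" "c 0 = p" "c t = y"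
    using assms(2) unfolding reaches_def by blast
  obtain J' c' where J': "open J'" "is_interval J'" "0 \<in> J'" "t \<in> J'" "integral_curve M X J' c'" "c' 0 = p" "c' t = y'"
    using assms(3) unfolding reaches_def by blast
  have "integral_curve M X (J \<inter> J') c" "integral_curve M X (J \<inter> J') c'"
    by (rule integral_curve_subset[OF J(5)] integral_curve_subset[OF J'(5)]; simp)+
  moreover have "open (J \<inter> J')" "is_interval (J \<inter> J')"
    using open_Int[OF J(1) J'(1)] is_interval_Int[OF J(2) J'(2)] .
  ultimately have "c t = c' t"
    using J J' by (intro integral_curve_unique[OF X, of "J \<inter> J'" c c' 0 t]) simp_all
  then show ?thesis using J(7) J'(7) by simp
qed

lemma flow_eq: "X \<in> vector_fields M \<Longrightarrow> reaches M X t p y \<Longrightarrow> flow M X t p = y"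
  unfolding flow_def by (rule the_equality) (auto dest: reaches_unique)

end

section \<open>Flows of linear vector fields\<close>

context linear_field
begin

lemma openin_tot_preimage:
  assumes W: "openin (mtop M) W"
  shows "openin (mtop (tot M G)) {e \<in> tspace G. bproj G e \<in> W}"
  unfolding tot.openin_mtop
proof safe
  fix C \<omega> assume "(C, \<omega>) \<in> atlas (tot M G)"
  then obtain U \<kappa> V \<psi> where U: "(U, \<kappa>) \<in> atlas M" and V: "(V, \<psi>) \<in> trivs G" and c: "(C, \<omega>) = tot_chart U \<kappa> V \<psi>"
    by (auto simp: atlas_tot)
  have C_eq: "\<omega> = snd (tot_chart U \<kappa> V \<psi>)" "C = {e \<in> tspace G. bproj G e \<in> U \<inter> V}"
    using c by (metis snd_conv, simp add: tot_chart_def)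
  have "{e \<in> tspace G. bproj G e \<in> W} \<inter> C = {e \<in> tspace G. bproj G e \<in> U \<inter> (V \<inter> W)}"
    using C_eq(2) by auto
  then have "\<omega> ` ({e \<in> tspace G. bproj G e \<in> W} \<inter> C) = \<kappa> ` (U \<inter> (V \<inter> W)) \<times> UNIV"
    using tot_chart_image[OF U V, of "U \<inter> (V \<inter> W)"] C_eq(1) by auto
  moreover have "open (\<kappa> ` (U \<inter> (V \<inter> W)))"
    by (intro open_chart_image[OF _ U] openin_Int triv_openin[OF V] W)
  ultimately show "open (\<omega> ` ({e \<in> tspace G. bproj G e \<in> W} \<inter> C))"
    by (simp add: open_Times)
qed (auto simp: pts_tot)

lemma lift_in_fibre:
  "open J \<Longrightarrow> integral_curve (tot M G) \<Xi> J g \<Longrightarrow> t \<in> J \<Longrightarrow> g t \<in> fibre G (bproj G (g t))"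
  using tot.integral_curve_in[of J \<Xi> g t] by (simp add: pts_tot fibre_def)

lemma lift_chart_derivative:
  assumes J: "open J" and g: "integral_curve (tot M G) \<Xi> J g" and t: "t \<in> J"
    and U: "(U, \<kappa>) \<in> atlas M" "bproj G (g t) \<in> U" and V: "(V, \<psi>) \<in> trivs G" "bproj G (g t) \<in> V"
  shows "((\<kappa> \<circ> (bproj G \<circ> g)) has_vector_derivative snd (X (bproj G (g t))) (U, \<kappa>)) (at t)"
    and "((\<psi> \<circ> g) has_vector_derivative snd (snd (\<Xi> (g t)) (tot_chart U \<kappa> V \<psi>))) (at t)"
proof -
  note f = lift_in_fibre[OF J g t]
  have "tot_chart U \<kappa> V \<psi> \<in> charts_at (tot M G) (g t)"
    by (rule tot_chart_at[OF U(1) V(1) f U(2) V(2)])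
  then have "(fst (tot_chart U \<kappa> V \<psi>), snd (tot_chart U \<kappa> V \<psi>)) \<in> atlas (tot M G)"
    "g t \<in> fst (tot_chart U \<kappa> V \<psi>)" by (auto simp: charts_at_def)
  from tot.integral_curve_derivative[OF g t this]
  have d: "((\<lambda>s. (\<kappa> (bproj G (g s)), \<psi> (g s))) has_vector_derivative snd (\<Xi> (g t)) (tot_chart U \<kappa> V \<psi>)) (at t)"
    by (simp add: o_def tot_chart_apply)
  from bounded_linear.has_vector_derivative[OF bounded_linear_fst d]
  show "((\<kappa> \<circ> (bproj G \<circ> g)) has_vector_derivative snd (X (bproj G (g t))) (U, \<kappa>)) (at t)"
    using \<Xi>_base_component[OF U(1) V(1) f U(2) V(2)] by (simp add: o_def)
  from bounded_linear.has_vector_derivative[OF bounded_linear_snd d]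
  show "((\<psi> \<circ> g) has_vector_derivative snd (snd (\<Xi> (g t)) (tot_chart U \<kappa> V \<psi>))) (at t)"
    by (simp add: o_def)
qed

lemma lift_base:
  assumes J: "open J" and g: "integral_curve (tot M G) \<Xi> J g"
  shows "integral_curve M X J (bproj G \<circ> g)"
proof (rule integral_curve_charts[OF J])
  have gt: "g t \<in> tspace G" if "t \<in> J" for t using lift_in_fibre[OF J g that] by (simp add: fibre_def)
  show "open {t \<in> J. (bproj G \<circ> g) t \<in> W}" if "openin (mtop M) W" for W
  proof -
    have "open {t \<in> J. g t \<in> {e \<in> tspace G. bproj G e \<in> W}}"
      using g openin_tot_preimage[OF that] tot.continuous_map_curve_iff[OF J] unfolding integral_curve_def by blast
    moreover have "{t \<in> J. g t \<in> {e \<in> tspace G. bproj G e \<in> W}} = {t \<in> J. (bproj G \<circ> g) t \<in> W}"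
      using gt by auto
    ultimately show ?thesis by simp
  qed
  show "(bproj G \<circ> g) t \<in> pts M" if "t \<in> J" for t using bproj_in gt[OF that] by simp
  fix t U \<kappa> assume t: "t \<in> J" and U: "(U, \<kappa>) \<in> atlas M" "(bproj G \<circ> g) t \<in> U"
  obtain V \<psi> where V: "(V, \<psi>) \<in> trivs G" "bproj G (g t) \<in> V" using triv_at_ex[OF bproj_in[OF gt[OF t]]] .
  show "((\<kappa> \<circ> (bproj G \<circ> g)) has_vector_derivative snd (X ((bproj G \<circ> g) t)) (U, \<kappa>)) (at t)"
    using lift_chart_derivative(1)[OF J g t U(1) _ V] U(2) by simp
qed

text \<open>For a map over an integral curve of \<open>X\<close>, the base component of the equation
  is already satisfied, so only the fibre derivative is to be checked, in one trivialization for
  each time.\<close>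

lemma liftI:
  assumes J: "open J" and c: "integral_curve M X J c" and f: "\<And>t. t \<in> J \<Longrightarrow> g t \<in> fibre G (c t)"
    and d: "\<And>t. t \<in> J \<Longrightarrow> \<exists>U \<kappa> V \<psi>. (U, \<kappa>) \<in> atlas M \<and> (V, \<psi>) \<in> trivs G \<and> c t \<in> U \<and> c t \<in> V \<and>
      ((\<psi> \<circ> g) has_vector_derivative snd (snd (\<Xi> (g t)) (tot_chart U \<kappa> V \<psi>))) (at t)"
  shows "integral_curve (tot M G) \<Xi> J g"
proof (rule tot.integral_curveI[OF J])
  fix t assume t: "t \<in> J"
  have gt: "g s \<in> tspace G" "bproj G (g s) = c s" if "s \<in> J" for s using f[OF that] by (auto simp: fibre_def)
  show "snd (\<Xi> (g t)) \<in> tangent_space (tot M G) (g t)"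
    by (rule tot.vector_fieldsD(2)[OF \<Xi>_vf]) (simp add: pts_tot gt t)
  obtain U \<kappa> V \<psi> where U: "(U, \<kappa>) \<in> atlas M" "c t \<in> U" and V: "(V, \<psi>) \<in> trivs G" "c t \<in> V"
    and dg: "((\<psi> \<circ> g) has_vector_derivative snd (snd (\<Xi> (g t)) (tot_chart U \<kappa> V \<psi>))) (at t)"
    using d[OF t] by blast
  have oW: "openin (mtop M) (U \<inter> V)" by (intro openin_Int chart_openin[OF U(1)] triv_openin[OF V(1)])
  obtain e where e: "0 < e" "ball t e \<subseteq> J" "\<And>s. s \<in> ball t e \<Longrightarrow> c s \<in> U \<inter> V"
    using integral_curve_nbhd[OF J c oW t] U(2) V(2) by blast
  have "((\<kappa> \<circ> c) has_vector_derivative snd (X (c t)) (U, \<kappa>)) (at t)"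
    by (rule integral_curve_derivative[OF c t U])
  then have "((\<lambda>s. (\<kappa> (c s), \<psi> (g s))) has_vector_derivative
      (fst (snd (\<Xi> (g t)) (tot_chart U \<kappa> V \<psi>)), snd (snd (\<Xi> (g t)) (tot_chart U \<kappa> V \<psi>)))) (at t)"
    using dg \<Xi>_base_component[OF U(1) V(1) f[OF t] U(2) V(2)]
      has_vector_derivative_Pair[of "\<kappa> \<circ> c" _ t UNIV "\<psi> \<circ> g"]
    by (simp add: o_def)
  then have "((\<lambda>s. (\<kappa> (c s), \<psi> (g s))) has_vector_derivative snd (\<Xi> (g t)) (tot_chart U \<kappa> V \<psi>)) (at t)"
    by simp
  then have "((snd (tot_chart U \<kappa> V \<psi>) \<circ> g) has_vector_derivative snd (\<Xi> (g t)) (tot_chart U \<kappa> V \<psi>)) (at t)"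
    by (rule has_vector_derivative_transform_within_open[OF _ J t]) (simp add: tot_chart_apply gt)
  moreover have "tot_chart U \<kappa> V \<psi> \<in> atlas (tot M G)" using U V by (auto simp: atlas_tot)
  moreover have "g ` ball t e \<subseteq> fst (tot_chart U \<kappa> V \<psi>)"
  proof safe
    fix s assume s: "s \<in> ball t e"
    then have "s \<in> J" using e(2) by auto
    then show "g s \<in> fst (tot_chart U \<kappa> V \<psi>)" using gt[of s] e(3)[OF s] by (simp add: tot_chart_def)
  qed
  ultimately show "\<exists>(C, \<omega>)\<in>atlas (tot M G). ((\<omega> \<circ> g) has_vector_derivative snd (\<Xi> (g t)) (C, \<omega>)) (at t) \<and>
      (\<exists>N. open N \<and> t \<in> N \<and> N \<subseteq> J \<and> g ` N \<subseteq> C)"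
    using e(1,2)
    by (intro bexI[of _ "tot_chart U \<kappa> V \<psi>"]) (auto simp: split_beta intro!: exI[of _ "ball t e"])
qed

text \<open>The radius \<open>3 * e\<close> leaves room for intervals of radius \<open>2 * e\<close> around every point of
  \<open>ball t e\<close>.\<close>

lemma lift_local_equation:
  assumes J: "open J" and c: "integral_curve M X J c" and t: "t \<in> J"
  obtains U \<kappa> V \<psi> e K and A :: "real \<Rightarrow> 'v \<Rightarrow>\<^sub>L 'v" where
    "(U, \<kappa>) \<in> atlas M" "(V, \<psi>) \<in> trivs G" "0 < e" "ball t (3 * e) \<subseteq> J"
    "\<And>s. s \<in> ball t (3 * e) \<Longrightarrow> c s \<in> U \<and> c s \<in> V" "continuous_on (ball t (3 * e)) A" "0 \<le> K"
    "\<And>s. s \<in> ball t (3 * e) \<Longrightarrow> norm (A s) \<le> K" "K * (2 * e) \<le> 1 / 2"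
    "\<And>s g. s \<in> ball t (3 * e) \<Longrightarrow> g \<in> fibre G (c s) \<Longrightarrow> snd (snd (\<Xi> g) (tot_chart U \<kappa> V \<psi>)) = A s (\<psi> g)"
proof -
  have ct: "c t \<in> pts M" by (rule integral_curve_in[OF J c t])
  obtain U \<kappa> where U: "(U, \<kappa>) \<in> atlas M" "c t \<in> U" using chart_at_ex[OF ct] .
  obtain V \<psi> where V: "(V, \<psi>) \<in> trivs G" "c t \<in> V" using triv_at_ex[OF ct] .
  obtain A0 :: "'a \<Rightarrow> 'v \<Rightarrow>\<^sub>L 'v" where A0: "continuous_on (\<kappa> ` (U \<inter> V)) A0"
    "\<And>x e. x \<in> U \<Longrightarrow> x \<in> V \<Longrightarrow> e \<in> fibre G x \<Longrightarrow> snd (snd (\<Xi> e) (tot_chart U \<kappa> V \<psi>)) = A0 (\<kappa> x) (\<psi> e)"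
    using \<Xi>_fibre_component_linear[OF U(1) V(1)] by metis
  have oW: "openin (mtop M) (U \<inter> V)" by (intro openin_Int chart_openin[OF U(1)] triv_openin[OF V(1)])
  obtain r where r: "0 < r" "ball t r \<subseteq> J" "\<And>s. s \<in> ball t r \<Longrightarrow> c s \<in> U \<inter> V"
    using integral_curve_nbhd[OF J c oW t] U(2) V(2) by blast
  have "continuous_on (ball t r) (\<kappa> \<circ> c)"
  proof (intro continuous_at_imp_continuous_on ballI)
    fix s assume s: "s \<in> ball t r"
    then have "s \<in> J" using r(2) by auto
    from integral_curve_derivative[OF c this U(1)] r(3)[OF s]
    show "isCont (\<kappa> \<circ> c) s" by (blast intro: has_vector_derivative_continuous)
  qed
  then have cA: "continuous_on (ball t r) (\<lambda>s. A0 ((\<kappa> \<circ> c) s))"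
    by (rule continuous_on_compose2[OF A0(1)]) (use r(3) in auto)
  have sub: "cball t (r / 2) \<subseteq> ball t r" using r(1) by (simp add: cball_subset_ball_iff)
  have "bounded ((\<lambda>s. A0 ((\<kappa> \<circ> c) s)) ` cball t (r / 2))"
    by (intro compact_imp_bounded compact_continuous_image continuous_on_subset[OF cA sub]) simp
  then obtain K where K: "0 < K" "\<forall>s\<in>cball t (r / 2). norm (A0 ((\<kappa> \<circ> c) s)) \<le> K"
    unfolding bounded_pos by auto
  \<comment> \<open>With \<open>r / 6\<close> the ball of radius \<open>3 * e\<close> lies in the
    closed ball on which compactness bounded the operators; \<open>1 / (4 * K)\<close> gives the
    smallness condition on intervals of radius \<open>2 * e\<close>.\<close>
  define e where "e = min (r / 6) (1 / (4 * K))"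
  have e: "0 < e" "3 * e \<le> r / 2" using r(1) K(1) by (auto simp: e_def)
  have be: "ball t (3 * e) \<subseteq> cball t (r / 2)" using e(2) by auto
  have "K * (2 * e) \<le> K * (2 * (1 / (4 * K)))" using K(1) by (intro mult_left_mono) (auto simp: e_def)
  then have Ke: "K * (2 * e) \<le> 1 / 2" using K(1) by simp
  show ?thesis
  proof (rule that[OF U(1) V(1) e(1), of "\<lambda>s. A0 ((\<kappa> \<circ> c) s)" K])
    show "ball t (3 * e) \<subseteq> J" using be sub r(2) by blast
    show "continuous_on (ball t (3 * e)) (\<lambda>s. A0 ((\<kappa> \<circ> c) s))"
      by (rule continuous_on_subset[OF cA]) (use be sub in blast)
    fix s assume s: "s \<in> ball t (3 * e)"
    then have "s \<in> ball t r" using be sub by blast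
    then have cs: "c s \<in> U" "c s \<in> V" using r(3)[of s] by auto
    then show "c s \<in> U \<and> c s \<in> V" by simp
    show "norm (A0 ((\<kappa> \<circ> c) s)) \<le> K" using K(2) be s by blast
    show "snd (snd (\<Xi> g) (tot_chart U \<kappa> V \<psi>)) = blinfun_apply (A0 ((\<kappa> \<circ> c) s)) (\<psi> g)" if "g \<in> fibre G (c s)" for g
      using A0(2)[OF cs that] by simp
  qed (use K(1) Ke in auto)
qed

text \<open>Two lifts that agree once have the same projection, by uniqueness in \<open>M\<close>.
  They then run in a common trivialization, where their difference solves a homogeneous linear
  equation, so agreement at any point of a small ball spreads over the ball.\<close>

lemma lift_unique:
  assumes J: "open J" "is_interval J"
    and g1: "integral_curve (tot M G) \<Xi> J g1" and g2: "integral_curve (tot M G) \<Xi> J g2"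
    and s: "s \<in> J" "g1 s = g2 s" and t: "t \<in> J"
  shows "g1 t = g2 t"
proof -
  define c where "c = bproj G \<circ> g1"
  have c: "integral_curve M X J c" unfolding c_def by (rule lift_base[OF J(1) g1])
  have c2: "bproj G (g2 r) = c r" if "r \<in> J" for r
    using integral_curve_unique[OF X_vf J lift_base[OF J(1) g2] c s(1) _ that] s(2) by (simp add: c_def)
  have f: "g1 r \<in> fibre G (c r)" "g2 r \<in> fibre G (c r)" if "r \<in> J" for r
    using lift_in_fibre[OF J(1) g1 that] lift_in_fibre[OF J(1) g2 that] c2[OF that] by (auto simp: c_def)
  show ?thesis
  proof (rule interval_clopen_induct[of J s "\<lambda>t. g1 t = g2 t", OF J s t])
    fix t assume t: "t \<in> J"
    obtain U \<kappa> V \<psi> e K and A :: "real \<Rightarrow> 'v \<Rightarrow>\<^sub>L 'v" where U: "(U, \<kappa>) \<in> atlas M" and V: "(V, \<psi>) \<in> trivs G"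
      and e: "0 < e" "ball t (3 * e) \<subseteq> J" "\<And>s. s \<in> ball t (3 * e) \<Longrightarrow> c s \<in> U \<and> c s \<in> V"
      and K: "0 \<le> K" "\<And>s. s \<in> ball t (3 * e) \<Longrightarrow> norm (A s) \<le> K" "K * (2 * e) \<le> 1 / 2"
      and A: "\<And>s g. s \<in> ball t (3 * e) \<Longrightarrow> g \<in> fibre G (c s) \<Longrightarrow> snd (snd (\<Xi> g) (tot_chart U \<kappa> V \<psi>)) = A s (\<psi> g)"
      using lift_local_equation[OF J(1) c t] by metis
    have "g1 q = g2 q" if r: "r \<in> ball t e" "g1 r = g2 r" and q: "q \<in> ball t e" for r q
    proof -
      define u where "u s = (\<psi> \<circ> g1) s - (\<psi> \<circ> g2) s" for s
      have "u q = 0"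
      \<comment> \<open>The interval is centred at \<open>r\<close>, where the lifts agree, instead
        of \<open>t\<close>; radius \<open>2 * e\<close> reaches every point of
        \<open>ball t e\<close>.\<close>
      proof (rule ode_zero[of r "2 * e" u "\<lambda>s. A s (u s)" K])
        fix s assume "s \<in> {r - 2 * e..r + 2 * e}"
        then have s: "s \<in> ball t (3 * e)" using r(1) by (auto simp: dist_real_def)
        then have sJ: "s \<in> J" using e(2) by auto
        have b: "bproj G (g1 s) = c s" "bproj G (g2 s) = c s" using f[OF sJ] by (auto simp: fibre_def)
        have "(u has_vector_derivative A s (\<psi> (g1 s)) - A s (\<psi> (g2 s))) (at s)"
          unfolding u_def
          using lift_chart_derivative(2)[OF J(1) g1 sJ U _ V] lift_chart_derivative(2)[OF J(1) g2 sJ U _ V]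
            e(3)[OF s] b A[OF s f(1)[OF sJ]] A[OF s f(2)[OF sJ]]
          by (intro has_vector_derivative_diff) (simp_all add: o_def)
        then show "(u has_vector_derivative A s (u s)) (at s)" by (simp add: u_def blinfun.diff_right)
        have "norm (A s (u s)) \<le> norm (A s) * norm (u s)" by (rule norm_blinfun)
        also have "\<dots> \<le> K * norm (u s)" by (rule mult_right_mono[OF K(2)[OF s]]) simp
        finally show "norm (A s (u s)) \<le> K * norm (u s)" .
      next
        show "u r = 0" using r(2) by (simp add: u_def)
        show "q \<in> {r - 2 * e..r + 2 * e}" using r(1) q by (auto simp: dist_real_def)
      qed (use K in auto)
      moreover have q3: "q \<in> ball t (3 * e)" using q e(1) by auto
      then have "q \<in> J" "c q \<in> V" using e(2,3) by auto
      ultimately show ?thesis using triv_eqD[OF V _ f(1) f(2), of q] by (simp add: u_def)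
    qed
    moreover have "ball t e \<subseteq> J" using e(1,2) by (auto simp: subset_iff)
    ultimately show "\<exists>e>0. ball t e \<subseteq> J \<and> ((\<exists>r\<in>ball t e. g1 r = g2 r) \<longrightarrow> (\<forall>r\<in>ball t e. g1 r = g2 r))"
      using e(1) by blast
  qed
qed

end

section \<open>Existence of lifts and the flow, over a complete model fibre\<close>

locale banach_linear_field = linear_field M G X D \<Xi>
  for M :: "('p, 'a::real_normed_vector) manifold" and G :: "('p, 'e, 'v::banach) vbundle" and X D \<Xi>
begin

text \<open>Propagates along the base curve the existence of a lift on some interval containing 0
  and \<open>t\<close>. Asking for a subinterval of \<open>J\<close>, not all of \<open>J\<close>,
  is what makes the property extendable by gluing.\<close>

lemma lift_exists:
  assumes J: "open J" "is_interval J" "0 \<in> J" and c: "integral_curve M X J c"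
    and g0: "g0 \<in> fibre G (c 0)" and t: "t \<in> J"
  shows "\<exists>J' g. open J' \<and> is_interval J' \<and> 0 \<in> J' \<and> t \<in> J' \<and> J' \<subseteq> J \<and> integral_curve (tot M G) \<Xi> J' g \<and>
    (\<forall>s\<in>J'. bproj G (g s) = c s) \<and> g 0 = g0" (is "?P t")
proof -
  \<comment> \<open>The radius depends on \<open>t\<close> alone: the same ball serves for every
    starting time \<open>r\<close> in it and every initial vector \<open>h\<close>. For a nonlinear
    field it would shrink with the vector.\<close>
  have step: "\<exists>e>0. ball t e \<subseteq> J \<and> (\<forall>r\<in>ball t e. \<forall>h\<in>fibre G (c r).
      \<exists>g. integral_curve (tot M G) \<Xi> (ball t e) g \<and> (\<forall>s\<in>ball t e. bproj G (g s) = c s) \<and> g r = h)"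
    if t: "t \<in> J" for t
  proof -
    obtain U \<kappa> V \<psi> e K and A :: "real \<Rightarrow> 'v \<Rightarrow>\<^sub>L 'v" where U: "(U, \<kappa>) \<in> atlas M" and V: "(V, \<psi>) \<in> trivs G"
      and e: "0 < e" "ball t (3 * e) \<subseteq> J" "\<And>s. s \<in> ball t (3 * e) \<Longrightarrow> c s \<in> U \<and> c s \<in> V"
      and cA: "continuous_on (ball t (3 * e)) A"
      and K: "0 \<le> K" "\<And>s. s \<in> ball t (3 * e) \<Longrightarrow> norm (A s) \<le> K" "K * (2 * e) \<le> 1 / 2"
      and A: "\<And>s g. s \<in> ball t (3 * e) \<Longrightarrow> g \<in> fibre G (c s) \<Longrightarrow> snd (snd (\<Xi> g) (tot_chart U \<kappa> V \<psi>)) = A s (\<psi> g)"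
      using lift_local_equation[OF J(1) c t] by metis
    have bJ: "ball t e \<subseteq> J" and b3: "ball t e \<subseteq> ball t (3 * e)" using e(1,2) by (auto simp: subset_iff)
    have "\<exists>g. integral_curve (tot M G) \<Xi> (ball t e) g \<and> (\<forall>s\<in>ball t e. bproj G (g s) = c s) \<and> g r = h"
      if r: "r \<in> ball t e" and h: "h \<in> fibre G (c r)" for r h
    proof -
      have sub: "{r - 2 * e..r + 2 * e} \<subseteq> ball t (3 * e)" using r by (auto simp: dist_real_def)
      obtain y where y: "y r = \<psi> h"
        "\<And>s. s \<in> {r - 2 * e<..<r + 2 * e} \<Longrightarrow> (y has_vector_derivative A s (y s)) (at s)"
      proof (rule linear_ode_exists)
        show "0 < 2 * e" using e(1) by simp
        show "norm (A s) \<le> K" if "s \<in> {r - 2 * e..r + 2 * e}" for s by (rule K(2)[OF subsetD[OF sub that]])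
      qed (use K(3) continuous_on_subset[OF cA sub] that in blast)+
      define g where "g s = triv_inv G \<psi> (c s) (y s)" for s
      have cs: "c s \<in> U" "c s \<in> V" if "s \<in> ball t e" for s using e(3)[of s] b3 that by auto
      have gf: "g s \<in> fibre G (c s)" if "s \<in> ball t e" for s
        unfolding g_def by (rule triv_inv_in[OF V cs(2)[OF that]])
      have \<psi>g: "\<psi> (g s) = y s" if "s \<in> ball t e" for s
        unfolding g_def by (rule triv_triv_inv[OF V cs(2)[OF that]])
      have "integral_curve (tot M G) \<Xi> (ball t e) g"
      proof (rule liftI[OF open_ball integral_curve_subset[OF c bJ] gf])
        fix s assume s: "s \<in> ball t e"
        have "s \<in> {r - 2 * e<..<r + 2 * e}" using s r by (auto simp: dist_real_def)
        from y(2)[OF this] have "((\<psi> \<circ> g) has_vector_derivative A s (\<psi> (g s))) (at s)"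
          unfolding \<psi>g[OF s]
          by (rule has_vector_derivative_transform_within_open[OF _ open_ball s]) (simp add: \<psi>g)
        then show "\<exists>U \<kappa> V \<psi>. (U, \<kappa>) \<in> atlas M \<and> (V, \<psi>) \<in> trivs G \<and> c s \<in> U \<and> c s \<in> V \<and>
            ((\<psi> \<circ> g) has_vector_derivative snd (snd (\<Xi> (g s)) (tot_chart U \<kappa> V \<psi>))) (at s)"
          using U V cs[OF s] A[OF subsetD[OF b3 s] gf[OF s]] by metis
      qed
      moreover have "g r = h" unfolding g_def y(1) by (rule triv_inv_triv[OF V cs(2)[OF r] h])
      ultimately show ?thesis using gf by (auto simp: fibre_def)
    qed
    then show ?thesis using e(1) bJ by blast
  qed
  have P0: "?P 0"
  proof -
    obtain e where e: "e > 0" "ball 0 e \<subseteq> J" "\<forall>r\<in>ball 0 e. \<forall>h\<in>fibre G (c r).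
      \<exists>g. integral_curve (tot M G) \<Xi> (ball 0 e) g \<and> (\<forall>s\<in>ball 0 e. bproj G (g s) = c s) \<and> g r = h"
      using step[OF J(3)] by blast
    then obtain g where g: "integral_curve (tot M G) \<Xi> (ball 0 e) g" "\<forall>s\<in>ball 0 e. bproj G (g s) = c s" "g 0 = g0"
      using g0 by (meson centre_in_ball)
    then show ?thesis
      using e(1,2) by (intro exI[of _ "ball 0 e"] exI[of _ g]) (simp add: is_interval_ball_real)
  qed
  show ?thesis
  proof (rule interval_clopen_induct[of J 0 ?P, OF J P0 t])
    fix t assume "t \<in> J"
    from step[OF this] obtain e where e: "e > 0" "ball t e \<subseteq> J" "\<forall>r\<in>ball t e. \<forall>h\<in>fibre G (c r).
      \<exists>g. integral_curve (tot M G) \<Xi> (ball t e) g \<and> (\<forall>s\<in>ball t e. bproj G (g s) = c s) \<and> g r = h"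
      by blast
    have "?P q" if r: "r \<in> ball t e" "?P r" and q: "q \<in> ball t e" for r q
    proof -
      from r(2) obtain J' g where J': "open J'" "is_interval J'" "0 \<in> J'" "r \<in> J'" "J' \<subseteq> J"
        and g: "integral_curve (tot M G) \<Xi> J' g" "\<forall>s\<in>J'. bproj G (g s) = c s" "g 0 = g0" by blast
      have "g r \<in> fibre G (c r)" using lift_in_fibre[OF J'(1) g(1) J'(4)] g(2) J'(4) by simp
      from bspec[OF bspec[OF e(3) r(1)] this] obtain g' where g': "integral_curve (tot M G) \<Xi> (ball t e) g'"
        "\<forall>s\<in>ball t e. bproj G (g' s) = c s" "g' r = g r" by blast
      let ?I = "J' \<inter> ball t e"
      have I: "open ?I" "is_interval ?I"
        using open_Int[OF J'(1) open_ball] is_interval_Int[OF J'(2) is_interval_ball_real] .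
      have "integral_curve (tot M G) \<Xi> ?I g" "integral_curve (tot M G) \<Xi> ?I g'"
        by (rule tot.integral_curve_subset[OF g(1)] tot.integral_curve_subset[OF g'(1)]; simp)+
      \<comment> \<open>Both lifts take the same value at \<open>r\<close>, so they agree on the
        whole overlap, which is an interval, and may be glued.\<close>
      then have eq: "g s = g' s" if "s \<in> J'" "s \<in> ball t e" for s
        using lift_unique[OF I, of g g' r s] that J'(4) r(1) g'(3) by simp
      let ?h = "\<lambda>s. if s \<in> J' then g s else g' s"
      have "integral_curve (tot M G) \<Xi> (J' \<union> ball t e) ?h"
        by (rule tot.integral_curve_glue[OF J'(1) open_ball g(1) g'(1) eq])
      moreover have "is_interval (J' \<union> ball t e)"
        using connected_Un[of J' "ball t e"] J'(2,4) r(1) is_interval_ball_real[of t e]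
        unfolding is_interval_connected_1 by blast
      moreover have "\<forall>s\<in>J' \<union> ball t e. bproj G (?h s) = c s" using g(2) g'(2) by auto
      ultimately show "?P q"
        using J' g(3) e(2) q open_Un[OF J'(1) open_ball[of t e]]
        by (intro exI[of _ "J' \<union> ball t e"] exI[of _ ?h]) simp
    qed
    then show "\<exists>e>0. ball t e \<subseteq> J \<and> ((\<exists>r\<in>ball t e. ?P r) \<longrightarrow> (\<forall>r\<in>ball t e. ?P r))"
      using e(1,2) by blast
  qed
qed

lemma reaches_tot_unique:
  assumes "reaches (tot M G) \<Xi> t g h" "reaches (tot M G) \<Xi> t g h'"
  shows "h = h'"
proof -
  obtain J c where J: "open J" "is_interval J" "0 \<in> J" "t \<in> J" "integral_curve (tot M G) \<Xi> J c" "c 0 = g" "c t = h"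
    using assms(1) unfolding reaches_def by blast
  obtain J' c' where J': "open J'" "is_interval J'" "0 \<in> J'" "t \<in> J'" "integral_curve (tot M G) \<Xi> J' c'" "c' 0 = g" "c' t = h'"
    using assms(2) unfolding reaches_def by blast
  have "integral_curve (tot M G) \<Xi> (J \<inter> J') c" "integral_curve (tot M G) \<Xi> (J \<inter> J') c'"
    by (rule tot.integral_curve_subset[OF J(5)] tot.integral_curve_subset[OF J'(5)]; simp)+
  moreover have "open (J \<inter> J')" "is_interval (J \<inter> J')"
    using open_Int[OF J(1) J'(1)] is_interval_Int[OF J(2) J'(2)] .
  ultimately have "c t = c' t"
    using J J' by (intro lift_unique[of "J \<inter> J'" c c' 0 t]) simp_all
  then show ?thesis using J(7) J'(7) by simp
qed

lemma flow_tot_eq: "reaches (tot M G) \<Xi> t g h \<Longrightarrow> flow (tot M G) \<Xi> t g = h"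
  unfolding flow_def by (rule the_equality) (auto dest: reaches_tot_unique)

lemma reaches_base:
  assumes "reaches (tot M G) \<Xi> t g h"
  shows "reaches M X t (bproj G g) (bproj G h)"
proof -
  obtain J c where J: "open J" "is_interval J" "0 \<in> J" "t \<in> J" "integral_curve (tot M G) \<Xi> J c" "c 0 = g" "c t = h"
    using assms unfolding reaches_def by blast
  then show ?thesis unfolding reaches_def
    using lift_base[OF J(1,5)] by (intro exI[of _ J] exI[of _ "bproj G \<circ> c"]) simp
qed

lemma reaches_tspace: "reaches (tot M G) \<Xi> t g h \<Longrightarrow> h \<in> tspace G"
  unfolding reaches_def using tot.integral_curve_in pts_tot by blast

lemma reaches_tot_ex:
  assumes "(t, bproj G g) \<in> flow_dom M X" "g \<in> tspace G"
  shows "\<exists>h. reaches (tot M G) \<Xi> t g h"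
proof -
  obtain y where "reaches M X t (bproj G g) y" using assms(1) by (auto simp: flow_dom_def)
  then obtain J c where J: "open J" "is_interval J" "0 \<in> J" "t \<in> J" "integral_curve M X J c" "c 0 = bproj G g"
    unfolding reaches_def by blast
  have "g \<in> fibre G (c 0)" using assms(2) J(6) by (simp add: fibre_def)
  from lift_exists[OF J(1-3,5) this J(4)] show ?thesis unfolding reaches_def by blast
qed

text \<open>Projecting integral curves gives one inclusion, lifting the base curve through the given
  vector the other.\<close>

lemma flow_dom_tot: "flow_dom (tot M G) \<Xi> = {(t, g). g \<in> tspace G \<and> (t, bproj G g) \<in> flow_dom M X}"
proof -
  have "(t, bproj G g) \<in> flow_dom M X" if "reaches (tot M G) \<Xi> t g h" "g \<in> tspace G" for t g h
    using reaches_base[OF that(1)] bproj_in[OF that(2)] by (auto simp: flow_dom_def)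
  moreover have "(t, g) \<in> flow_dom (tot M G) \<Xi>" if "(t, bproj G g) \<in> flow_dom M X" "g \<in> tspace G" for t g
    using reaches_tot_ex[OF that] that(2) by (auto simp: flow_dom_def pts_tot)
  ultimately show ?thesis by (auto simp: flow_dom_def[of "tot M G"] pts_tot)
qed

lemma reaches_flow: "(t, g) \<in> flow_dom (tot M G) \<Xi> \<Longrightarrow> reaches (tot M G) \<Xi> t g (flow (tot M G) \<Xi> t g)"
  unfolding flow_dom_def using flow_tot_eq by auto

lemma flow_in_fibre:
  assumes "(t, x) \<in> flow_dom M X" "g \<in> fibre G x"
  shows "flow (tot M G) \<Xi> t g \<in> fibre G (flow M X t x)"
proof -
  have g: "g \<in> tspace G" "bproj G g = x" using assms(2) by (auto simp: fibre_def)
  have r: "reaches (tot M G) \<Xi> t g (flow (tot M G) \<Xi> t g)"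
    by (rule reaches_flow) (use g assms(1) in \<open>simp add: flow_dom_tot\<close>)
  then show ?thesis
    using flow_eq[OF X_vf reaches_base[OF r]] reaches_tspace[OF r] g(2) by (simp add: fibre_def)
qed

section \<open>Fibrewise linearity of the flow\<close>

lemma reaches_scale:
  assumes g: "g \<in> tspace G" and h: "reaches (tot M G) \<Xi> t g h"
  shows "reaches (tot M G) \<Xi> t (fscale G r g) (fscale G r h)"
proof -
  obtain J c where J: "open J" "is_interval J" "0 \<in> J" "t \<in> J" and c: "integral_curve (tot M G) \<Xi> J c" "c 0 = g" "c t = h"
    using h unfolding reaches_def by blast
  let ?b = "bproj G \<circ> c"
  note b = lift_base[OF J(1) c(1)] and f = lift_in_fibre[OF J(1) c(1)]
  have bp: "bproj G (c s) \<in> pts M" if "s \<in> J" for s using integral_curve_in[OF J(1) b that] by simp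
  have "integral_curve (tot M G) \<Xi> J (\<lambda>s. fscale G r (c s))"
  proof (rule liftI[OF J(1) b])
    fix s assume s: "s \<in> J"
    show "fscale G r (c s) \<in> fibre G (?b s)" using fscale_in[OF bp[OF s] f[OF s]] by simp
    obtain U \<kappa> where U: "(U, \<kappa>) \<in> atlas M" "?b s \<in> U" using chart_at_ex[OF bp[OF s]] by auto
    obtain V \<psi> where V: "(V, \<psi>) \<in> trivs G" "?b s \<in> V" using triv_at_ex[OF bp[OF s]] by auto
    obtain e where e: "0 < e" "ball s e \<subseteq> J" "\<And>q. q \<in> ball s e \<Longrightarrow> ?b q \<in> V"
      using integral_curve_nbhd[OF J(1) b triv_openin[OF V(1)] s V(2)] by blast
    have "((\<psi> \<circ> c) has_vector_derivative snd (snd (\<Xi> (c s)) (tot_chart U \<kappa> V \<psi>))) (at s)"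
      using lift_chart_derivative(2)[OF J(1) c(1) s U(1) _ V(1)] U(2) V(2) by simp
    from bounded_linear.has_vector_derivative[OF bounded_linear_scaleR_right this, of r]
    have "((\<psi> \<circ> (\<lambda>s. fscale G r (c s))) has_vector_derivative r *\<^sub>R snd (snd (\<Xi> (c s)) (tot_chart U \<kappa> V \<psi>))) (at s)"
    proof (rule has_vector_derivative_transform_within_open[OF _ open_ball])
      show "s \<in> ball s e" using e(1) by simp
      fix q assume q: "q \<in> ball s e"
      then have "q \<in> J" using e(2) by auto
      from triv_scale[OF V(1) _ f[OF this]] e(3)[OF q]
      show "r *\<^sub>R (\<psi> \<circ> c) q = (\<psi> \<circ> (\<lambda>s. fscale G r (c s))) q" by simp
    qed
    then show "\<exists>U \<kappa> V \<psi>. (U, \<kappa>) \<in> atlas M \<and> (V, \<psi>) \<in> trivs G \<and> ?b s \<in> U \<and> ?b s \<in> V \<and>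
        ((\<psi> \<circ> (\<lambda>s. fscale G r (c s))) has_vector_derivative snd (snd (\<Xi> (fscale G r (c s))) (tot_chart U \<kappa> V \<psi>))) (at s)"
      using \<Xi>_fibre_component_scale[OF U(1) V(1) f[OF s], of r] U V
      by (intro exI[of _ U] exI[of _ \<kappa>] exI[of _ V] exI[of _ \<psi>]) simp
  qed
  then show ?thesis unfolding reaches_def
    using J c by (intro exI[of _ J] exI[of _ "\<lambda>s. fscale G r (c s)"]) simp
qed

text \<open>The vertical part of \<open>\<Xi>\<close> is additive in the fibre, so the pointwise sum
  of two lifts of one base curve is a lift. The two curves are first cut down to a common
  interval.\<close>

lemma reaches_add:
  assumes "bproj G g = bproj G g'" and h: "reaches (tot M G) \<Xi> t g h" and h': "reaches (tot M G) \<Xi> t g' h'"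
  shows "reaches (tot M G) \<Xi> t (fadd G g g') (fadd G h h')"
proof -
  obtain I c where I: "open I" "is_interval I" "0 \<in> I" "t \<in> I" and c: "integral_curve (tot M G) \<Xi> I c" "c 0 = g" "c t = h"
    using h unfolding reaches_def by blast
  obtain I' c' where I': "open I'" "is_interval I'" "0 \<in> I'" "t \<in> I'" and c': "integral_curve (tot M G) \<Xi> I' c'" "c' 0 = g'" "c' t = h'"
    using h' unfolding reaches_def by blast
  define J where "J = I \<inter> I'"
  have J: "open J" "is_interval J" "0 \<in> J" "t \<in> J"
    using I I' is_interval_Int by (auto simp: J_def)
  have cJ: "integral_curve (tot M G) \<Xi> J c" "integral_curve (tot M G) \<Xi> J c'"
    unfolding J_def by (rule tot.integral_curve_subset[OF c(1)] tot.integral_curve_subset[OF c'(1)]; simp)+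
  let ?b = "bproj G \<circ> c"
  note b = lift_base[OF J(1) cJ(1)]
  \<comment> \<open>The projections start at the same point and hence agree; otherwise the sum of
    the two curves would not be defined fibrewise.\<close>
  have b': "bproj G (c' s) = bproj G (c s)" if "s \<in> J" for s
    using integral_curve_unique[OF X_vf J(1,2) lift_base[OF J(1) cJ(2)] b J(3) _ that] assms(1) c(2) c'(2) by simp
  have f: "c s \<in> fibre G (?b s)" "c' s \<in> fibre G (?b s)" if "s \<in> J" for s
    using lift_in_fibre[OF J(1) cJ(1) that] lift_in_fibre[OF J(1) cJ(2) that] b'[OF that] by auto
  have bp: "?b s \<in> pts M" if "s \<in> J" for s using integral_curve_in[OF J(1) b that] .
  have "integral_curve (tot M G) \<Xi> J (\<lambda>s. fadd G (c s) (c' s))"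
  proof (rule liftI[OF J(1) b])
    fix s assume s: "s \<in> J"
    show "fadd G (c s) (c' s) \<in> fibre G (?b s)" by (rule fadd_in[OF bp[OF s] f[OF s]])
    obtain U \<kappa> where U: "(U, \<kappa>) \<in> atlas M" "?b s \<in> U" using chart_at_ex[OF bp[OF s]] .
    obtain V \<psi> where V: "(V, \<psi>) \<in> trivs G" "?b s \<in> V" using triv_at_ex[OF bp[OF s]] .
    obtain e where e: "0 < e" "ball s e \<subseteq> J" "\<And>q. q \<in> ball s e \<Longrightarrow> ?b q \<in> V"
      using integral_curve_nbhd[OF J(1) b triv_openin[OF V(1)] s V(2)] by blast
    have "((\<psi> \<circ> c) has_vector_derivative snd (snd (\<Xi> (c s)) (tot_chart U \<kappa> V \<psi>))) (at s)"
      "((\<psi> \<circ> c') has_vector_derivative snd (snd (\<Xi> (c' s)) (tot_chart U \<kappa> V \<psi>))) (at s)"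
      using lift_chart_derivative(2)[OF J(1) cJ(1) s U(1) _ V(1)] lift_chart_derivative(2)[OF J(1) cJ(2) s U(1) _ V(1)]
        U(2) V(2) b'[OF s] by simp_all
    from has_vector_derivative_add[OF this]
    have "((\<psi> \<circ> (\<lambda>s. fadd G (c s) (c' s))) has_vector_derivative
        snd (snd (\<Xi> (c s)) (tot_chart U \<kappa> V \<psi>)) + snd (snd (\<Xi> (c' s)) (tot_chart U \<kappa> V \<psi>))) (at s)"
    proof (rule has_vector_derivative_transform_within_open[OF _ open_ball])
      show "s \<in> ball s e" using e(1) by simp
      fix q assume q: "q \<in> ball s e"
      then have "q \<in> J" using e(2) by auto
      from triv_add[OF V(1) e(3)[OF q] f[OF this]]
      show "(\<psi> \<circ> c) q + (\<psi> \<circ> c') q = (\<psi> \<circ> (\<lambda>s. fadd G (c s) (c' s))) q" by simp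
    qed
    then show "\<exists>U \<kappa> V \<psi>. (U, \<kappa>) \<in> atlas M \<and> (V, \<psi>) \<in> trivs G \<and> ?b s \<in> U \<and> ?b s \<in> V \<and>
        ((\<psi> \<circ> (\<lambda>s. fadd G (c s) (c' s))) has_vector_derivative
          snd (snd (\<Xi> (fadd G (c s) (c' s))) (tot_chart U \<kappa> V \<psi>))) (at s)"
      using \<Xi>_fibre_component_add[OF U(1) V(1) f[OF s] U(2) V(2)] U V
      by (intro exI[of _ U] exI[of _ \<kappa>] exI[of _ V] exI[of _ \<psi>]) simp
  qed
  then show ?thesis unfolding reaches_def
    using J c c' by (intro exI[of _ J] exI[of _ "\<lambda>s. fadd G (c s) (c' s)"]) simp
qed

end

section \<open>Tensor products of flows\<close>

locale tensor_fields = bundle_pair M E F + LE: banach_linear_field M E X D\<^sub>E \<Xi>\<^sub>E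
    + LF: banach_linear_field M F X D\<^sub>F \<Xi>\<^sub>F + LT: banach_linear_field M "tensor_bundle M E F" X D \<Xi>
  for M :: "('p, 'a::real_normed_vector) manifold"
    and E :: "('p, 'e, 'v::banach) vbundle" and F :: "('p, 'f, 'w::banach) vbundle"
    and X D\<^sub>E D\<^sub>F D \<Xi>\<^sub>E \<Xi>\<^sub>F \<Xi> +
  assumes leibniz: "e \<in> sections M E \<Longrightarrow> f \<in> sections M F \<Longrightarrow> D (sec_tensor M E F e f) =
    sec_add M (tensor_bundle M E F) (sec_tensor M E F (D\<^sub>E e) f) (sec_tensor M E F e (D\<^sub>F f))"
begin

lemma tensor_fibre: "x \<in> pts M \<Longrightarrow> e \<in> fibre E x \<Longrightarrow> f \<in> fibre F x \<Longrightarrow> tensor E F e f \<in> fibre T x"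
  using tensor_in E.triv_at_ex F.triv_at_ex by metis

lemma tens_triv_sec_tensor:
  assumes V: "(V, \<psi>) \<in> trivs E" "x \<in> V" and V': "(V', \<theta>) \<in> trivs F" "x \<in> V'"
    and e: "e \<in> sections M E" and f: "f \<in> sections M F"
  shows "tens_triv \<psi> \<theta> (sec_tensor M E F e f x) = tens (\<psi> (e x)) (\<theta> (f x))"
proof -
  have x: "x \<in> pts M" using E.triv_subset[OF V(1)] V(2) by auto
  then show ?thesis
    using tens_triv_tensor[OF V V' E.section_in[OF e x] F.section_in[OF f x]] by (simp add: sec_tensor_def)
qed

lemma sec_tensor_in:
  assumes e: "e \<in> sections M E" and f: "f \<in> sections M F"
  shows "sec_tensor M E F e f \<in> sections M T"
proof (rule LT.sectionsI)
  show "sec_tensor M E F e f x \<in> fibre T x" if x: "x \<in> pts M" for x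
    using tensor_fibre[OF x E.section_in[OF e x] F.section_in[OF f x]] x by (simp add: sec_tensor_def)
  fix W \<tau> assume "(W, \<tau>) \<in> trivs T"
  then obtain V \<psi> V' \<theta> where V: "(V, \<psi>) \<in> trivs E" and V': "(V', \<theta>) \<in> trivs F"
    and W: "W = V \<inter> V'" "\<tau> = tens_triv \<psi> \<theta>" by (auto simp: trivs_tensor)
  have o: "openin (mtop M) (V \<inter> V')" by (intro openin_Int E.triv_openin[OF V] F.triv_openin[OF V'])
  have "smooth_fun_on M (V \<inter> V') (\<lambda>x. tens (\<psi> (e x)) (\<theta> (f x)))"
    by (intro E.smooth_fun_on_bilinear[OF bounded_bilinear_tens o]
        E.smooth_fun_on_subset[OF E.section_smooth[OF e V]] E.smooth_fun_on_subset[OF F.section_smooth[OF f V']]) auto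
  then show "smooth_fun_on M W (\<lambda>x. \<tau> (sec_tensor M E F e f x))"
    unfolding W by (rule E.smooth_fun_on_cong[OF o, rotated]) (simp add: tens_triv_sec_tensor[OF V _ V' _ e f])
qed (simp add: sec_tensor_def)

text \<open>The infinitesimal form of the theorem: on elementary tensors the vertical part obeys the
  product rule. It is read off at the value of a tensor product of global sections, where the
  Leibniz rule for \<open>D\<close> is available.\<close>

lemma \<Xi>_tensor:
  assumes U: "(U, \<kappa>) \<in> atlas M" "x \<in> U" and V: "(V, \<psi>) \<in> trivs E" "x \<in> V" and V': "(V', \<theta>) \<in> trivs F" "x \<in> V'"
    and e: "e \<in> fibre E x" and f: "f \<in> fibre F x"
  shows "snd (snd (\<Xi> (tensor E F e f)) (LT.tot_chart U \<kappa> (V \<inter> V') (tens_triv \<psi> \<theta>)))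
    = tens (\<psi> e) (snd (snd (\<Xi>\<^sub>F f) (F.tot_chart U \<kappa> V' \<theta>))) + tens (snd (snd (\<Xi>\<^sub>E e) (E.tot_chart U \<kappa> V \<psi>))) (\<theta> f)"
proof -
  have x: "x \<in> pts M" using E.triv_subset[OF V(1)] V(2) by auto
  have chM: "(U, \<kappa>) \<in> charts_at M x" using U by (simp add: charts_at_def)
  have VT: "(V \<inter> V', tens_triv \<psi> \<theta>) \<in> trivs T" "x \<in> V \<inter> V'" using V V' by (auto simp: trivs_tensor)
  obtain s where s: "s \<in> sections M E" "s x = e" using E.section_through[OF x e] .
  obtain t where t: "t \<in> sections M F" "t x = f" using F.section_through[OF x f] .
  let ?st = "sec_tensor M E F s t"
  note st = sec_tensor_in[OF s(1) t(1)]
  have st_x: "?st x = tensor E F e f" using x s t by (simp add: sec_tensor_def)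
  let ?s = "(\<lambda>x. \<psi> (s x)) \<circ> inv_into U \<kappa>" and ?t = "(\<lambda>x. \<theta> (t x)) \<circ> inv_into U \<kappa>"
  let ?ds = "frechet_derivative ?s (at (\<kappa> x))" and ?dt = "frechet_derivative ?t (at (\<kappa> x))"
  have ds: "(?s has_derivative ?ds) (at (\<kappa> x))" and dt: "(?t has_derivative ?dt) (at (\<kappa> x))"
    by (rule E.smooth_fun_on_has_derivative[OF E.section_smooth[OF s(1) V(1)] chM V(2)],
        rule E.smooth_fun_on_has_derivative[OF F.section_smooth[OF t(1) V'(1)] chM V'(2)])
  have oW: "openin (mtop M) (V \<inter> V')" by (intro openin_Int E.triv_openin[OF V(1)] F.triv_openin[OF V'(1)])
  have "((\<lambda>y. tens (?s y) (?t y)) has_derivative (\<lambda>h. tens (?s (\<kappa> x)) (?dt h) + tens (?ds h) (?t (\<kappa> x)))) (at (\<kappa> x))"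
    by (rule bounded_bilinear.FDERIV[OF bounded_bilinear_tens ds dt])
  then have "((\<lambda>x. tens_triv \<psi> \<theta> (?st x)) \<circ> inv_into U \<kappa> has_derivative
      (\<lambda>h. tens (?s (\<kappa> x)) (?dt h) + tens (?ds h) (?t (\<kappa> x)))) (at (\<kappa> x))"
  proof (rule has_derivative_transform_within_open[OF _ E.open_chart_image[OF oW U(1)]])
    show "\<kappa> x \<in> \<kappa> ` (U \<inter> (V \<inter> V'))" using U(2) VT(2) by auto
    fix y assume "y \<in> \<kappa> ` (U \<inter> (V \<inter> V'))"
    then obtain z where z: "y = \<kappa> z" "z \<in> U" "z \<in> V" "z \<in> V'" by auto
    then show "tens (?s y) (?t y) = ((\<lambda>x. tens_triv \<psi> \<theta> (?st x)) \<circ> inv_into U \<kappa>) y"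
      by (simp add: E.chart_inv[OF U(1)] tens_triv_sec_tensor[OF V(1) _ V'(1) _ s(1) t(1)])
  qed
  note dst = frechet_derivative_at[OF this, symmetric]
  let ?X = "snd (X x) (U, \<kappa>)"
  \<comment> \<open>The Leibniz rule for \<open>D\<close> contributes two terms that pair with the
    two terms of the coordinate derivative. Each pair combines, by bilinearity of
    \<open>tens\<close>, to the vertical part in one factor tensored with the other vector.\<close>
  have "tens_triv \<psi> \<theta> (D ?st x) = tens (\<psi> (D\<^sub>E s x)) (\<theta> f) + tens (\<psi> e) (\<theta> (D\<^sub>F t x))"
    unfolding leibniz[OF s(1) t(1)]
    using LT.triv_sec_add[OF sec_tensor_in[OF LE.D_in[OF s(1)] t(1)] sec_tensor_in[OF s(1) LF.D_in[OF t(1)]] VT]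
      tens_triv_sec_tensor[OF V V' LE.D_in[OF s(1)] t(1)] tens_triv_sec_tensor[OF V V' s(1) LF.D_in[OF t(1)]]
    by (simp add: s(2) t(2))
  moreover have "snd (snd (\<Xi> (?st x)) (LT.tot_chart U \<kappa> (V \<inter> V') (tens_triv \<psi> \<theta>)))
      = (tens (?s (\<kappa> x)) (?dt ?X) + tens (?ds ?X) (?t (\<kappa> x))) - tens_triv \<psi> \<theta> (D ?st x)"
    using LT.\<Xi>_fibre_component[OF U(1) VT(1) st U(2) VT(2)] by (simp add: dst)
  moreover have "?s (\<kappa> x) = \<psi> e" "?t (\<kappa> x) = \<theta> f" by (simp_all add: E.chart_inv[OF U] s(2) t(2))
  moreover have "snd (snd (\<Xi>\<^sub>E e) (E.tot_chart U \<kappa> V \<psi>)) = ?ds ?X - \<psi> (D\<^sub>E s x)"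
    using LE.\<Xi>_fibre_component[OF U(1) V(1) s(1) U(2) V(2)] by (simp add: s(2))
  moreover have "snd (snd (\<Xi>\<^sub>F f) (F.tot_chart U \<kappa> V' \<theta>)) = ?dt ?X - \<theta> (D\<^sub>F t x)"
    using LF.\<Xi>_fibre_component[OF U(1) V'(1) t(1) U(2) V'(2)] by (simp add: t(2))
  ultimately show ?thesis
    by (simp add: st_x bounded_bilinear.diff_left[OF bounded_bilinear_tens] bounded_bilinear.diff_right[OF bounded_bilinear_tens])
qed

text \<open>Works with curves instead of flows: the tensor product of the two lifts is itself the
  integral curve that witnesses \<open>reaches\<close>.\<close>

lemma reaches_tensor:
  assumes b: "bproj E e = bproj F f"
    and e: "reaches (tot M E) \<Xi>\<^sub>E t e e'" and f: "reaches (tot M F) \<Xi>\<^sub>F t f f'"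
  shows "reaches (tot M T) \<Xi> t (tensor E F e f) (tensor E F e' f')"
proof -
  obtain I c where I: "open I" "is_interval I" "0 \<in> I" "t \<in> I" and c: "integral_curve (tot M E) \<Xi>\<^sub>E I c" "c 0 = e" "c t = e'"
    using e unfolding reaches_def by blast
  obtain I' d where I': "open I'" "is_interval I'" "0 \<in> I'" "t \<in> I'" and d: "integral_curve (tot M F) \<Xi>\<^sub>F I' d" "d 0 = f" "d t = f'"
    using f unfolding reaches_def by blast
  define J where "J = I \<inter> I'"
  have J: "open J" "is_interval J" "0 \<in> J" "t \<in> J"
    using I I' is_interval_Int by (auto simp: J_def)
  have cJ: "integral_curve (tot M E) \<Xi>\<^sub>E J c" and dJ: "integral_curve (tot M F) \<Xi>\<^sub>F J d"
    unfolding J_def by (rule E.tot.integral_curve_subset[OF c(1)] F.tot.integral_curve_subset[OF d(1)]; simp)+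
  let ?b = "bproj E \<circ> c"
  note base = LE.lift_base[OF J(1) cJ]
  \<comment> \<open>The two lifts were obtained independently; uniqueness in \<open>M\<close> gives
    them a common base curve, so that their tensor product makes sense.\<close>
  have b': "bproj F (d s) = bproj E (c s)" if "s \<in> J" for s
    using E.integral_curve_unique[OF LE.X_vf J(1,2) LF.lift_base[OF J(1) dJ] base J(3) _ that] b c(2) d(2) by simp
  have ff: "c s \<in> fibre E (?b s)" "d s \<in> fibre F (?b s)" if "s \<in> J" for s
    using LE.lift_in_fibre[OF J(1) cJ that] LF.lift_in_fibre[OF J(1) dJ that] b'[OF that] by auto
  have bp: "?b s \<in> pts M" if "s \<in> J" for s using E.integral_curve_in[OF J(1) base that] .
  let ?g = "\<lambda>s. tensor E F (c s) (d s)"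
  have "integral_curve (tot M T) \<Xi> J ?g"
  proof (rule LT.liftI[OF J(1) base])
    fix s assume s: "s \<in> J"
    show "?g s \<in> fibre T (?b s)" by (rule tensor_fibre[OF bp[OF s] ff[OF s]])
    obtain U \<kappa> where U: "(U, \<kappa>) \<in> atlas M" "?b s \<in> U" using E.chart_at_ex[OF bp[OF s]] .
    obtain V \<psi> where V: "(V, \<psi>) \<in> trivs E" "?b s \<in> V" using E.triv_at_ex[OF bp[OF s]] .
    obtain V' \<theta> where V': "(V', \<theta>) \<in> trivs F" "?b s \<in> V'" using F.triv_at_ex[OF bp[OF s]] .
    have oW: "openin (mtop M) (V \<inter> V')" by (intro openin_Int E.triv_openin[OF V(1)] F.triv_openin[OF V'(1)])
    obtain r where r: "0 < r" "ball s r \<subseteq> J" "\<And>q. q \<in> ball s r \<Longrightarrow> ?b q \<in> V \<inter> V'"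
      using E.integral_curve_nbhd[OF J(1) base oW s] V(2) V'(2) by blast
    have "((\<psi> \<circ> c) has_vector_derivative snd (snd (\<Xi>\<^sub>E (c s)) (E.tot_chart U \<kappa> V \<psi>))) (at s)"
      "((\<theta> \<circ> d) has_vector_derivative snd (snd (\<Xi>\<^sub>F (d s)) (F.tot_chart U \<kappa> V' \<theta>))) (at s)"
      using LE.lift_chart_derivative(2)[OF J(1) cJ s U(1) _ V(1)] LF.lift_chart_derivative(2)[OF J(1) dJ s U(1) _ V'(1)]
        U(2) V(2) V'(2) b'[OF s] by simp_all
    \<comment> \<open>The product rule along the curves yields exactly the two summands of
      \<open>\<Xi>_tensor\<close>.\<close>
    from bounded_bilinear.has_vector_derivative[OF bounded_bilinear_tens this]
    have "((\<lambda>q. tens ((\<psi> \<circ> c) q) ((\<theta> \<circ> d) q)) has_vector_derivative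
        snd (snd (\<Xi> (?g s)) (LT.tot_chart U \<kappa> (V \<inter> V') (tens_triv \<psi> \<theta>)))) (at s)"
      using \<Xi>_tensor[OF U V V' ff[OF s]] by (simp add: o_def)
    then have "((tens_triv \<psi> \<theta> \<circ> ?g) has_vector_derivative
        snd (snd (\<Xi> (?g s)) (LT.tot_chart U \<kappa> (V \<inter> V') (tens_triv \<psi> \<theta>)))) (at s)"
    proof (rule has_vector_derivative_transform_within_open[OF _ open_ball])
      show "s \<in> ball s r" using r(1) by simp
      fix q assume q: "q \<in> ball s r"
      then have "q \<in> J" using r(2) by auto
      from tens_triv_tensor[OF V(1) _ V'(1) _ ff[OF this]] r(3)[OF q]
      show "tens ((\<psi> \<circ> c) q) ((\<theta> \<circ> d) q) = (tens_triv \<psi> \<theta> \<circ> ?g) q" by simp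
    qed
    moreover have "(V \<inter> V', tens_triv \<psi> \<theta>) \<in> trivs T" using V V' by (auto simp: trivs_tensor)
    ultimately show "\<exists>U \<kappa> V \<psi>. (U, \<kappa>) \<in> atlas M \<and> (V, \<psi>) \<in> trivs T \<and> ?b s \<in> U \<and> ?b s \<in> V \<and>
        ((\<psi> \<circ> ?g) has_vector_derivative snd (snd (\<Xi> (?g s)) (LT.tot_chart U \<kappa> V \<psi>))) (at s)"
      using U V V'
      by (intro exI[of _ U] exI[of _ \<kappa>] exI[of _ "V \<inter> V'"] exI[of _ "tens_triv \<psi> \<theta>"]) simp
  qed
  then show ?thesis unfolding reaches_def
    using J c d by (intro exI[of _ J] exI[of _ ?g]) simp
qed

end

text \<open>Elementary tensors do not fill a fibre, but they span it, so their images determine the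
  flow together with the additivity and homogeneity stated alongside. Membership of \<open>e\<close>
  and \<open>f\<close> in their own flow domains belongs to the claim because \<open>flow\<close> is
  a definite description and carries information only there.\<close>

theorem mainTheorem8:
  fixes M :: "('p, 'a::banach) manifold"
    and E :: "('p, 'e, 'v::banach) vbundle"
    and F :: "('p, 'f, 'w::banach) vbundle"
  assumes "smooth_vector_bundle M E" and "smooth_vector_bundle M F"
    and "linear_derivation M E X D\<^sub>E" and "linear_derivation M F X D\<^sub>F"
    and "linear_derivation M (tensor_bundle M E F) X D"
    and "\<forall>e\<in>sections M E. \<forall>f\<in>sections M F.
      D (sec_tensor M E F e f) =
        sec_add M (tensor_bundle M E F) (sec_tensor M E F (D\<^sub>E e) f) (sec_tensor M E F e (D\<^sub>F f))"
    and "associated_vector_field M E X D\<^sub>E \<Xi>\<^sub>E"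
    and "associated_vector_field M F X D\<^sub>F \<Xi>\<^sub>F"
    and "associated_vector_field M (tensor_bundle M E F) X D \<Xi>"
  shows "let T = tensor_bundle M E F;
             \<phi> = flow M X;
             \<Phi>\<^sub>E = flow (tot M E) \<Xi>\<^sub>E;
             \<Phi>\<^sub>F = flow (tot M F) \<Xi>\<^sub>F;
             \<Phi> = flow (tot M T) \<Xi>
         in flow_dom (tot M T) \<Xi> = {(t, \<tau>). \<tau> \<in> tspace T \<and> (t, bproj T \<tau>) \<in> flow_dom M X} \<and>
            (\<forall>(t, x)\<in>flow_dom M X.
               (\<forall>\<tau>\<in>fibre T x. \<Phi> t \<tau> \<in> fibre T (\<phi> t x) \<and>
                  (\<forall>r. \<Phi> t (fscale T r \<tau>) = fscale T r (\<Phi> t \<tau>)) \<and>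
                  (\<forall>\<tau>'\<in>fibre T x. \<Phi> t (fadd T \<tau> \<tau>') = fadd T (\<Phi> t \<tau>) (\<Phi> t \<tau>'))) \<and>
               (\<forall>e\<in>fibre E x. \<forall>f\<in>fibre F x.
                  (t, e) \<in> flow_dom (tot M E) \<Xi>\<^sub>E \<and> (t, f) \<in> flow_dom (tot M F) \<Xi>\<^sub>F \<and>
                  \<Phi> t (tensor E F e f) = tensor E F (\<Phi>\<^sub>E t e) (\<Phi>\<^sub>F t f)))"
proof -
  interpret bundle_pair M E F
    using assms(1,2) by (simp add: bundle_pair_def smooth_bundle_def)
  interpret tensor_fields M E F X D\<^sub>E D\<^sub>F D \<Xi>\<^sub>E \<Xi>\<^sub>F \<Xi>
    by unfold_locales (use assms smooth_vector_bundle_tensor in auto)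
  \<comment> \<open>Each equation between flows below comes from a curve with the right end point:
    \<open>LT.flow_tot_eq\<close> turns a \<open>reaches\<close> fact into a value of the
    flow.\<close>
  note T_flow = LT.flow_tot_eq and T_dom = LT.flow_dom_tot
  have T_in: "(t, \<tau>) \<in> flow_dom (tot M T) \<Xi>" if "(t, x) \<in> flow_dom M X" "\<tau> \<in> fibre T x" for t x \<tau>
    using that by (auto simp: T_dom fibre_def)
  have scale: "flow (tot M T) \<Xi> t (fscale T r \<tau>) = fscale T r (flow (tot M T) \<Xi> t \<tau>)"
    if "(t, x) \<in> flow_dom M X" "\<tau> \<in> fibre T x" for t x \<tau> r
    by (rule T_flow[OF LT.reaches_scale[OF _ LT.reaches_flow[OF T_in[OF that]]]]) (use that in \<open>simp add: fibre_def\<close>)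
  have add: "flow (tot M T) \<Xi> t (fadd T \<tau> \<tau>') = fadd T (flow (tot M T) \<Xi> t \<tau>) (flow (tot M T) \<Xi> t \<tau>')"
    if "(t, x) \<in> flow_dom M X" "\<tau> \<in> fibre T x" "\<tau>' \<in> fibre T x" for t x \<tau> \<tau>'
    by (rule T_flow[OF LT.reaches_add[OF _ LT.reaches_flow[OF T_in[OF that(1,2)]] LT.reaches_flow[OF T_in[OF that(1,3)]]]])
      (use that in \<open>simp add: fibre_def\<close>)
  have E_in: "(t, e) \<in> flow_dom (tot M E) \<Xi>\<^sub>E" if "(t, x) \<in> flow_dom M X" "e \<in> fibre E x" for t x e
    using that by (auto simp: LE.flow_dom_tot fibre_def)
  have F_in: "(t, f) \<in> flow_dom (tot M F) \<Xi>\<^sub>F" if "(t, x) \<in> flow_dom M X" "f \<in> fibre F x" for t x f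
    using that by (auto simp: LF.flow_dom_tot fibre_def)
  have "flow (tot M T) \<Xi> t (tensor E F e f) = tensor E F (flow (tot M E) \<Xi>\<^sub>E t e) (flow (tot M F) \<Xi>\<^sub>F t f)"
    if "(t, x) \<in> flow_dom M X" "e \<in> fibre E x" "f \<in> fibre F x" for t x e f
    by (rule T_flow[OF reaches_tensor[OF _ LE.reaches_flow[OF E_in[OF that(1,2)]] LF.reaches_flow[OF F_in[OF that(1,3)]]]])
      (use that in \<open>simp add: fibre_def\<close>)
  then show ?thesis
    unfolding Let_def using T_dom scale add LT.flow_in_fibre E_in F_in by fast
qed

end
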